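(* Let $M$ be an orientable surface whose fundamental group is infinite cyclic. Then $M$ is dichotomic, i.e. for every Jordan curve (embedded circle) $J\subset M$ the complement $M\setminus J$ is disconnected.
   Context: A surface is a connected Hausdorff topological $2$-manifold without boundary, NOT assumed metrizable or second countable. *)

theory Defs
  imports "HOL-Homology.Homology"
begin

text \<open>Neither second countability nor metrizability is required of a surface.\<close>

definition surface :: "'a topology \<Rightarrow> bool" where
  "surface X \<longleftrightarrow>
     connected_space X \<and> Hausdorff_space X \<and>
     (\<forall>x \<in> topspace X. \<exists>U. openin X U \<and> x \<in> U \<and>
        subtopology X U homeomorphic_space Euclidean_space 2)"

text \<open>
  Orientations are the usual homological ones: a choice of a generator of the local homology
  group \<open>H\<^sub>2(X, X - x; \<int>)\<close> at each point \<open>x\<close> that is locally constant, in the sense that near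
  every point all the chosen generators are images of one class in \<open>H\<^sub>2(X, X - U; \<int>)\<close>.
  This makes sense without any countability assumption.
\<close>

definition local_homology :: "'a topology \<Rightarrow> 'a set \<Rightarrow> 'a chain set monoid" where
  "local_homology X U = relative_homology_group 2 X (topspace X - U)"

definition surface_orientation :: "'a topology \<Rightarrow> ('a \<Rightarrow> 'a chain set) \<Rightarrow> bool" where
  "surface_orientation X \<mu> \<longleftrightarrow>
     (\<forall>x \<in> topspace X.
        \<mu> x \<in> carrier (local_homology X {x}) \<and>
        subgroup_generated (local_homology X {x}) {\<mu> x} = local_homology X {x}) \<and>
     (\<forall>x \<in> topspace X. \<exists>U. openin X U \<and> x \<in> U \<and>
        (\<exists>\<alpha> \<in> carrier (local_homology X U). \<forall>y \<in> U.
           hom_induced 2 X (topspace X - U) X (topspace X - {y}) id \<alpha> = \<mu> y))"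

definition orientable :: "'a topology \<Rightarrow> bool" where
  "orientable X \<longleftrightarrow> (\<exists>\<mu>. surface_orientation X \<mu>)"

text \<open>
  The library's \<open>homotopic_paths\<close> and \<open>joinpaths\<close> are confined to types of class
  \<open>topological_space\<close>; the following are their counterparts for loops in an abstract topology.
\<close>

definition loops :: "'a topology \<Rightarrow> 'a \<Rightarrow> (real \<Rightarrow> 'a) set" where
  "loops X x0 = {p. pathin X p \<and> p 0 = x0 \<and> p 1 = x0}"

definition homotopic_loops_at :: "'a topology \<Rightarrow> 'a \<Rightarrow> (real \<Rightarrow> 'a) \<Rightarrow> (real \<Rightarrow> 'a) \<Rightarrow> bool" where
  "homotopic_loops_at X x0 =
     homotopic_with (\<lambda>r. r 0 = x0 \<and> r 1 = x0) (top_of_set {0..1}) X"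

definition loop_join :: "(real \<Rightarrow> 'a) \<Rightarrow> (real \<Rightarrow> 'a) \<Rightarrow> real \<Rightarrow> 'a" where
  "loop_join p q = (\<lambda>t. if t \<le> 1/2 then p (2 * t) else q (2 * t - 1))"

definition loop_class :: "'a topology \<Rightarrow> 'a \<Rightarrow> (real \<Rightarrow> 'a) \<Rightarrow> (real \<Rightarrow> 'a) set" where
  "loop_class X x0 p = {q. homotopic_loops_at X x0 p q}"

text \<open>The product of the classes of \<open>p\<close> and \<open>q\<close> is the class of \<open>loop_join p q\<close>; it is written
  as a union over all representatives to avoid choosing any.\<close>

definition fundamental_group :: "'a topology \<Rightarrow> 'a \<Rightarrow> (real \<Rightarrow> 'a) set monoid" where
  "fundamental_group X x0 =
     \<lparr>carrier = loop_class X x0 ` loops X x0,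
      monoid.mult = (\<lambda>A B. \<Union>p \<in> A. \<Union>q \<in> B. loop_class X x0 (loop_join p q)),
      one = loop_class X x0 (\<lambda>t. x0)\<rparr>"

definition jordan_curve :: "'a topology \<Rightarrow> 'a set \<Rightarrow> bool" where
  "jordan_curve X J \<longleftrightarrow> (\<exists>f. embedding_map (nsphere 1) X f \<and> J = f ` topspace (nsphere 1))"

definition dichotomic :: "'a topology \<Rightarrow> bool" where
  "dichotomic X \<longleftrightarrow>
     (\<forall>J. jordan_curve X J \<longrightarrow> \<not> connected_space (subtopology X (topspace X - J)))"

end

theory Submission
  imports Defs "HOL-Complex_Analysis.Complex_Analysis"
begin

text \<open>
  The change of \<open>log f\<close> along a loop, for a continuous function \<open>f: M \<rightarrow> \<complex> - {0}\<close>, is additive and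
  homotopy invariant, so \<open>f\<close> defines a homomorphism from the fundamental group of \<open>M\<close> to the integers;
  if that group is infinite cyclic, any two such homomorphisms are proportional. For a Jordan curve \<open>J\<close>
  with connected complement there are two functions that contradict this: \<open>f\<^sub>1\<close> has no turning along \<open>J\<close> but
  turns along some other loop, and \<open>f\<^sub>2\<close> turns along \<open>J\<close>.

  Orientability makes \<open>J\<close> two-sided, and \<open>f\<^sub>1\<close> is \<open>exp (\<plusminus> \<i> \<pi> \<rho>)\<close> on the two sides, where the bump function \<open>\<rho>\<close> is \<open>1\<close>
  on \<open>J\<close> and \<open>0\<close> off a neighbourhood of \<open>J\<close>. In a disc that meets \<open>J\<close>, two points \<open>x\<close>, \<open>y\<close> lie on different sides
  iff the function \<open>(z - x) / (z - y)\<close>, deformed to \<open>1\<close> outside the disc, turns along \<open>J\<close>. For \<open>f\<^sub>2\<close>, divide such a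
  function by one with the same simple zero and simple pole that has no turning along \<open>J\<close>; the latter is a product
  over a chain of discs that lead from \<open>x\<close> to \<open>y\<close> off \<open>J\<close>. The singularities cancel because the charts are compatibly
  oriented.

  The local statements follow from the Jordan curve theorem in the plane, after a small arc of \<open>J\<close> has been
  completed to a Jordan curve inside a chart. The homological orientation is used only to choose charts with
  transition maps of local degree \<open>1\<close>: the class \<open>\<mu> x\<close> is mapped by the boundary and by the direction of
  \<open>\<phi> z - \<phi> x\<close> to a generator of \<open>H\<^sub>1\<close> of the circle, which is required to be the same for all charts.
\<close>

subsection \<open>Change of logarithm along a path\<close>

text \<open>\<open>M\<close> may be neither metrizable nor normal, and it carries no triangulation
  or smooth structure, so continuous logarithms take the place of intersection numbers. Global
  constructions rest on the compactness of \<open>J\<close>, on the connectedness of its complement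
  and on nonvanishing functions that are 1 off a disc. Such a function has a global logarithm,
  because a disc has connected complement in its chart plane; multiplying by it does not affect the
  turning along \<open>J\<close>. In charts that are merely continuous, zeros and poles have no
  power series. They are defined up to a factor \<open>exp \<kappa>\<close> with
  \<open>\<kappa>\<close> continuous on a punctured neighbourhood. This suffices: a singularity of
  order 0 is removed by cutting off \<open>\<kappa>\<close> near the point. A transition map of
  local degree 1 changes a coordinate difference by just such a factor, whereas degree -1 would
  interchange zeros and poles. This is the only way in which the orientation enters.\<close>

lemma continuous_logs_differ_by_const:
  fixes l m :: "'b::topological_space \<Rightarrow> complex"
  assumes S: "connected S" and l: "continuous_on S l" and m: "continuous_on S m"
    and eq: "\<And>x. x \<in> S \<Longrightarrow> exp (l x) = exp (m x)"
  shows "\<exists>n::int. \<forall>x\<in>S. l x = m x + 2 * of_real pi * \<i> * of_int n"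
proof (cases "S = {}")
  case True
  then show ?thesis by simp
next
  case False
  have int: "\<exists>n::int. l x - m x = 2 * of_real pi * \<i> * of_int n" if "x \<in> S" for x
    using eq[OF that] unfolding exp_eq by (auto simp: algebra_simps)
  have "(\<lambda>x. l x - m x) constant_on S"
  proof (rule continuous_discrete_range_constant[OF S])
    show "continuous_on S (\<lambda>x. l x - m x)"
      by (intro continuous_intros l m)
    fix x assume x: "x \<in> S"
    show "\<exists>e>0. \<forall>y. y \<in> S \<and> l y - m y \<noteq> l x - m x \<longrightarrow> e \<le> norm (l y - m y - (l x - m x))"
    proof (intro exI[of _ "2*pi"] conjI allI impI)
      fix y assume y: "y \<in> S \<and> l y - m y \<noteq> l x - m x"
      obtain a b :: int where a: "l x - m x = 2 * of_real pi * \<i> * of_int a"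
        and b: "l y - m y = 2 * of_real pi * \<i> * of_int b"
        using int x y by meson
      with y have "b \<noteq> a" by auto
      have "l y - m y - (l x - m x) = 2 * of_real pi * \<i> * of_int (b - a)"
        by (simp add: a b algebra_simps)
      then have "norm (l y - m y - (l x - m x)) = 2 * pi * \<bar>of_int (b - a)\<bar>"
        by (simp add: norm_mult flip: of_int_diff)
      moreover have "\<bar>of_int (b - a) :: real\<bar> \<ge> 1" using \<open>b \<noteq> a\<close> by linarith
      ultimately show "2*pi \<le> norm (l y - m y - (l x - m x))" by simp
    qed simp
  qed
  then obtain c where c: "\<And>x. x \<in> S \<Longrightarrow> l x - m x = c"
    unfolding constant_on_def by auto
  obtain x where "x \<in> S" using False by auto
  then obtain n :: int where "c = 2 * of_real pi * \<i> * of_int n" using int c by metis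
  then have "\<forall>x\<in>S. l x = m x + 2 * of_real pi * \<i> * of_int n"
    using c by (metis add.commute diff_add_cancel)
  then show ?thesis by blast
qed

text \<open>Unspecified unless \<open>g\<close> has a continuous logarithm on \<open>{a..b}\<close>.\<close>
definition dlog :: "real \<Rightarrow> real \<Rightarrow> (real \<Rightarrow> complex) \<Rightarrow> complex" where
  "dlog a b g = (SOME d. \<exists>l. continuous_on {a..b} l \<and> (\<forall>t\<in>{a..b}. g t = exp (l t)) \<and> d = l b - l a)"

text \<open>Two logarithms of \<open>g\<close> on an interval differ by a constant, so the choice
  made by \<open>SOME\<close> is immaterial.\<close>

lemma dlog_eq:
  assumes "a \<le> b" "continuous_on {a..b} l" "\<And>t. t \<in> {a..b} \<Longrightarrow> g t = exp (l t)"
  shows "dlog a b g = l b - l a"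
proof -
  have "\<exists>d l. continuous_on {a..b} l \<and> (\<forall>t\<in>{a..b}. g t = exp (l t)) \<and> d = l b - l a"
    using assms by blast
  from someI_ex[OF this] obtain m where m: "continuous_on {a..b} m" "\<forall>t\<in>{a..b}. g t = exp (m t)"
      "dlog a b g = m b - m a"
    unfolding dlog_def by blast
  obtain n :: int where n: "\<forall>x\<in>{a..b}. l x = m x + 2 * of_real pi * \<i> * of_int n"
    using continuous_logs_differ_by_const[of "{a..b}" l m] assms m by auto
  show ?thesis using n assms(1) m(3) by simp
qed

lemma log_exists:
  fixes g :: "real \<Rightarrow> complex"
  assumes "continuous_on {a..b} g" "\<And>t. t \<in> {a..b} \<Longrightarrow> g t \<noteq> 0"
  obtains l where "continuous_on {a..b} l" "\<And>t. t \<in> {a..b} \<Longrightarrow> g t = exp (l t)"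
proof (cases "{a..b} = {}")
  case True
  then show ?thesis using that[of "\<lambda>_. 0"] by simp
next
  case False
  have "contractible {a..b}"
    by (simp add: convex_imp_contractible)
  from continuous_logarithm_on_contractible[OF assms(1) this assms(2)] show ?thesis
    using that by metis
qed

lemma dlog_cong:
  assumes "\<And>t. t \<in> {a..b} \<Longrightarrow> g t = h t"
  shows "dlog a b g = dlog a b h"
  unfolding dlog_def using assms by (metis (mono_tags, lifting))

lemma dlog_mult:
  assumes "a \<le> b" "continuous_on {a..b} g" "\<And>t. t \<in> {a..b} \<Longrightarrow> g t \<noteq> 0"
    and "continuous_on {a..b} h" "\<And>t. t \<in> {a..b} \<Longrightarrow> h t \<noteq> 0"
  shows "dlog a b (\<lambda>t. g t * h t) = dlog a b g + dlog a b h"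
proof -
  obtain l where l: "continuous_on {a..b} l" "\<And>t. t \<in> {a..b} \<Longrightarrow> g t = exp (l t)"
    using log_exists[OF assms(2,3)] by blast
  obtain m where m: "continuous_on {a..b} m" "\<And>t. t \<in> {a..b} \<Longrightarrow> h t = exp (m t)"
    using log_exists[OF assms(4,5)] by blast
  have "dlog a b (\<lambda>t. g t * h t) = (l b + m b) - (l a + m a)"
    by (intro dlog_eq[where l="\<lambda>t. l t + m t"] continuous_on_add l(1) m(1) assms(1))
       (simp add: l(2) m(2) exp_add)
  moreover have "dlog a b g = l b - l a" using assms(1) l by (rule dlog_eq)
  moreover have "dlog a b h = m b - m a" using assms(1) m by (rule dlog_eq)
  ultimately show ?thesis by simp
qed

lemma dlog_divide:
  assumes "a \<le> b" "continuous_on {a..b} g" "\<And>t. t \<in> {a..b} \<Longrightarrow> g t \<noteq> 0"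
    and "continuous_on {a..b} h" "\<And>t. t \<in> {a..b} \<Longrightarrow> h t \<noteq> 0"
  shows "dlog a b (\<lambda>t. g t / h t) = dlog a b g - dlog a b h"
proof -
  have "dlog a b g = dlog a b (\<lambda>t. (g t / h t) * h t)"
    by (rule dlog_cong) (use assms in auto)
  also have "\<dots> = dlog a b (\<lambda>t. g t / h t) + dlog a b h"
    by (rule dlog_mult) (use assms in \<open>auto intro!: continuous_intros\<close>)
  finally show ?thesis by simp
qed

lemma dlog_const: "a \<le> b \<Longrightarrow> c \<noteq> 0 \<Longrightarrow> dlog a b (\<lambda>t. c) = 0"
  using dlog_eq[of a b "\<lambda>_. Ln c" "\<lambda>_. c"] by simp

lemma dlog_eq_0:
  assumes "a \<le> b" "\<And>t. t \<in> {a..b} \<Longrightarrow> g t = 1"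
  shows "dlog a b g = 0"
  using dlog_cong[of a b g "\<lambda>_. 1"] dlog_const[of a b 1] assms by simp

lemma dlog_combine:
  assumes "a \<le> b" "b \<le> c" "continuous_on {a..c} g" "\<And>t. t \<in> {a..c} \<Longrightarrow> g t \<noteq> 0"
  shows "dlog a c g = dlog a b g + dlog b c g"
proof -
  obtain l where l: "continuous_on {a..c} l" "\<And>t. t \<in> {a..c} \<Longrightarrow> g t = exp (l t)"
    using log_exists[OF assms(3,4)] by blast
  have "dlog a c g = l c - l a" by (rule dlog_eq) (use l assms in auto)
  moreover have "dlog a b g = l b - l a"
    by (rule dlog_eq) (use l assms in \<open>auto intro: continuous_on_subset[OF l(1)]\<close>)
  moreover have "dlog b c g = l c - l b"
    by (rule dlog_eq) (use l assms in \<open>auto intro: continuous_on_subset[OF l(1)]\<close>)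
  ultimately show ?thesis by simp
qed

lemma dlog_affine:
  assumes "a \<le> b" "c > 0" "continuous_on {c*a+d..c*b+d} g"
    and "\<And>t. t \<in> {c*a+d..c*b+d} \<Longrightarrow> g t \<noteq> 0"
  shows "dlog a b (\<lambda>t. g (c*t+d)) = dlog (c*a+d) (c*b+d) g"
proof -
  obtain l where l: "continuous_on {c*a+d..c*b+d} l" "\<And>t. t \<in> {c*a+d..c*b+d} \<Longrightarrow> g t = exp (l t)"
    using log_exists[OF assms(3,4)] by blast
  have "dlog a b (\<lambda>t. g (c*t+d)) = l (c*b+d) - l (c*a+d)"
    using assms
    by (intro dlog_eq[where l="\<lambda>t. l (c*t+d)"] continuous_on_compose2[OF l(1)] l)
       (auto intro!: continuous_intros)
  moreover have "dlog (c*a+d) (c*b+d) g = l (c*b+d) - l (c*a+d)"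
    by (rule dlog_eq) (use l assms in auto)
  ultimately show ?thesis by simp
qed

lemma dlog_reverse:
  assumes "a \<le> b" "continuous_on {a..b} g" "\<And>t. t \<in> {a..b} \<Longrightarrow> g t \<noteq> 0"
  shows "dlog a b (\<lambda>t. g (a+b-t)) = - dlog a b g"
proof -
  obtain l where l: "continuous_on {a..b} l" "\<And>t. t \<in> {a..b} \<Longrightarrow> g t = exp (l t)"
    using log_exists[OF assms(2,3)] by blast
  have "dlog a b (\<lambda>t. g (a+b-t)) = l (a+b-b) - l (a+b-a)"
    using assms
    by (intro dlog_eq[where l="\<lambda>t. l (a+b-t)"] continuous_on_compose2[OF l(1)] l)
       (auto intro!: continuous_intros)
  moreover have "dlog a b g = l b - l a"
    by (rule dlog_eq) (use l assms in auto)
  ultimately show ?thesis by simp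
qed

text \<open>A logarithm on the whole line satisfies \<open>l (t+1) = l t + 2 * pi * \<i> * n\<close>
  with the same \<open>n\<close> for all \<open>t\<close>, so the increment over a period does not
  depend on where the period starts.\<close>

lemma dlog_periodic:
  assumes g: "continuous_on UNIV g" "\<And>t. g t \<noteq> 0" and per: "\<And>t. g (t+1) = g t"
  shows "dlog a (a+1) g = dlog 0 1 g"
proof -
  have "contractible (UNIV::real set)" by (simp add: convex_imp_contractible)
  then obtain l where l: "continuous_on UNIV l" "\<And>t. g t = exp (l t)"
    using continuous_logarithm_on_contractible[OF g(1)] g(2) by (metis UNIV_I)
  have "continuous_on UNIV (\<lambda>t. l (t+1))"
    by (intro continuous_on_compose2[OF l(1)] continuous_intros) auto
  then obtain n :: int where n: "\<forall>x\<in>UNIV. l (x+1) = l x + 2 * of_real pi * \<i> * of_int n"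
    using continuous_logs_differ_by_const[OF connected_UNIV _ l(1), of "\<lambda>t. l (t+1)"] l(2) per
    by metis
  have *: "dlog c (c+1) g = l (c+1) - l c" for c
    by (rule dlog_eq) (use l in \<open>auto intro: continuous_on_subset[OF l(1)]\<close>)
  show ?thesis using *[of a] *[of 0] n[rule_format, of 0] n[rule_format, of a] by simp
qed

lemma dlog_winding_number:
  assumes "path \<gamma>" "z \<notin> path_image \<gamma>"
  shows "dlog 0 1 (\<lambda>t. \<gamma> t - z) = 2 * of_real pi * \<i> * winding_number \<gamma> z"
proof -
  obtain q where q: "path q" "pathfinish q - pathstart q = 2 * of_real pi * \<i> * winding_number \<gamma> z"
      "\<And>t. t \<in> {0..1} \<Longrightarrow> \<gamma> t = z + exp(q t)"
    using winding_number_as_continuous_log[OF assms] by metis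
  have "dlog 0 1 (\<lambda>t. \<gamma> t - z) = q 1 - q 0"
    by (rule dlog_eq) (use q in \<open>auto simp: path_def\<close>)
  then show ?thesis using q by (simp add: pathfinish_def pathstart_def)
qed

text \<open>A logarithm on the whole square restricts to one along each path of the homotopy. On the
  two edges where \<open>H\<close> is constant the logarithm is constant too, so all paths have the
  same increment.\<close>

lemma dlog_homotopy:
  fixes H :: "real \<times> real \<Rightarrow> complex"
  assumes H: "continuous_on ({0..1} \<times> {0..1}) H" "\<And>x. x \<in> {0..1} \<times> {0..1} \<Longrightarrow> H x \<noteq> 0"
    and 0: "\<And>s. s \<in> {0..1} \<Longrightarrow> H (s,0) = u" and 1: "\<And>s. s \<in> {0..1} \<Longrightarrow> H (s,1) = v"
  shows "dlog 0 1 (\<lambda>t. H (0,t)) = dlog 0 1 (\<lambda>t. H (1,t))"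
proof -
  have "convex ({0..1::real} \<times> {0..1::real})" by (intro convex_Times convex_real_interval)
  then have "contractible ({0..1::real} \<times> {0..1::real})" by (rule convex_imp_contractible)
  from continuous_logarithm_on_contractible[OF H(1) this H(2)]
  obtain L where L: "continuous_on ({0..1} \<times> {0..1}) L"
      "\<And>x. x \<in> {0..1} \<times> {0..1} \<Longrightarrow> H x = exp (L x)" by metis
  have *: "dlog 0 1 (\<lambda>t. H (s,t)) = L (s,1) - L (s,0)" if "s \<in> {0..1}" for s
    by (rule dlog_eq[where l="\<lambda>t. L (s,t)"])
       (use that L in \<open>auto intro!: continuous_on_compose2[OF L(1)] continuous_intros\<close>)
  have c: "L (0,e) = L (1,e)" if e: "e = 0 \<or> e = 1" for e
  proof -
    have "continuous_on {0..1} (\<lambda>s. L (s,e))"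
      using e by (auto intro!: continuous_on_compose2[OF L(1)] continuous_intros)
    moreover have "exp (L (s,e)) = exp (L (0,e))" if "s \<in> {0..1}" for s
      using L(2)[of "(s,e)"] L(2)[of "(0,e)"] 0[of s] 1[of s] 0[of 0] 1[of 0] that e by force
    ultimately obtain n :: int where n: "\<forall>x\<in>{0..1}. L (x,e) = L (0,e) + 2 * of_real pi * \<i> * of_int n"
      using continuous_logs_differ_by_const[of "{0..1::real}" "\<lambda>s. L (s,e)" "\<lambda>_. L (0,e)"]
      using connected_Icc continuous_on_const by blast
    have "n = 0" using n[rule_format, of 0] by simp
    then show ?thesis using n[rule_format, of 1] by simp
  qed
  have "dlog 0 1 (\<lambda>t. H (0,t)) = L (0,1) - L (0,0)" by (rule *) simp
  also have "\<dots> = L (1,1) - L (1,0)" by (simp only: c simp_thms)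
  also have "\<dots> = dlog 0 1 (\<lambda>t. H (1,t))" by (rule *[symmetric]) simp
  finally show ?thesis .
qed

text \<open>Lifted along \<open>exp\<close> to a half-plane, \<open>g\<close> has a logarithm
  \<open>l\<close>. The period \<open>2 * pi * \<i>\<close> raises \<open>l\<close> by
  \<open>n\<close> times itself, so \<open>l w - n * w\<close> is periodic and descends to the
  punctured ball. The exponent is thus the winding number of \<open>g\<close> around the
  origin.\<close>

lemma punctured_ball_power_exp:
  fixes g :: "complex \<Rightarrow> complex"
  assumes g: "continuous_on (ball 0 r - {0}) g" "\<And>z. z \<in> ball 0 r - {0} \<Longrightarrow> g z \<noteq> 0" and r: "r > 0"
  shows "\<exists>(k::int) \<kappa>. continuous_on (ball 0 r - {0}) \<kappa> \<and>
           (\<forall>z \<in> ball 0 r - {0}. g z = z powi k * exp (\<kappa> z))"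
proof -
  define S where "S = {w::complex. Re w < ln r}"
  have inS: "w \<in> S \<longleftrightarrow> exp w \<in> ball 0 r - {0}" for w
    using r by (auto simp: S_def dist_norm norm_exp_eq_Re)
               (metis exp_less_cancel_iff exp_ln less_irrefl)+
  have "convex S" unfolding S_def by (rule convex_halfspace_Re_lt)
  then have S: "contractible S" "connected S"
    by (auto intro: convex_imp_contractible convex_connected)
  have "continuous_on S (\<lambda>w. g (exp w))"
    by (intro continuous_on_compose2[OF g(1)] continuous_intros) (use inS in auto)
  from continuous_logarithm_on_contractible[OF this S(1)] g(2) inS
  obtain l where l: "continuous_on S l" "\<And>w. w \<in> S \<Longrightarrow> g (exp w) = exp (l w)" by metis
  have Sadd: "w + 2 * of_real pi * \<i> * of_int j \<in> S \<longleftrightarrow> w \<in> S" for w and j :: int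
    by (simp add: S_def)
  obtain n :: int where n: "\<forall>w\<in>S. l (w + 2 * of_real pi * \<i>) = l w + 2 * of_real pi * \<i> * of_int n"
  proof -
    have Sadd1: "w + 2 * of_real pi * \<i> \<in> S \<longleftrightarrow> w \<in> S" for w
      using Sadd[of w 1] by simp
    have "\<exists>n::int. \<forall>w\<in>S. l (w + 2 * of_real pi * \<i>) = l w + 2 * of_real pi * \<i> * of_int n"
    proof (rule continuous_logs_differ_by_const[OF S(2) _ l(1)])
      show "continuous_on S (\<lambda>w. l (w + 2 * of_real pi * \<i>))"
        by (intro continuous_on_compose2[OF l(1)] continuous_intros) (use Sadd1 in auto)
      show "exp (l (w + 2 * of_real pi * \<i>)) = exp (l w)" if "w \<in> S" for w
        using that l(2)[of w] l(2)[of "w + 2 * of_real pi * \<i>"] Sadd1[of w]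
        by (simp add: exp_add)
    qed
    then show ?thesis using that by blast
  qed
  define m where "m w = l w - of_int n * w" for w
  have m1: "m (w + 2 * of_real pi * \<i>) = m w" if "w \<in> S" for w
    using n that by (simp add: m_def algebra_simps)
  have mn: "m (w + 2 * of_real pi * \<i> * of_nat j) = m w" if "w \<in> S" for w j
  proof (induction j)
    case (Suc j)
    have "w + 2 * of_real pi * \<i> * of_nat j \<in> S" using that Sadd[of w "int j"] by simp
    from m1[OF this] Suc show ?case by (simp add: algebra_simps)
  qed simp
  have mexp: "m w = m w'" if w: "w \<in> S" "w' \<in> S" "exp w = exp w'" for w w'
  proof -
    obtain j :: int where j: "w = w' + of_int (2 * j) * complex_of_real pi * \<i>"
      using w(3) unfolding exp_eq by auto
    show ?thesis
    proof (cases "j \<ge> 0")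
      case True
      then have "w = w' + 2 * of_real pi * \<i> * of_nat (nat j)" using j by simp
      then show ?thesis using mn[OF w(2)] by simp
    next
      case False
      then have "w' = w + 2 * of_real pi * \<i> * of_nat (nat (-j))" using j by simp
      then show ?thesis using mn[OF w(1)] by simp
    qed
  qed
  have mcont: "continuous_on S m" unfolding m_def by (intro continuous_intros l)
  define \<kappa> where "\<kappa> z = m (Ln z)" for z
  have LnS: "Ln z \<in> S" if "z \<in> ball 0 r - {0}" for z
    using that inS[of "Ln z"] by simp
  have "g z = z powi n * exp (\<kappa> z)" if "z \<in> ball 0 r - {0}" for z
  proof -
    have "g z = exp (l (Ln z))" using l(2)[OF LnS[OF that]] that by simp
    also have "l (Ln z) = of_int n * Ln z + \<kappa> z" by (simp add: m_def \<kappa>_def)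
    also have "exp \<dots> = exp (Ln z) powi n * exp (\<kappa> z)" by (simp add: exp_add exp_power_int mult.commute)
    finally show ?thesis using that by simp
  qed
  moreover have "continuous_on (ball 0 r - {0}) \<kappa>"
  proof -
    have op: "open (ball 0 r - {0::complex})" by (simp add: open_delete)
    define A where "A = (ball 0 r - {0::complex}) \<inter> - \<real>\<^sub>\<le>\<^sub>0"
    define B where "B = (ball 0 r - {0}) \<inter> uminus -` (- \<real>\<^sub>\<le>\<^sub>0 :: complex set)"
    have oA: "open A" unfolding A_def
      by (rule open_Int[OF op]) (simp add: open_Compl closed_nonpos_Reals_complex)
    have oB: "open B" unfolding B_def
      by (intro open_Int[OF op] open_vimage)
         (auto simp: open_Compl closed_nonpos_Reals_complex intro: continuous_intros)
    have "continuous_on A \<kappa>" unfolding \<kappa>_def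
      by (intro continuous_on_compose2[OF mcont] continuous_intros)
         (use LnS in \<open>force simp: A_def\<close>)+
    \<comment> \<open>\<open>Ln\<close> jumps on the negative axis. The branch
      \<open>Ln (-z) + \<i> * pi\<close> is continuous there, and \<open>m\<close> takes the same
      value on both branches, being constant on the fibres of \<open>exp\<close>.\<close>
    moreover have "continuous_on B \<kappa>"
    proof (rule continuous_on_eq)
      have S2: "Ln (-z) + \<i> * pi \<in> S" if "z \<in> B" for z
        using that inS[of "Ln (-z) + \<i> * pi"] by (simp add: B_def exp_add exp_Ln)
      show "continuous_on B (\<lambda>z. m (Ln (-z) + \<i> * pi))"
        by (intro continuous_on_compose2[OF mcont] continuous_intros) (use S2 in \<open>force simp: B_def\<close>)+
      show "m (Ln (-z) + \<i> * pi) = \<kappa> z" if "z \<in> B" for z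
        unfolding \<kappa>_def by (rule mexp) (use that S2 LnS in \<open>auto simp: B_def exp_add\<close>)
    qed
    moreover have "A \<union> B = ball 0 r - {0}"
      by (auto simp: A_def B_def complex_nonpos_Reals_iff complex_eq_iff)
    ultimately show ?thesis using continuous_on_open_Un[OF oA oB] by metis
  qed
  ultimately show ?thesis by blast
qed

subsection \<open>Plane topology\<close>

text \<open>By injectivity the image of a small circle is a Jordan curve, and
  \<open>\<tau> z0\<close> lies inside it. The exponent is the winding number of this curve around
  \<open>\<tau> z0\<close>, hence 1 or -1.\<close>

lemma injective_local_degree:
  fixes \<tau> :: "complex \<Rightarrow> complex"
  assumes \<Omega>: "open \<Omega>" "z0 \<in> \<Omega>" and cont: "continuous_on \<Omega> \<tau>" and inj: "inj_on \<tau> \<Omega>"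
  obtains k :: int and r \<kappa> where "k = 1 \<or> k = -1" "r > 0" "ball z0 r \<subseteq> \<Omega>" "continuous_on (ball z0 r - {z0}) \<kappa>"
    "\<And>z. z \<in> ball z0 r - {z0} \<Longrightarrow> \<tau> z - \<tau> z0 = (z - z0) powi k * exp (\<kappa> z)"
proof -
  obtain r where r: "r > 0" "ball z0 r \<subseteq> \<Omega>"
    using \<Omega> open_contains_ball by metis
  define g where "g z = \<tau> (z0 + z) - \<tau> z0" for z
  have in_ball: "z0 + z \<in> ball z0 r \<longleftrightarrow> z \<in> ball 0 r" for z
    by (simp add: dist_norm)
  have "continuous_on (ball 0 r - {0}) g"
    unfolding g_def
    by (intro continuous_intros continuous_on_compose2[OF cont]) (auto intro!: subsetD[OF r(2)] simp: dist_norm)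
  moreover have "g z \<noteq> 0" if "z \<in> ball 0 r - {0}" for z
  proof
    assume "g z = 0"
    then have "\<tau> (z0 + z) = \<tau> z0" by (simp add: g_def)
    moreover have "z0 + z \<in> \<Omega>" using that r in_ball by blast
    ultimately have "z0 + z = z0" using inj \<Omega>(2) by (meson inj_onD)
    then show False using that by simp
  qed
  ultimately obtain k :: int and \<kappa> where \<kappa>: "continuous_on (ball 0 r - {0}) \<kappa>"
      "\<And>z. z \<in> ball 0 r - {0} \<Longrightarrow> g z = z powi k * exp (\<kappa> z)"
    using punctured_ball_power_exp[of r g] r(1) by metis
  define s where "s = r / 2"
  have s: "0 < s" "s < r" using r by (auto simp: s_def)
  define \<gamma> where "\<gamma> = \<tau> \<circ> circlepath z0 s"
  have circ: "path_image (circlepath z0 s) = sphere z0 s" using s by simp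
  have sub: "cball z0 s \<subseteq> \<Omega>" using s r(2) by (auto simp: subset_iff)
  have "simple_path (circlepath z0 s)" using s by (simp add: simple_path_circlepath)
  then have simple: "simple_path \<gamma>"
    unfolding \<gamma>_def
    by (rule simple_path_continuous_image)
       (use sub circ in \<open>auto intro!: continuous_on_subset[OF cont] inj_on_subset[OF inj]\<close>)
  have closed: "pathfinish \<gamma> = pathstart \<gamma>"
    by (simp add: \<gamma>_def pathfinish_compose pathstart_compose)
  have img: "path_image \<gamma> = \<tau> ` sphere z0 s" using s by (simp add: \<gamma>_def path_image_compose)
  define T where "T = \<tau> ` ball z0 s"
  have bs: "ball z0 s \<subseteq> \<Omega>" using sub ball_subset_cball by blast
  have disj: "T \<inter> path_image \<gamma> = {}"
  proof -
    have "\<tau> z \<noteq> \<tau> w" if "z \<in> ball z0 s" "w \<in> sphere z0 s" for z w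
    proof
      assume "\<tau> z = \<tau> w"
      moreover have "z \<in> \<Omega>" "w \<in> \<Omega>" using that sub by (auto simp: subset_iff)
      ultimately have "z = w" using inj by (meson inj_onD)
      then show False using that by simp
    qed
    then show ?thesis unfolding T_def img by blast
  qed
  have "open T" unfolding T_def
    by (rule invariance_of_domain) (auto intro!: continuous_on_subset[OF cont bs] inj_on_subset[OF inj bs])
  have z0T: "\<tau> z0 \<in> T" using s by (auto simp: T_def)
  have z0nin: "\<tau> z0 \<notin> path_image \<gamma>" using z0T disj by blast
  have comp: "compact (\<tau> ` cball z0 s)"
    by (intro compact_continuous_image continuous_on_subset[OF cont sub] compact_cball)
  have Tsub: "T \<subseteq> \<tau> ` cball z0 s" unfolding T_def by (intro image_mono ball_subset_cball)
  have "closure T \<subseteq> \<tau> ` cball z0 s"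
    using Tsub comp by (simp add: closure_minimal compact_imp_closed)
  also have "\<dots> = T \<union> path_image \<gamma>"
    unfolding T_def img by (auto simp: image_Un[symmetric] intro!: arg_cong[where f="image \<tau>"])
  finally have fr: "frontier T \<subseteq> path_image \<gamma>"
    using \<open>open T\<close> by (auto simp: frontier_def interior_open)
  note JIO = Jordan_inside_outside[OF simple closed]
  \<comment> \<open>The image \<open>T\<close> of the open disc is open and bounded, with its
    frontier on the curve. If \<open>\<tau> z0\<close> were outside, the connected outside would
    meet both \<open>T\<close> and its complement, hence the frontier of \<open>T\<close>.\<close>
  have "\<tau> z0 \<in> inside (path_image \<gamma>)"
  proof (rule ccontr)
    assume "\<not> ?thesis"
    then have out: "\<tau> z0 \<in> outside (path_image \<gamma>)"
      using z0nin inside_Un_outside[of "path_image \<gamma>"] by blast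
    have "bounded T" using Tsub comp compact_imp_bounded bounded_subset by blast
    then have "outside (path_image \<gamma>) - T \<noteq> {}"
      using JIO bounded_subset[of T "outside (path_image \<gamma>)"] by auto
    moreover have "outside (path_image \<gamma>) \<inter> T \<noteq> {}" using out z0T by blast
    ultimately have "outside (path_image \<gamma>) \<inter> frontier T \<noteq> {}"
      by (intro connected_Int_frontier) (simp_all add: JIO)
    then show False using fr outside_no_overlap by blast
  qed
  then have wn: "winding_number \<gamma> (\<tau> z0) = 1 \<or> winding_number \<gamma> (\<tau> z0) = -1"
    using simple_closed_path_winding_number_inside[OF simple] by blast
  have "dlog 0 1 (\<lambda>t. \<gamma> t - \<tau> z0) = 2 * of_real pi * \<i> * winding_number \<gamma> (\<tau> z0)"
    using simple z0nin by (intro dlog_winding_number) (auto simp: simple_path_imp_path)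
  \<comment> \<open>The same increment, read off from the normal form: \<open>\<kappa>\<close>
    returns to its value after one turn, and only the power contributes.\<close>
  moreover have "dlog 0 1 (\<lambda>t. \<gamma> t - \<tau> z0) = 2 * of_real pi * \<i> * of_int k"
  proof -
    define e where "e t = of_real s * exp (2 * of_real pi * \<i> * of_real t)" for t :: real
    have e: "e t \<in> ball 0 r - {0}" "norm (e t) = s" for t
      using s by (auto simp: e_def norm_mult)
    define l where "l t = of_int k * (of_real (ln s) + 2 * of_real pi * \<i> * of_real t) + \<kappa> (e t)" for t :: real
    have "dlog 0 1 (\<lambda>t. \<gamma> t - \<tau> z0) = l 1 - l 0"
    proof (rule dlog_eq)
      show "continuous_on {0..1} l" unfolding l_def
        by (intro continuous_intros continuous_on_compose2[OF \<kappa>(1)])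
           (use e in \<open>auto simp: e_def intro!: continuous_intros\<close>)
      fix t :: real
      have et: "e t = exp (of_real (ln s) + 2 * of_real pi * \<i> * of_real t)"
        unfolding e_def exp_add exp_of_real using s by simp
      have "exp (l t) = exp (of_int k * (of_real (ln s) + 2 * of_real pi * \<i> * of_real t)) * exp (\<kappa> (e t))"
        unfolding l_def by (rule exp_add)
      also have "exp (of_int k * (of_real (ln s) + 2 * of_real pi * \<i> * of_real t)) = e t powi k"
        unfolding et by (rule exp_power_int[symmetric])
      also have "e t powi k * exp (\<kappa> (e t)) = \<gamma> t - \<tau> z0"
      proof -
        have "\<gamma> t = \<tau> (z0 + e t)" by (simp add: \<gamma>_def circlepath e_def)
        then show ?thesis by (simp only: \<kappa>(2)[OF e(1)[of t], symmetric] g_def)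
      qed
      finally show "\<gamma> t - \<tau> z0 = exp (l t)" by simp
    qed simp
    moreover have "e 1 = e 0" by (simp add: e_def exp_two_pi_i)
    ultimately show ?thesis by (simp add: l_def algebra_simps)
  qed
  ultimately have "winding_number \<gamma> (\<tau> z0) = of_int k" by simp
  then have k: "k = 1 \<or> k = -1" using wn
    by (metis of_int_1 of_int_eq_iff of_int_minus)
  show ?thesis
  proof (rule that[OF k r, of "\<lambda>z. \<kappa> (z - z0)"])
    show "continuous_on (ball z0 r - {z0}) (\<lambda>z. \<kappa> (z - z0))"
      by (intro continuous_on_compose2[OF \<kappa>(1)] continuous_intros) (auto simp: dist_norm norm_minus_commute)
    show "\<tau> z - \<tau> z0 = (z - z0) powi k * exp (\<kappa> (z - z0))" if "z \<in> ball z0 r - {z0}" for z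
      using \<kappa>(2)[of "z - z0"] that by (auto simp: g_def dist_norm norm_minus_commute)
  qed
qed

text \<open>An arc has empty interior in the plane, so some \<open>z\<close> off the arc is close to
  its middle point. The point of the arc nearest to \<open>z\<close> is accessible along the segment
  that joins the two.\<close>

lemma arc_accessible_point:
  fixes \<alpha> :: "real \<Rightarrow> complex"
  assumes cont: "continuous_on {a..b} \<alpha>" and inj: "inj_on \<alpha> {a..b}" and uv: "a \<le> u" "u < v" "v \<le> b"
  obtains t z where "u < t" "t < v" "z \<notin> \<alpha> ` {a..b}" "closed_segment (\<alpha> t) z \<inter> \<alpha> ` {a..b} = {\<alpha> t}"
proof -
  define A where "A = \<alpha> ` {a..b}"
  have "compact A" unfolding A_def by (intro compact_continuous_image cont compact_Icc)
  define m where "m = (u + v) / 2"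
  have m: "u < m" "m < v" "m \<in> {a..b}" using uv by (auto simp: m_def)
  define E where "E = \<alpha> ` ({a..u} \<union> {v..b})"
  have subE: "{a..u} \<union> {v..b} \<subseteq> {a..b}" using uv by auto
  have "compact E" unfolding E_def
    by (intro compact_continuous_image continuous_on_subset[OF cont subE] compact_Un compact_Icc)
  moreover have "\<alpha> m \<notin> E"
  proof
    assume "\<alpha> m \<in> E"
    then obtain t where t: "t \<in> {a..u} \<union> {v..b}" "\<alpha> m = \<alpha> t" unfolding E_def by blast
    then have "m = t" using inj m subE by (meson inj_onD subsetD)
    then show False using t m by auto
  qed
  ultimately obtain \<delta> where \<delta>: "\<delta> > 0" "\<And>y. y \<in> E \<Longrightarrow> \<delta> \<le> dist (\<alpha> m) y"
    using separate_point_closed[of E "\<alpha> m"] compact_imp_closed by blast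
  have "A homeomorphic {a..b}"
    unfolding A_def
    using homeomorphic_compact[OF compact_Icc cont _ inj] homeomorphic_sym by blast
  then have "interior A = {}"
    by (rule empty_interior_lowdim_gen[rotated]) simp
  then have "\<not> ball (\<alpha> m) (\<delta>/2) \<subseteq> A"
    using \<delta>(1) mem_interior[of "\<alpha> m" A] by (metis empty_iff half_gt_zero)
  \<comment> \<open>Half of \<open>\<delta>\<close>, because the point of the arc nearest to
    \<open>z\<close> is no farther from \<open>z\<close> than \<open>\<alpha> m\<close> is, and so
    its distance from \<open>\<alpha> m\<close> is at most twice that of \<open>z\<close>.\<close>
  then obtain z where z: "dist (\<alpha> m) z < \<delta>/2" "z \<notin> A" by (metis mem_ball subsetI)
  have "A \<noteq> {}" using m by (auto simp: A_def)
  then obtain p where p: "p \<in> A" "\<And>y. y \<in> A \<Longrightarrow> dist z p \<le> dist z y"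
    using distance_attains_inf[of A z] \<open>compact A\<close> compact_imp_closed by blast
  obtain t where t: "t \<in> {a..b}" "p = \<alpha> t" using p unfolding A_def by blast
  have "dist z p \<le> dist z (\<alpha> m)" using p m by (auto simp: A_def)
  then have "dist (\<alpha> m) p < \<delta>"
    using z dist_triangle[of "\<alpha> m" p z] by (simp add: dist_commute)
  then have "p \<notin> E" using \<delta>(2) by force
  then have tt: "u < t" "t < v" using t unfolding E_def by (auto simp: not_le[symmetric])
  have "closed_segment p z \<inter> A = {p}"
  proof -
    have "w = p" if w: "w \<in> closed_segment p z" "w \<in> A" for w
    proof -
      have "dist z p \<le> dist z w" using p w by blast
      moreover have "dist z p = dist z w + dist w p"
        using w(1) by (simp add: between_mem_segment[symmetric] between dist_commute)
      ultimately show "w = p" by simp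
    qed
    then show ?thesis using p by auto
  qed
  then show ?thesis using that[of t z] tt z t A_def by simp
qed

text \<open>From accessible points on both sides of \<open>t0\<close>, segments lead off the arc;
  their ends can be joined there because an arc does not separate the plane. The resulting Jordan
  curve agrees with \<open>\<alpha>\<close> near \<open>t0\<close>, which makes the Jordan curve
  theorem available for local questions.\<close>

lemma arc_extends_to_simple_closed_path:
  fixes \<alpha> :: "real \<Rightarrow> complex"
  assumes cont: "continuous_on {a..b} \<alpha>" and inj: "inj_on \<alpha> {a..b}" and t0: "a < t0" "t0 < b"
  obtains s t q where "a < s" "s < t0" "t0 < t" "t < b"
    "simple_path (subpath s t \<alpha> +++ q)" "pathfinish (subpath s t \<alpha> +++ q) = pathstart (subpath s t \<alpha> +++ q)"
    "path q" "pathstart q = \<alpha> t" "\<alpha> t0 \<notin> path_image q"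
proof -
  define A where "A = \<alpha> ` {a..b}"
  obtain s z1 where s: "a < s" "s < t0" "z1 \<notin> A" "closed_segment (\<alpha> s) z1 \<inter> A = {\<alpha> s}"
    using arc_accessible_point[OF cont inj, of a t0] t0 unfolding A_def by auto
  obtain t z2 where t: "t0 < t" "t < b" "z2 \<notin> A" "closed_segment (\<alpha> t) z2 \<inter> A = {\<alpha> t}"
    using arc_accessible_point[OF cont inj, of t0 b] t0 unfolding A_def by auto
  have "A homeomorphic {a..b}"
    unfolding A_def
    using homeomorphic_compact[OF compact_Icc cont _ inj] homeomorphic_sym by blast
  then have "path_connected (- A)"
    by (rule path_connected_complement_homeomorphic_convex_compact) auto
  then obtain h where h: "path h" "path_image h \<subseteq> - A" "pathstart h = z2" "pathfinish h = z1"
    using s(3) t(3) unfolding path_connected_def by (metis ComplI)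
  define P where "P = linepath (\<alpha> t) z2 +++ (h +++ linepath z1 (\<alpha> s))"
  have P: "path P" "pathstart P = \<alpha> t" "pathfinish P = \<alpha> s"
    using h by (auto simp: P_def intro!: path_join_imp)
  have PA: "path_image P \<inter> A \<subseteq> {\<alpha> s, \<alpha> t}"
    using h s t by (auto simp: P_def path_image_join closed_segment_commute[of z1])
  have ne: "\<alpha> t \<noteq> \<alpha> s"
    using inj_onD[OF inj, of t s] s t t0 by auto
  \<comment> \<open>\<open>P\<close> may cross itself; an arc inside its image still meets
    \<open>A\<close> only at the two ends.\<close>
  obtain q where q: "arc q" "path_image q \<subseteq> path_image P" "pathstart q = \<alpha> t" "pathfinish q = \<alpha> s"
    using path_contains_arc[OF P ne] by metis
  have st: "s < t" "{s..t} \<subseteq> {a..b}" using s t by auto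
  have psub: "path_image (subpath s t \<alpha>) = \<alpha> ` {s..t}"
    using st by (simp add: path_image_subpath)
  have "continuous_on {s..t} \<alpha>" "inj_on \<alpha> {s..t}"
    using st(2) cont inj continuous_on_subset inj_on_subset by blast+
  then have arc: "arc (subpath s t \<alpha>)"
  proof -
    assume c: "continuous_on {s..t} \<alpha>" and i: "inj_on \<alpha> {s..t}"
    have im: "(t - s) * x + s \<in> {s..t}" if "x \<in> {0..1}" for x
    proof -
      have "0 \<le> (t - s) * x" "(t - s) * x \<le> t - s"
        using that st(1) by (auto intro: mult_left_le)
      then show ?thesis by simp
    qed
    show ?thesis
      unfolding arc_def path_def subpath_def
    proof
      show "continuous_on {0..1} (\<lambda>x. \<alpha> ((t - s) * x + s))"
        by (intro continuous_on_compose2[OF c] continuous_intros) (use im in blast)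
      show "inj_on (\<lambda>x. \<alpha> ((t - s) * x + s)) {0..1}"
      proof (rule inj_onI)
        fix x y assume xy: "x \<in> {0..1}" "y \<in> {0..1}" "\<alpha> ((t - s) * x + s) = \<alpha> ((t - s) * y + s)"
        have "(t - s) * x + s = (t - s) * y + s"
          by (rule inj_onD[OF i xy(3)]) (use xy im in blast)+
        then show "x = y" using st(1) by simp
      qed
    qed
  qed
  have simple: "simple_path (subpath s t \<alpha> +++ q)"
  proof (rule simple_path_join_loop[OF arc q(1)])
    show "path_image (subpath s t \<alpha>) \<inter> path_image q \<subseteq> {pathstart (subpath s t \<alpha>), pathstart q}"
      using psub q(2,3) PA st(2) unfolding A_def by auto
  qed (use q in auto)
  have "\<alpha> t0 \<in> A" using t0 by (auto simp: A_def)
  moreover have "\<alpha> t0 \<noteq> \<alpha> s" "\<alpha> t0 \<noteq> \<alpha> t"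
    using inj_onD[OF inj, of t0 s] inj_onD[OF inj, of t0 t] s t t0 by auto
  ultimately have "\<alpha> t0 \<notin> path_image q" using q(2) PA by blast
  then show ?thesis
    using that[of s t q] s t simple q by (simp add: arc_imp_path)
qed

text \<open>Each point of a Jordan curve is in the closure of both the inside and the outside. The
  winding number inside may be 1 or -1; the order of \<open>x\<close> and \<open>y\<close> absorbs
  the sign.\<close>

lemma simple_closed_path_winding_number_jump:
  assumes c: "simple_path c" "pathfinish c = pathstart c" and p: "p \<in> path_image c" and r: "r > 0"
  obtains x y where "x \<in> ball p r - path_image c" "y \<in> ball p r - path_image c"
    "winding_number c x - winding_number c y = 1"
proof -
  note JIO = Jordan_inside_outside[OF c]
  have "p \<in> closure (inside (path_image c))" "p \<in> closure (outside (path_image c))"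
    using p JIO by (auto simp: frontier_def)
  then obtain x y where xy: "x \<in> inside (path_image c)" "dist x p < r" "y \<in> outside (path_image c)" "dist y p < r"
    unfolding closure_approachable using r by metis
  have wy: "winding_number c y = 0"
    using xy c by (simp add: winding_number_zero_in_outside simple_path_imp_path)
  have nin: "x \<notin> path_image c" "y \<notin> path_image c"
    using xy inside_no_overlap outside_no_overlap by blast+
  show ?thesis
  proof (rule simple_closed_path_winding_number_inside[OF c(1)])
    assume "\<And>z. z \<in> inside (path_image c) \<Longrightarrow> winding_number c z = 1"
    then show ?thesis using that[of x y] xy wy nin by (auto simp: dist_commute)
  next
    assume "\<And>z. z \<in> inside (path_image c) \<Longrightarrow> winding_number c z = -1"
    then show ?thesis using that[of y x] xy wy nin by (auto simp: dist_commute)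
  qed
qed

lemma simple_closed_path_winding_number_diff:
  assumes c: "simple_path c" "pathfinish c = pathstart c"
    and "x \<notin> path_image c" "y \<notin> path_image c"
  shows "winding_number c x - winding_number c y \<in> {-1,0,1}"
proof -
  have out: "winding_number c z = 0" if "z \<in> outside (path_image c)" for z
    using that c by (simp add: winding_number_zero_in_outside simple_path_imp_path)
  have io: "z \<in> inside (path_image c) \<or> z \<in> outside (path_image c)" if "z \<notin> path_image c" for z
    using that inside_Un_outside[of "path_image c"] by blast
  show ?thesis
    by (rule simple_closed_path_winding_number_inside[OF c(1)])
       (use io[OF assms(3)] io[OF assms(4)] out in \<open>auto\<close>)
qed

text \<open>If the quotient is \<open>t \<le> 0\<close>, then
  \<open>w = (a - t * b) / (1 - t)\<close> is a convex combination of \<open>a\<close> and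
  \<open>b\<close>, so it lies in the ball.\<close>

lemma quotient_notin_nonpos_Reals:
  fixes a b c w :: complex
  assumes ab: "a \<in> ball c r" "b \<in> ball c r" and w: "w \<notin> ball c r"
  shows "(w - a) / (w - b) \<notin> \<real>\<^sub>\<le>\<^sub>0"
proof
  assume "(w - a) / (w - b) \<in> \<real>\<^sub>\<le>\<^sub>0"
  then obtain t :: real where t: "t \<le> 0" "(w - a) / (w - b) = of_real t"
    unfolding nonpos_Reals_def by auto
  have "w \<noteq> b" using w ab by auto
  then have "w - a = of_real t * (w - b)" using t(2) by (simp add: field_simps)
  then have e: "(1 - of_real t) * w = a - of_real t * b" by (simp add: algebra_simps)
  define u where "u = - t / (1 - t)"
  have u: "0 \<le> u" "u \<le> 1" "1 - u = 1 / (1 - t)" using t(1) by (auto simp: u_def field_simps)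
  have nz: "(1 - complex_of_real t) \<noteq> 0" using t(1)
    by (metis add_cancel_right_left diff_add_cancel eq_iff_diff_eq_0 not_one_le_zero of_real_1 of_real_eq_iff)
  have "w = (a - of_real t * b) / (1 - of_real t)" using e nz by (simp add: field_simps)
  also have "\<dots> = of_real (1 - u) * a + of_real u * b"
    unfolding u(3) by (simp add: u_def diff_divide_distrib)
  finally have "w = (1 - u) *\<^sub>R a + u *\<^sub>R b" by (simp add: scaleR_conv_of_real)
  then have "w \<in> closed_segment a b" using u by (auto simp: in_segment)
  then have "w \<in> ball c r" using ab closed_segment_subset[OF ab convex_ball] by blast
  then show False using w by simp
qed

text \<open>Multiplying \<open>(w - a) / (w - b)\<close> by the exponential of this function makes it equal to 1
  outside the ball of radius \<open>2r\<close>; the logarithm is continuous there because the quotient is a nonpositive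
  real only on the segment from \<open>a\<close> to \<open>b\<close>.\<close>
definition cutoff_log :: "complex \<Rightarrow> real \<Rightarrow> complex \<Rightarrow> complex \<Rightarrow> complex \<Rightarrow> complex" where
  "cutoff_log c r a b w = - of_real (max 0 (min 1 (dist c w / r - 1))) * Ln ((w - a) / (w - b))"

lemma cutoff_log_continuous:
  assumes ab: "a \<in> ball c r" "b \<in> ball c r"
  shows "continuous_on UNIV (cutoff_log c r a b)"
proof -
  have r: "r > 0" using ab by (metis ball_eq_empty empty_iff not_le)
  \<comment> \<open>On the closed ball the factor in front of \<open>Ln\<close> is 0, which hides
    the jump of \<open>Ln\<close> along the segment and the singularities at \<open>a\<close> and
    \<open>b\<close>.\<close>
  have 1: "continuous_on (cball c r) (cutoff_log c r a b)"
  proof (rule continuous_on_eq)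
    show "0 = cutoff_log c r a b w" if "w \<in> cball c r" for w
      using that r by (simp add: cutoff_log_def max_def)
  qed simp
  have neg: "(w - a) / (w - b) \<notin> \<real>\<^sub>\<le>\<^sub>0" if "w \<in> - ball c r" for w
    using quotient_notin_nonpos_Reals[OF ab, of w] that by simp
  have 2: "continuous_on (- ball c r) (cutoff_log c r a b)"
    unfolding cutoff_log_def
    by (intro continuous_intros) (use neg r ab in auto)
  have "continuous_on (cball c r \<union> - ball c r) (cutoff_log c r a b)"
    by (rule continuous_on_closed_Un) (use 1 2 in \<open>auto simp: closed_Compl\<close>)
  moreover have "cball c r \<union> - ball c r = UNIV" by auto
  ultimately show ?thesis by simp
qed

lemma cutoff_log_outside:
  assumes ab: "a \<in> ball c r" "b \<in> ball c r" and w: "2 * r \<le> dist c w"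
  shows "(w - a) / (w - b) * exp (cutoff_log c r a b w) = 1"
proof -
  have r: "r > 0" using ab by (metis ball_eq_empty empty_iff not_le)
  have "dist c w / r \<ge> 2" using w r by (simp add: field_simps)
  then have "cutoff_log c r a b w = - Ln ((w - a) / (w - b))"
    by (simp add: cutoff_log_def)
  moreover have "w \<noteq> a" "w \<noteq> b" using ab w r by auto
  ultimately show ?thesis by (simp add: exp_minus)
qed

subsection \<open>Functions on an oriented surface\<close>

text \<open>Continuity at one point of a total function. Functions with zeros and poles can then be
  multiplied and modified without changing their domain; their values at the exceptional points are
  irrelevant.\<close>

definition cont_at :: "'a topology \<Rightarrow> ('a \<Rightarrow> 'b::topological_space) \<Rightarrow> 'a \<Rightarrow> bool" where
  "cont_at M f x \<longleftrightarrow> x \<in> topspace M \<and> (f \<longlongrightarrow> f x) (nhdsin M x)"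

lemma cont_at_topological:
  "cont_at M f x \<longleftrightarrow> x \<in> topspace M \<and> (\<forall>V. open V \<and> f x \<in> V \<longrightarrow> (\<exists>A. openin M A \<and> x \<in> A \<and> f ` A \<subseteq> V))"
  unfolding cont_at_def tendsto_def by (auto simp: eventually_nhdsin image_subset_iff)

lemma cont_at_cong_open:
  assumes "openin M A" "x \<in> A" "\<And>y. y \<in> A \<Longrightarrow> f y = g y" "cont_at M f x"
  shows "cont_at M g x"
proof -
  have "x \<in> topspace M" using assms by (auto simp: cont_at_def)
  moreover have "eventually (\<lambda>y. f y = g y) (nhdsin M x)"
    using assms \<open>x \<in> topspace M\<close> by (auto simp: eventually_nhdsin)
  moreover have "(f \<longlongrightarrow> f x) (nhdsin M x)" "f x = g x" using assms by (auto simp: cont_at_def)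
  ultimately show ?thesis
    unfolding cont_at_def using Lim_transform_eventually by force
qed

lemma cont_at_const: "x \<in> topspace M \<Longrightarrow> cont_at M (\<lambda>_. c) x"
  by (simp add: cont_at_def)

lemma cont_at_compose:
  assumes "cont_at M f x" "isCont g (f x)"
  shows "cont_at M (\<lambda>y. g (f y)) x"
  using assms unfolding cont_at_def by (auto intro: isCont_tendsto_compose)

lemma cont_at_compose_on:
  fixes f :: "'a \<Rightarrow> 'b::t2_space"
  assumes "cont_at M f x" "continuous_on S g" "open S" "f x \<in> S"
  shows "cont_at M (\<lambda>y. g (f y)) x"
proof (rule cont_at_compose[OF assms(1)])
  show "isCont g (f x)" using assms(2-4) by (simp add: continuous_on_eq_continuous_at)
qed

lemma cont_at_mult:
  fixes f g :: "'a \<Rightarrow> 'b::real_normed_algebra"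
  shows "cont_at M f x \<Longrightarrow> cont_at M g x \<Longrightarrow> cont_at M (\<lambda>y. f y * g y) x"
  unfolding cont_at_def by (auto intro: tendsto_mult)

lemma cont_at_add:
  fixes f g :: "'a \<Rightarrow> 'b::real_normed_vector"
  shows "cont_at M f x \<Longrightarrow> cont_at M g x \<Longrightarrow> cont_at M (\<lambda>y. f y + g y) x"
  unfolding cont_at_def by (auto intro: tendsto_add)

lemma cont_at_diff:
  fixes f g :: "'a \<Rightarrow> 'b::real_normed_vector"
  shows "cont_at M f x \<Longrightarrow> cont_at M g x \<Longrightarrow> cont_at M (\<lambda>y. f y - g y) x"
  unfolding cont_at_def by (auto intro: tendsto_diff)

lemma cont_at_divide:
  fixes f g :: "'a \<Rightarrow> 'b::real_normed_field"
  shows "cont_at M f x \<Longrightarrow> cont_at M g x \<Longrightarrow> g x \<noteq> 0 \<Longrightarrow> cont_at M (\<lambda>y. f y / g y) x"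
  unfolding cont_at_def by (auto intro: tendsto_divide)

lemma cont_at_exp:
  fixes f :: "'a \<Rightarrow> complex"
  shows "cont_at M f x \<Longrightarrow> cont_at M (\<lambda>y. exp (f y)) x"
  unfolding cont_at_def by (auto intro: tendsto_exp)

lemma continuous_map_imp_cont_at:
  assumes "openin M U" "continuous_map (subtopology M U) euclidean f" "x \<in> U"
  shows "cont_at M f x"
  unfolding cont_at_topological
proof (intro conjI allI impI)
  show "x \<in> topspace M" using assms openin_subset by blast
  fix V assume V: "open V \<and> f x \<in> V"
  have "openin (subtopology M U) {y \<in> topspace (subtopology M U). f y \<in> V}"
    by (rule openin_continuous_map_preimage[OF assms(2)]) (use V in simp)
  then have "openin M {y \<in> topspace (subtopology M U). f y \<in> V}"
    using assms(1) openin_trans_full by blast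
  then show "\<exists>A. openin M A \<and> x \<in> A \<and> f ` A \<subseteq> V"
    using V assms openin_subset by (intro exI[of _ "{y \<in> topspace (subtopology M U). f y \<in> V}"]) auto
qed

lemma continuous_on_compose_cont_at:
  fixes p :: "'c::topological_space \<Rightarrow> 'a"
  assumes p: "continuous_map (top_of_set S) M p" and f: "\<And>t. t \<in> S \<Longrightarrow> cont_at M f (p t)"
  shows "continuous_on S (\<lambda>t. f (p t))"
  unfolding continuous_on_topological
proof (intro ballI allI impI)
  fix t B assume t: "t \<in> S" and B: "open B" "f (p t) \<in> B"
  obtain A where A: "openin M A" "p t \<in> A" "f ` A \<subseteq> B"
    using f[OF t] B unfolding cont_at_topological by blast
  have "openin (top_of_set S) {s \<in> topspace (top_of_set S). p s \<in> A}"
    by (rule openin_continuous_map_preimage[OF p A(1)])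
  then obtain T where T: "open T" "{s \<in> S. p s \<in> A} = S \<inter> T"
    unfolding openin_open by auto
  show "\<exists>A. open A \<and> t \<in> A \<and> (\<forall>y\<in>S. y \<in> A \<longrightarrow> f (p y) \<in> B)"
  proof (intro exI conjI ballI impI)
    show "t \<in> T" using T t A by blast
    show "f (p y) \<in> B" if "y \<in> S" "y \<in> T" for y
      using that T(2) A(3) by blast
  qed (rule T)
qed

text \<open>A chart is onto the whole plane, so its inverse is a total continuous map and every ball
  of the plane comes from a disc in \<open>U\<close>.\<close>

definition chart :: "'a topology \<Rightarrow> 'a set \<Rightarrow> ('a \<Rightarrow> complex) \<Rightarrow> bool" where
  "chart M U \<phi> \<longleftrightarrow> openin M U \<and> homeomorphic_map (subtopology M U) euclidean \<phi>"

definition chart_inv :: "'a set \<Rightarrow> ('a \<Rightarrow> complex) \<Rightarrow> complex \<Rightarrow> 'a" where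
  "chart_inv U \<phi> = inv_into U \<phi>"

lemma chart_props:
  assumes "chart M U \<phi>"
  shows "openin M U" "U \<subseteq> topspace M" "\<And>x. x \<in> U \<Longrightarrow> cont_at M \<phi> x" "inj_on \<phi> U"
    "\<And>z. chart_inv U \<phi> z \<in> U" "\<And>z. \<phi> (chart_inv U \<phi> z) = z" "\<And>x. x \<in> U \<Longrightarrow> chart_inv U \<phi> (\<phi> x) = x"
    "continuous_map euclidean M (chart_inv U \<phi>)"
    "\<And>A. openin M A \<Longrightarrow> open (\<phi> ` (A \<inter> U))"
proof -
  show U: "openin M U" using assms by (simp add: chart_def)
  show Usub: "U \<subseteq> topspace M" using U openin_subset by blast
  have hom: "homeomorphic_map (subtopology M U) euclidean \<phi>" using assms by (simp add: chart_def)
  then have cm: "continuous_map (subtopology M U) euclidean \<phi>" by (simp add: homeomorphic_imp_continuous_map)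
  show "cont_at M \<phi> x" if "x \<in> U" for x by (rule continuous_map_imp_cont_at[OF U cm that])
  show inj: "inj_on \<phi> U"
    using hom Usub by (simp add: homeomorphic_eq_everything_map Int_absorb1)
  have surj: "\<phi> ` U = UNIV"
    using hom Usub by (simp add: homeomorphic_eq_everything_map Int_absorb1)
  show 1: "chart_inv U \<phi> z \<in> U" for z unfolding chart_inv_def by (rule inv_into_into) (simp add: surj)
  show 2: "\<phi> (chart_inv U \<phi> z) = z" for z unfolding chart_inv_def by (rule f_inv_into_f) (simp add: surj)
  show 3: "chart_inv U \<phi> (\<phi> x) = x" if "x \<in> U" for x unfolding chart_inv_def by (rule inv_into_f_f[OF inj that])
  have om: "open_map (subtopology M U) euclidean \<phi>" using hom by (simp add: homeomorphic_imp_open_map)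
  show op: "open (\<phi> ` (A \<inter> U))" if "openin M A" for A
  proof -
    have "openin (subtopology M U) (A \<inter> U)" using that by (auto simp: openin_subtopology)
    then show ?thesis using om by (simp add: open_map_def)
  qed
  have "openin euclidean {z \<in> topspace euclidean. chart_inv U \<phi> z \<in> A}" if "openin M A" for A
  proof -
    have "{z \<in> topspace euclidean. chart_inv U \<phi> z \<in> A} = \<phi> ` (A \<inter> U)"
    proof (intro equalityI subsetI)
      fix z assume "z \<in> {z \<in> topspace euclidean. chart_inv U \<phi> z \<in> A}"
      then have "chart_inv U \<phi> z \<in> A \<inter> U" using 1 by simp
      then show "z \<in> \<phi> ` (A \<inter> U)" using 2[of z] by (metis image_eqI)
    next
      fix z assume "z \<in> \<phi> ` (A \<inter> U)"
      then show "z \<in> {z \<in> topspace euclidean. chart_inv U \<phi> z \<in> A}" using 3 by auto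
    qed
    then show ?thesis using op[OF that] by simp
  qed
  then show "continuous_map euclidean M (chart_inv U \<phi>)"
    unfolding continuous_map using 1 Usub by auto
qed

lemma chart_open_vimage:
  assumes "chart M U \<phi>" "open W"
  shows "openin M {x \<in> U. \<phi> x \<in> W}"
proof (subst openin_subopen, intro ballI)
  fix x assume x: "x \<in> {x \<in> U. \<phi> x \<in> W}"
  then obtain A where "openin M A" "x \<in> A" "\<phi> ` A \<subseteq> W"
    using chart_props(3)[OF assms(1)] assms(2) unfolding cont_at_topological by blast
  then show "\<exists>T. openin M T \<and> x \<in> T \<and> T \<subseteq> {x \<in> U. \<phi> x \<in> W}"
    using x chart_props(1)[OF assms(1)] by (intro exI[of _ "A \<inter> U"]) auto
qed

text \<open>Closed in \<open>M\<close> and not only in \<open>U\<close>, as a compact subset of a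
  Hausdorff space. This permits extending a function by a constant beyond a disc.\<close>

lemma chart_closed_vimage:
  assumes "chart M U \<phi>" "Hausdorff_space M" "compact K"
  shows "closedin M {x \<in> U. \<phi> x \<in> K}"
proof -
  have "{x \<in> U. \<phi> x \<in> K} = chart_inv U \<phi> ` K"
    using chart_props[OF assms(1)] by force
  moreover have "compactin M (chart_inv U \<phi> ` K)"
    by (rule image_compactin[OF _ chart_props(8)[OF assms(1)]]) (simp add: assms(3))
  ultimately show ?thesis using assms(2) compactin_imp_closedin by metis
qed

lemma chart_small_ball:
  assumes "chart M U \<phi>" "openin M A" "x \<in> A" "x \<in> U"
  obtains r where "r > 0" "{y \<in> U. \<phi> y \<in> cball (\<phi> x) r} \<subseteq> A"
proof -
  have "open (\<phi> ` (A \<inter> U))" "\<phi> x \<in> \<phi> ` (A \<inter> U)" using chart_props(9)[OF assms(1,2)] assms by auto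
  then obtain r where r: "r > 0" "cball (\<phi> x) r \<subseteq> \<phi> ` (A \<inter> U)"
    using open_contains_cball by metis
  have "{y \<in> U. \<phi> y \<in> cball (\<phi> x) r} \<subseteq> A"
  proof
    fix y assume y: "y \<in> {y \<in> U. \<phi> y \<in> cball (\<phi> x) r}"
    then obtain y' where "y' \<in> A \<inter> U" "\<phi> y = \<phi> y'" using r(2) by blast
    then show "y \<in> A" using y chart_props(4)[OF assms(1)] by (metis (mono_tags, lifting) IntD1 IntD2 inj_onD mem_Collect_eq)
  qed
  then show ?thesis using that r by blast
qed

text \<open>\<open>compat\<close> says without derivatives that transition maps have local degree 1:
  the quotient of the two coordinate differences has a continuous logarithm on a punctured
  neighbourhood, so it does not wind around 0.\<close>

locale oriented_surface =
  fixes M :: "'a topology" and \<A> :: "('a set \<times> ('a \<Rightarrow> complex)) set"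
  assumes Hausdorff: "Hausdorff_space M"
    and charts: "(U,\<phi>) \<in> \<A> \<Longrightarrow> chart M U \<phi>"
    and cover: "x \<in> topspace M \<Longrightarrow> \<exists>(U,\<phi>)\<in>\<A>. x \<in> U"
    and compat: "\<lbrakk>(U,\<phi>) \<in> \<A>; (V,\<psi>) \<in> \<A>; x \<in> U; x \<in> V\<rbrakk> \<Longrightarrow>
       \<exists>W \<kappa>. openin M W \<and> x \<in> W \<and>
         (\<forall>z\<in>W-{x}. cont_at M \<kappa> z \<and> \<phi> z - \<phi> x = (\<psi> z - \<psi> x) * exp (\<kappa> z :: complex))"
begin

text \<open>Equivalently, \<open>f\<close> winds \<open>k\<close> times around the origin on a small positive loop around \<open>x\<close>.\<close>
definition has_order :: "('a \<Rightarrow> complex) \<Rightarrow> 'a \<Rightarrow> int \<Rightarrow> bool" where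
  "has_order f x k \<longleftrightarrow> (\<exists>(U,\<phi>)\<in>\<A>. x \<in> U \<and> (\<exists>W \<kappa>. openin M W \<and> x \<in> W \<and>
      (\<forall>z\<in>W-{x}. cont_at M \<kappa> z \<and> f z = (\<phi> z - \<phi> x) powi k * exp (\<kappa> z))))"

text \<open>A change of chart multiplies the coordinate difference by some
  \<open>exp (\<kappa>' z)\<close>, and the \<open>k\<close>-th power of this is absorbed by the
  exponential factor. So the order does not depend on the chart.\<close>

lemma has_order_in_chart:
  assumes "has_order f x k" "(V,\<psi>) \<in> \<A>" "x \<in> V"
  obtains W \<kappa> where "openin M W" "x \<in> W" "\<And>z. z \<in> W - {x} \<Longrightarrow> cont_at M \<kappa> z"
    "\<And>z. z \<in> W - {x} \<Longrightarrow> f z = (\<psi> z - \<psi> x) powi k * exp (\<kappa> z)"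
proof -
  obtain U \<phi> W \<kappa> where U: "(U,\<phi>) \<in> \<A>" "x \<in> U" and W: "openin M W" "x \<in> W"
    and \<kappa>: "\<And>z. z \<in> W - {x} \<Longrightarrow> cont_at M \<kappa> z \<and> f z = (\<phi> z - \<phi> x) powi k * exp (\<kappa> z)"
    using assms(1) unfolding has_order_def by blast
  obtain W' \<kappa>' where W': "openin M W'" "x \<in> W'"
    and \<kappa>': "\<And>z. z \<in> W' - {x} \<Longrightarrow> cont_at M \<kappa>' z \<and> \<phi> z - \<phi> x = (\<psi> z - \<psi> x) * exp (\<kappa>' z)"
    using compat[OF U(1) assms(2) U(2) assms(3)] by blast
  show ?thesis
  proof (rule that[of "W \<inter> W'" "\<lambda>z. \<kappa> z + of_int k * \<kappa>' z"])
    show "openin M (W \<inter> W')" "x \<in> W \<inter> W'" using W W' by auto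
    fix z assume z: "z \<in> W \<inter> W' - {x}"
    have "z \<in> topspace M" using z W openin_subset by blast
    then show "cont_at M (\<lambda>z. \<kappa> z + of_int k * \<kappa>' z) z"
      using \<kappa>[of z] \<kappa>'[of z] z by (intro cont_at_add cont_at_mult cont_at_const) auto
    have "f z = (\<phi> z - \<phi> x) powi k * exp (\<kappa> z)" using \<kappa>[of z] z by simp
    also have "\<phi> z - \<phi> x = (\<psi> z - \<psi> x) * exp (\<kappa>' z)" using \<kappa>'[of z] z by simp
    finally show "f z = (\<psi> z - \<psi> x) powi k * exp (\<kappa> z + of_int k * \<kappa>' z)"
      by (simp add: power_int_mult_distrib exp_add exp_power_int mult.commute mult.left_commute)
  qed
qed

lemma has_orderI:
  assumes "(U,\<phi>) \<in> \<A>" "x \<in> U" "openin M W" "x \<in> W" "\<And>z. z \<in> W - {x} \<Longrightarrow> cont_at M \<kappa> z"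
    "\<And>z. z \<in> W - {x} \<Longrightarrow> f z = (\<phi> z - \<phi> x) powi k * exp (\<kappa> z)"
  shows "has_order f x k"
  unfolding has_order_def using assms by blast

lemma chart_diff_nonzero:
  assumes "(U,\<phi>) \<in> \<A>" "x \<in> U" "z \<in> U" "z \<noteq> x"
  shows "\<phi> z - \<phi> x \<noteq> 0"
  using chart_props(4)[OF charts[OF assms(1)]] assms by (auto dest: inj_onD)

lemma has_order_mult:
  assumes "has_order f x k" "has_order g x l"
  shows "has_order (\<lambda>z. f z * g z) x (k + l)"
proof -
  obtain U \<phi> W \<kappa> where U: "(U,\<phi>) \<in> \<A>" "x \<in> U" and W: "openin M W" "x \<in> W"
    and \<kappa>: "\<And>z. z \<in> W - {x} \<Longrightarrow> cont_at M \<kappa> z \<and> f z = (\<phi> z - \<phi> x) powi k * exp (\<kappa> z)"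
    using assms(1) unfolding has_order_def by blast
  obtain W' \<nu> where W': "openin M W'" "x \<in> W'" "\<And>z. z \<in> W' - {x} \<Longrightarrow> cont_at M \<nu> z"
    "\<And>z. z \<in> W' - {x} \<Longrightarrow> g z = (\<phi> z - \<phi> x) powi l * exp (\<nu> z)"
    using has_order_in_chart[OF assms(2) U] by metis
  show ?thesis
  proof (rule has_orderI[OF U, of "W \<inter> W' \<inter> U" "\<lambda>z. \<kappa> z + \<nu> z"])
    show "openin M (W \<inter> W' \<inter> U)" "x \<in> W \<inter> W' \<inter> U"
      using W W' U chart_props(1)[OF charts[OF U(1)]] by auto
    fix z assume z: "z \<in> W \<inter> W' \<inter> U - {x}"
    show "cont_at M (\<lambda>z. \<kappa> z + \<nu> z) z"
      using \<kappa>[of z] W'(3)[of z] z by (intro cont_at_add) auto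
    have "\<phi> z - \<phi> x \<noteq> 0" using chart_diff_nonzero[OF U] z by auto
    then show "f z * g z = (\<phi> z - \<phi> x) powi (k + l) * exp (\<kappa> z + \<nu> z)"
      using \<kappa>[of z] W'(4)[of z] z by (simp add: power_int_add exp_add)
  qed
qed

lemma has_order_inverse:
  assumes "has_order f x k"
  shows "has_order (\<lambda>z. 1 / f z) x (-k)"
proof -
  obtain U \<phi> W \<kappa> where U: "(U,\<phi>) \<in> \<A>" "x \<in> U" and W: "openin M W" "x \<in> W"
    and \<kappa>: "\<And>z. z \<in> W - {x} \<Longrightarrow> cont_at M \<kappa> z \<and> f z = (\<phi> z - \<phi> x) powi k * exp (\<kappa> z)"
    using assms(1) unfolding has_order_def by blast
  show ?thesis
  proof (rule has_orderI[OF U W, of "\<lambda>z. - \<kappa> z"])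
    fix z assume z: "z \<in> W - {x}"
    show "cont_at M (\<lambda>z. - \<kappa> z) z"
      using \<kappa>[OF z] cont_at_compose[of M \<kappa> z uminus] by auto
    show "1 / f z = (\<phi> z - \<phi> x) powi (- k) * exp (- \<kappa> z)"
      using \<kappa>[OF z] by (simp add: power_int_minus exp_minus field_simps)
  qed
qed

lemma has_order_divide:
  assumes "has_order f x k" "has_order g x l"
  shows "has_order (\<lambda>z. f z / g z) x (k - l)"
  using has_order_mult[OF assms(1) has_order_inverse[OF assms(2)]] by simp

text \<open>Near \<open>x\<close> the quotient \<open>f z / f x\<close> has distance less than 1
  from 1, so it stays in the right half-plane, where \<open>Ln\<close> is continuous.\<close>

lemma has_order_0:
  assumes f: "cont_at M f x" "f x \<noteq> 0" and W: "openin M W" "x \<in> W" "\<And>z. z \<in> W - {x} \<Longrightarrow> cont_at M f z"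
  shows "has_order f x 0"
proof -
  have "x \<in> topspace M" using f by (simp add: cont_at_def)
  then obtain U \<phi> where U: "(U,\<phi>) \<in> \<A>" "x \<in> U" using cover by blast
  have "open (ball (f x) (norm (f x)))" "f x \<in> ball (f x) (norm (f x))" using f by auto
  then obtain A where A: "openin M A" "x \<in> A" "f ` A \<subseteq> ball (f x) (norm (f x))"
    using f(1) unfolding cont_at_topological by meson
  show ?thesis
  proof (rule has_orderI[OF U, of "W \<inter> A" "\<lambda>z. Ln (f z / f x) + Ln (f x)"])
    show "openin M (W \<inter> A)" "x \<in> W \<inter> A" using W A by auto
    fix z assume z: "z \<in> W \<inter> A - {x}"
    have "norm (f x - f z) < norm (f x)" using A z by (auto simp: dist_norm)
    moreover have "norm (f z / f x - 1) = norm (f x - f z) / norm (f x)"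
      using f(2) by (simp add: norm_divide[symmetric] diff_divide_distrib norm_minus_commute)
    ultimately have "norm (f z / f x - 1) < 1" using f(2) by simp
    then have np: "f z / f x \<notin> \<real>\<^sub>\<le>\<^sub>0"
    proof -
      assume n: "norm (f z / f x - 1) < 1"
      have "\<bar>Re (f z / f x - 1)\<bar> < 1" using n abs_Re_le_cmod le_less_trans by blast
      then have "Re (f z / f x) > 0" by simp
      then show ?thesis using complex_nonpos_Reals_iff by force
    qed
    show "cont_at M (\<lambda>z. Ln (f z / f x) + Ln (f x)) z"
    proof (rule cont_at_add)
      have zt: "z \<in> topspace M" using z W openin_subset by blast
      have "cont_at M (\<lambda>z. f z / f x) z"
        using W(3)[of z] z zt f(2) by (intro cont_at_divide cont_at_const) auto
      then show "cont_at M (\<lambda>z. Ln (f z / f x)) z"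
        using np by (intro cont_at_compose[where g=Ln]) auto
      show "cont_at M (\<lambda>z. Ln (f x)) z" using zt by (rule cont_at_const)
    qed
    have "f z / f x \<noteq> 0" using np by auto
    then show "f z = (\<phi> z - \<phi> x) powi 0 * exp (Ln (f z / f x) + Ln (f x))"
      using f(2) by (simp add: exp_add)
  qed
qed

text \<open>Order 0 means \<open>f = exp \<kappa>\<close> around \<open>x\<close>. Multiplying
  \<open>\<kappa>\<close> by a radial function that is 0 near \<open>x\<close> and 1 at distance
  \<open>r\<close> gives a function that is 1 near \<open>x\<close>, has no zeros there and joins
  \<open>f\<close> continuously.\<close>

lemma remove_order_0:
  assumes ord: "has_order f x 0" and W: "openin M W" "x \<in> W"
  obtains g where "\<And>z. z \<notin> W \<Longrightarrow> g z = f z" "cont_at M g x" "g x \<noteq> 0"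
    "\<And>z. z \<noteq> x \<Longrightarrow> cont_at M f z \<Longrightarrow> f z \<noteq> 0 \<Longrightarrow> cont_at M g z \<and> g z \<noteq> 0"
proof -
  obtain U \<phi> V \<kappa> where U: "(U,\<phi>) \<in> \<A>" "x \<in> U" and V: "openin M V" "x \<in> V"
    and \<kappa>: "\<And>z. z \<in> V - {x} \<Longrightarrow> cont_at M \<kappa> z \<and> f z = exp (\<kappa> z)"
    using ord unfolding has_order_def power_int_0_right mult_1_left by blast
  note ch = charts[OF U(1)]
  obtain r where r: "r > 0" "{y \<in> U. \<phi> y \<in> cball (\<phi> x) r} \<subseteq> W \<inter> V"
    using chart_small_ball[OF ch, of "W \<inter> V" x] W V U by auto
  define K where "K = {y \<in> U. \<phi> y \<in> cball (\<phi> x) r}"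
  have K: "closedin M K" unfolding K_def by (rule chart_closed_vimage[OF ch Hausdorff]) simp
  define l where "l w = complex_of_real (max 0 (min 1 (2 * dist (\<phi> x) w / r - 1)))" for w
  have lcont: "isCont l w" for w unfolding l_def using r(1) by (intro continuous_intros) auto
  define g where "g z = (if z \<in> K then exp (l (\<phi> z) * \<kappa> z) else f z)" for z
  define B where "B = {y \<in> U. \<phi> y \<in> ball (\<phi> x) (r/2)}"
  define C where "C = {y \<in> U. \<phi> y \<in> ball (\<phi> x) r}"
  have B: "openin M B" unfolding B_def by (rule chart_open_vimage[OF ch]) simp
  have xB: "x \<in> B" unfolding B_def using U r by simp
  have C: "openin M C" unfolding C_def by (rule chart_open_vimage[OF ch]) simp
  have gB: "g z = 1" if "z \<in> B" for z
  proof -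
    have "l (\<phi> z) = 0" using that r(1) by (auto simp: l_def B_def field_simps)
    moreover have "z \<in> K" using that r by (auto simp: B_def K_def)
    ultimately show ?thesis by (simp add: g_def)
  qed
  have "cont_at M g z" if "z \<in> B" for z
  proof -
    have "z \<in> topspace M" using that B openin_subset by blast
    then show ?thesis using cont_at_cong_open[OF B that, of "\<lambda>_. 1" g] gB by (simp add: cont_at_const)
  qed
  note gBc = this
  show ?thesis
  proof (rule that[of g])
    show "g z = f z" if "z \<notin> W" for z using that r by (auto simp: g_def K_def)
    show "cont_at M g x" "g x \<noteq> 0" using gBc gB xB by auto
    fix z assume z: "z \<noteq> x" "cont_at M f z" "f z \<noteq> 0"
    have zt: "z \<in> topspace M" using z by (simp add: cont_at_def)
    consider "z \<in> C" | "z \<notin> K" | "z \<in> K - C" by blast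
    then show "cont_at M g z \<and> g z \<noteq> 0"
    proof cases
      case 1
      have CK: "C \<subseteq> K" unfolding C_def K_def by auto
      have zU: "z \<in> U" "z \<in> V - {x}" using 1 z r CK unfolding C_def K_def by auto
      have c1: "cont_at M (\<lambda>z. exp (l (\<phi> z) * \<kappa> z)) z"
        using \<kappa>[OF zU(2)] chart_props(3)[OF ch zU(1)] lcont
        by (intro cont_at_exp cont_at_mult cont_at_compose[where g=l]) auto
      have e1: "exp (l (\<phi> y) * \<kappa> y) = g y" if "y \<in> C" for y
        using that CK by (auto simp: g_def)
      have "cont_at M g z" by (rule cont_at_cong_open[OF C 1 e1 c1])
      moreover have "g z \<noteq> 0" using subsetD[OF CK 1] by (simp add: g_def)
      ultimately show ?thesis by blast
    next
      case 2
      have op: "openin M (topspace M - K)" using K by blast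
      then show ?thesis
        using cont_at_cong_open[OF op, of z f g] 2 zt z by (auto simp: g_def)
    next
      \<comment> \<open>On the boundary circle of \<open>K\<close> neither formula describes
        \<open>g\<close> on a whole neighbourhood, but both \<open>f\<close> and \<open>h\<close>
        are continuous at \<open>z\<close> with the same value, and \<open>g\<close> always equals
        one of them.\<close>
      case 3
      have zV: "z \<in> V - {x}" "z \<in> U" using 3 r z unfolding K_def by auto
      have "dist (\<phi> x) (\<phi> z) = r" using 3 unfolding C_def K_def by auto
      then have l1: "l (\<phi> z) = 1" using r(1) by (simp add: l_def)
      define h where "h z = exp (l (\<phi> z) * \<kappa> z)" for z
      have hc: "cont_at M h z" unfolding h_def
        using \<kappa>[OF zV(1)] chart_props(3)[OF ch zV(2)] lcont
        by (intro cont_at_exp cont_at_mult cont_at_compose[where g=l]) auto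
      have hz: "h z = f z" using \<kappa>[OF zV(1)] l1 by (simp add: h_def)
      have gz: "g z = f z" using 3 hz by (simp add: g_def h_def)
      have "cont_at M g z" unfolding cont_at_topological
      proof (intro conjI allI impI zt)
        fix S assume S: "open S \<and> g z \<in> S"
        obtain A1 where A1: "openin M A1" "z \<in> A1" "f ` A1 \<subseteq> S"
          using z(2) S gz unfolding cont_at_topological by auto
        obtain A2 where A2: "openin M A2" "z \<in> A2" "h ` A2 \<subseteq> S"
          using hc S gz hz unfolding cont_at_topological by auto
        have "g ` (A1 \<inter> A2) \<subseteq> S" using A1 A2 unfolding g_def h_def by auto
        then show "\<exists>A. openin M A \<and> z \<in> A \<and> g ` A \<subseteq> S" using A1 A2 by blast
      qed
      then show ?thesis using gz z by simp
    qed
  qed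
qed

end

section \<open>Functions with one simple zero and one simple pole, supported in a disc\<close>

definition disc :: "'a set \<Rightarrow> ('a \<Rightarrow> complex) \<Rightarrow> complex \<Rightarrow> real \<Rightarrow> 'a set" where
  "disc U \<phi> c r = {z \<in> U. \<phi> z \<in> ball c r}"

text \<open>For distinct points the only zero is at \<open>x\<close> and the only pole at
  \<open>y\<close>. Multiplying such functions along a chain of discs moves the pole step by step;
  \<open>c\<close> and \<open>r\<close> enter only through the cutoff.\<close>

definition edge :: "'a set \<Rightarrow> ('a \<Rightarrow> complex) \<Rightarrow> complex \<Rightarrow> real \<Rightarrow> 'a \<Rightarrow> 'a \<Rightarrow> 'a \<Rightarrow> complex" where
  "edge U \<phi> c r x y z =
     (if z \<in> U then (\<phi> z - \<phi> x) / (\<phi> z - \<phi> y) * exp (cutoff_log c r (\<phi> x) (\<phi> y) (\<phi> z)) else 1)"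

lemma edge_outside:
  assumes "x \<in> disc U \<phi> c r" "y \<in> disc U \<phi> c r" "z \<notin> disc U \<phi> c (2*r)"
  shows "edge U \<phi> c r x y z = 1"
  using assms cutoff_log_outside[of "\<phi> x" c r "\<phi> y" "\<phi> z"] by (auto simp: edge_def disc_def)

lemma disc_mono: "r \<le> s \<Longrightarrow> disc U \<phi> c r \<subseteq> disc U \<phi> c s"
  by (auto simp: disc_def)

context oriented_surface
begin

lemma openin_chart: "(U,\<phi>) \<in> \<A> \<Longrightarrow> openin M U"
  by (rule chart_props(1)[OF charts])

lemma cont_at_chart: "(U,\<phi>) \<in> \<A> \<Longrightarrow> z \<in> U \<Longrightarrow> cont_at M \<phi> z"
  by (rule chart_props(3)[OF charts])

lemma openin_disc: "(U,\<phi>) \<in> \<A> \<Longrightarrow> openin M (disc U \<phi> c r)"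
  unfolding disc_def by (rule chart_open_vimage[OF charts]) auto

lemma openin_disc_complement:
  assumes "(U,\<phi>) \<in> \<A>"
  shows "openin M (topspace M - {z \<in> U. \<phi> z \<in> cball c r})"
  by (intro openin_diff openin_topspace chart_closed_vimage[OF charts[OF assms] Hausdorff] compact_cball)

lemma openin_delete: "openin M U \<Longrightarrow> openin M (U - {x})"
  using Hausdorff Hausdorff_imp_t1_space t1_space_openin_delete_alt by blast

text \<open>A point outside \<open>U\<close> may be a limit of points of \<open>U\<close> but not of
  points of the disc, since closed discs are closed in \<open>M\<close>.\<close>

lemma cont_at_off_disc:
  assumes U: "(U,\<phi>) \<in> \<A>" and z: "z \<in> topspace M" "z \<notin> U"
    and f: "\<And>z. z \<notin> disc U \<phi> c r \<Longrightarrow> f z = a"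
  shows "cont_at M f z"
proof (rule cont_at_cong_open[OF openin_disc_complement[OF U, of c r]])
  show "z \<in> topspace M - {z \<in> U. \<phi> z \<in> cball c r}" using z by auto
  show "a = f y" if "y \<in> topspace M - {z \<in> U. \<phi> z \<in> cball c r}" for y
  proof -
    have "y \<notin> disc U \<phi> c r" using that by (auto simp: disc_def)
    then show ?thesis using f by simp
  qed
  show "cont_at M (\<lambda>_. a) z" using z(1) by (rule cont_at_const)
qed

lemma has_order_cong:
  assumes "has_order f x k" "openin M W" "x \<in> W" "\<And>z. z \<in> W - {x} \<Longrightarrow> f z = g z"
  shows "has_order g x k"
proof -
  obtain U \<phi> V \<kappa> where U: "(U,\<phi>) \<in> \<A>" "x \<in> U" and V: "openin M V" "x \<in> V"
    and \<kappa>: "\<And>z. z \<in> V - {x} \<Longrightarrow> cont_at M \<kappa> z \<and> f z = (\<phi> z - \<phi> x) powi k * exp (\<kappa> z)"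
    using assms(1) unfolding has_order_def by blast
  show ?thesis
  proof (rule has_orderI[OF U, of "V \<inter> W" \<kappa>])
    fix z assume z: "z \<in> V \<inter> W - {x}"
    show "cont_at M \<kappa> z" using \<kappa> z by blast
    have "g z = f z" using assms(4) z by simp
    then show "g z = (\<phi> z - \<phi> x) powi k * exp (\<kappa> z)" using \<kappa> z by simp
  qed (use V assms in auto)
qed

lemma edge_cont:
  assumes U: "(U,\<phi>) \<in> \<A>" and xy: "x \<in> disc U \<phi> c r" "y \<in> disc U \<phi> c r"
    and z: "z \<in> topspace M" "z \<noteq> x" "z \<noteq> y"
  shows "cont_at M (edge U \<phi> c r x y) z \<and> edge U \<phi> c r x y z \<noteq> 0"
proof (cases "z \<in> U")
  case True
  have xyU: "x \<in> U" "y \<in> U" using xy by (auto simp: disc_def)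
  have nz: "\<phi> z - \<phi> x \<noteq> 0" "\<phi> z - \<phi> y \<noteq> 0"
    using chart_diff_nonzero[OF U] xyU True z by auto
  define h where "h z = (\<phi> z - \<phi> x) / (\<phi> z - \<phi> y) * exp (cutoff_log c r (\<phi> x) (\<phi> y) (\<phi> z))" for z
  have cl: "continuous_on UNIV (cutoff_log c r (\<phi> x) (\<phi> y))"
    using xy by (intro cutoff_log_continuous) (auto simp: disc_def)
  have "cont_at M (\<lambda>z. cutoff_log c r (\<phi> x) (\<phi> y) (\<phi> z)) z"
    by (rule cont_at_compose_on[OF cont_at_chart[OF U True] cl]) auto
  then have h1: "cont_at M h z" unfolding h_def
    using nz z cont_at_chart[OF U True]
    by (intro cont_at_mult cont_at_divide cont_at_diff cont_at_exp cont_at_const) auto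
  have e: "h y' = edge U \<phi> c r x y y'" if "y' \<in> U" for y' using that by (simp add: h_def edge_def)
  have "cont_at M (edge U \<phi> c r x y) z"
    by (rule cont_at_cong_open[OF openin_chart[OF U] True e h1])
  then show ?thesis using nz True by (simp add: edge_def)
next
  case False
  have "cont_at M (edge U \<phi> c r x y) z"
    by (rule cont_at_off_disc[OF U z(1) False edge_outside[OF xy]])
  then show ?thesis using False by (simp add: edge_def)
qed

text \<open>At either point the factors other than the singular one form a nonvanishing continuous
  function, which has order 0.\<close>

lemma edge_order:
  assumes U: "(U,\<phi>) \<in> \<A>" and xy: "x \<in> disc U \<phi> c r" "y \<in> disc U \<phi> c r" "x \<noteq> y"
  shows "has_order (edge U \<phi> c r x y) x 1" "has_order (edge U \<phi> c r x y) y (-1)"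
proof -
  have xyU: "x \<in> U" "y \<in> U" using xy by (auto simp: disc_def)
  have top: "U \<subseteq> topspace M" using openin_chart[OF U] openin_subset by blast
  have cl: "continuous_on UNIV (cutoff_log c r (\<phi> x) (\<phi> y))"
    using xy by (intro cutoff_log_continuous) (auto simp: disc_def)
  have ce: "cont_at M (\<lambda>z. exp (cutoff_log c r (\<phi> x) (\<phi> y) (\<phi> z))) z" if "z \<in> U" for z
    by (rule cont_at_exp, rule cont_at_compose_on[OF cont_at_chart[OF U that] cl]) auto
  have lin: "has_order (\<lambda>z. \<phi> z - \<phi> w) w 1" if "w \<in> U" for w
    by (rule has_orderI[OF U that openin_chart[OF U] that, of "\<lambda>_. 0"])
       (use top in \<open>auto intro!: cont_at_const\<close>)
  have "has_order (\<lambda>z. exp (cutoff_log c r (\<phi> x) (\<phi> y) (\<phi> z)) / (\<phi> z - \<phi> y)) x 0"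
  proof (rule has_order_0[OF _ _ openin_delete[OF openin_chart[OF U], of y]])
    have *: "cont_at M (\<lambda>z. exp (cutoff_log c r (\<phi> x) (\<phi> y) (\<phi> z)) / (\<phi> z - \<phi> y)) z" if "z \<in> U" "z \<noteq> y" for z
      using that top chart_diff_nonzero[OF U xyU(2), of z]
      by (intro cont_at_divide ce cont_at_diff cont_at_chart[OF U] cont_at_const) auto
    show "cont_at M (\<lambda>z. exp (cutoff_log c r (\<phi> x) (\<phi> y) (\<phi> z)) / (\<phi> z - \<phi> y)) z"
      if "z \<in> U - {y} - {x}" for z using that by (intro *) auto
    show "cont_at M (\<lambda>z. exp (cutoff_log c r (\<phi> x) (\<phi> y) (\<phi> z)) / (\<phi> z - \<phi> y)) x"
      using xyU xy by (intro *) auto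
  qed (use xyU xy(3) chart_diff_nonzero[OF U xyU(2,1)] in auto)
  from has_order_mult[OF lin[OF xyU(1)] this]
  have "has_order (\<lambda>z. (\<phi> z - \<phi> x) * (exp (cutoff_log c r (\<phi> x) (\<phi> y) (\<phi> z)) / (\<phi> z - \<phi> y))) x 1"
    by simp
  then show "has_order (edge U \<phi> c r x y) x 1"
    by (rule has_order_cong[OF _ openin_chart[OF U] xyU(1)]) (auto simp: edge_def)
  have "has_order (\<lambda>z. exp (cutoff_log c r (\<phi> x) (\<phi> y) (\<phi> z)) * (\<phi> z - \<phi> x)) y 0"
  proof (rule has_order_0[OF _ _ openin_chart[OF U] xyU(2)])
    have *: "cont_at M (\<lambda>z. exp (cutoff_log c r (\<phi> x) (\<phi> y) (\<phi> z)) * (\<phi> z - \<phi> x)) z" if "z \<in> U" for z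
      using that top by (intro cont_at_mult ce cont_at_diff cont_at_chart[OF U] cont_at_const) auto
    show "cont_at M (\<lambda>z. exp (cutoff_log c r (\<phi> x) (\<phi> y) (\<phi> z)) * (\<phi> z - \<phi> x)) z"
      if "z \<in> U - {y}" for z using that by (intro *) auto
    show "cont_at M (\<lambda>z. exp (cutoff_log c r (\<phi> x) (\<phi> y) (\<phi> z)) * (\<phi> z - \<phi> x)) y"
      using xyU by (intro *) auto
  qed (use chart_diff_nonzero[OF U xyU(1,2)] xy(3) in auto)
  from has_order_divide[OF this lin[OF xyU(2)]]
  have "has_order (\<lambda>z. exp (cutoff_log c r (\<phi> x) (\<phi> y) (\<phi> z)) * (\<phi> z - \<phi> x) / (\<phi> z - \<phi> y)) y (-1)"
    by simp
  then show "has_order (edge U \<phi> c r x y) y (-1)"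
    by (rule has_order_cong[OF _ openin_chart[OF U] xyU(2)]) (auto simp: edge_def)
qed

text \<open>The first removal is confined to a neighbourhood of \<open>x\<close> disjoint from one
  of \<open>y\<close>, so the order at \<open>y\<close> is unaffected.\<close>

lemma remove_order_0_twice:
  assumes f: "\<And>z. z \<in> topspace M \<Longrightarrow> z \<noteq> x \<Longrightarrow> z \<noteq> y \<Longrightarrow> cont_at M f z \<and> f z \<noteq> 0"
    and ord: "has_order f x 0" "has_order f y 0" and W: "openin M W" "x \<in> W" "y \<in> W" and ne: "x \<noteq> y"
  obtains g where "\<And>z. z \<notin> W \<Longrightarrow> g z = f z" "\<And>z. z \<in> topspace M \<Longrightarrow> cont_at M g z \<and> g z \<noteq> 0"
proof -
  obtain P Q where PQ: "openin M P" "openin M Q" "x \<in> P" "y \<in> Q" "disjnt P Q"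
  proof -
    have "x \<in> topspace M" "y \<in> topspace M" using W openin_subset by blast+
    then show ?thesis using Hausdorff ne that unfolding Hausdorff_space_def by meson
  qed
  obtain g where g: "\<And>z. z \<notin> W \<inter> P \<Longrightarrow> g z = f z" "cont_at M g x" "g x \<noteq> 0"
    "\<And>z. z \<noteq> x \<Longrightarrow> cont_at M f z \<Longrightarrow> f z \<noteq> 0 \<Longrightarrow> cont_at M g z \<and> g z \<noteq> 0"
    using remove_order_0[OF ord(1), of "W \<inter> P"] W PQ by auto
  have gy: "has_order g y 0"
    by (rule has_order_cong[OF ord(2) PQ(2,4)]) (use g(1) PQ(5) in \<open>metis DiffD1 IntD2 disjnt_iff\<close>)
  then obtain h where h: "\<And>z. z \<notin> W \<Longrightarrow> h z = g z" "cont_at M h y" "h y \<noteq> 0"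
    "\<And>z. z \<noteq> y \<Longrightarrow> cont_at M g z \<Longrightarrow> g z \<noteq> 0 \<Longrightarrow> cont_at M h z \<and> h z \<noteq> 0"
    using remove_order_0[OF gy W(1,3)] by metis
  show ?thesis
  proof (rule that[of h])
    show "h z = f z" if "z \<notin> W" for z using that g(1) h(1) by simp
    show "cont_at M h z \<and> h z \<noteq> 0" if "z \<in> topspace M" for z
      using f[OF that] g h by (cases "z = x"; cases "z = y") auto
  qed
qed

text \<open>The chart plane is contractible, so there is a logarithm on it. Where \<open>Q\<close>
  is 1 it lies in the discrete set of multiples of \<open>2 * pi * \<i>\<close>; as the complement
  of a ball is connected, it is a single constant there.\<close>

lemma log_of_disc_supported:
  fixes Q :: "'a \<Rightarrow> complex"
  assumes U: "(U,\<phi>) \<in> \<A>" and Q: "\<And>z. z \<in> topspace M \<Longrightarrow> cont_at M Q z \<and> Q z \<noteq> 0"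
    and supp: "\<And>z. z \<notin> disc U \<phi> c R \<Longrightarrow> Q z = 1"
  obtains L where "\<And>z. z \<in> topspace M \<Longrightarrow> cont_at M L z \<and> Q z = exp (L z)"
proof -
  note ch = chart_props[OF charts[OF U]]
  have "continuous_on UNIV (\<lambda>w. Q (chart_inv U \<phi> w))"
    by (rule continuous_on_compose_cont_at[where f=Q and M=M]) (use ch(2,5,8) Q in auto)
  moreover have "contractible (UNIV :: complex set)" by (simp add: convex_imp_contractible)
  moreover have "Q (chart_inv U \<phi> w) \<noteq> 0" for w using Q ch(2,5) by blast
  ultimately obtain l where l: "continuous_on UNIV l" "\<And>w. Q (chart_inv U \<phi> w) = exp (l w)"
    using continuous_logarithm_on_contractible[of UNIV "\<lambda>w. Q (chart_inv U \<phi> w)"] by auto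
  have conn: "connected (- ball c R)"
    by (rule connected_complement_bounded_convex) auto
  have Q1: "exp (l w) = exp 0" if "w \<in> - ball c R" for w
    using supp[of "chart_inv U \<phi> w"] l(2)[of w] ch that by (auto simp: disc_def)
  obtain n :: int where n: "\<forall>w \<in> - ball c R. l w = 0 + 2 * of_real pi * \<i> * of_int n"
  proof -
    have "continuous_on (- ball c R) l" by (rule continuous_on_subset[OF l(1)]) simp
    from continuous_logs_differ_by_const[OF conn this continuous_on_const Q1] show ?thesis
      using that by blast
  qed
  \<comment> \<open>With the constant subtracted, the logarithm is 0 off the disc and extends by 0
    beyond \<open>U\<close>.\<close>
  define L where "L z = (if z \<in> U then l (\<phi> z) - 2 * of_real pi * \<i> * of_int n else 0)" for z
  have L0: "L z = 0" if "z \<notin> disc U \<phi> c R" for z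
    using that n by (auto simp: L_def disc_def)
  have e2: "exp (2 * of_real pi * \<i> * of_int n) = (1::complex)"
    using exp_integer_2pi[of "of_int n"] by (simp add: mult_ac)
  show ?thesis
  proof (rule that[of L])
    fix z assume z: "z \<in> topspace M"
    show "cont_at M L z \<and> Q z = exp (L z)"
    proof (cases "z \<in> U")
      case True
      have l1: "cont_at M (\<lambda>z. l (\<phi> z) - 2 * of_real pi * \<i> * of_int n) z"
        by (intro cont_at_diff cont_at_const z cont_at_compose_on[OF cont_at_chart[OF U True] l(1)]) auto
      have e: "l (\<phi> y) - 2 * of_real pi * \<i> * of_int n = L y" if "y \<in> U" for y
        using that by (simp add: L_def)
      have "cont_at M L z" by (rule cont_at_cong_open[OF openin_chart[OF U] True e l1])
      moreover have "Q z = exp (L z)"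
        using l(2)[of "\<phi> z"] ch(7)[OF True] True e2 by (simp add: L_def exp_diff)
      ultimately show ?thesis by simp
    next
      case False
      then have "cont_at M L z" using cont_at_off_disc[OF U z False L0] by simp
      moreover have "z \<notin> disc U \<phi> c R" using False by (auto simp: disc_def)
      ultimately show ?thesis using supp L0 by simp
    qed
  qed
qed

end

subsection \<open>The two sides of a Jordan curve\<close>

text \<open>The curve is a periodic map on the whole line, so a period can be centred at any of its
  points.\<close>

locale jordan_curve_in_surface = oriented_surface +
  fixes j :: "real \<Rightarrow> 'a"
  assumes cont_j: "continuous_map euclideanreal M j" and periodic: "j (t + 1) = j t"
    and inj_j: "inj_on j {0..<1}"
begin

definition J :: "'a set" where "J = range j"

definition turning :: "('a \<Rightarrow> complex) \<Rightarrow> complex" where "turning f = dlog 0 1 (\<lambda>t. f (j t))"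

definition nonvanishing :: "('a \<Rightarrow> complex) \<Rightarrow> bool" where
  "nonvanishing f \<longleftrightarrow> (\<forall>z\<in>J. cont_at M f z \<and> f z \<noteq> 0)"

lemma j_in_J [simp]: "j t \<in> J" by (simp add: J_def)

lemma j_int: "j (t + of_int n) = j t"
proof -
  have nat: "j (t + of_nat m) = j t" for m t
    by (induction m) (use periodic in \<open>simp_all add: add.assoc[symmetric] add.commute[of 1]\<close>)
  show ?thesis
  proof (cases "n \<ge> 0")
    case True
    then show ?thesis using nat[of t "nat n"] by simp
  next
    case False
    then show ?thesis using nat[of "t + of_int n" "nat (-n)"] by simp
  qed
qed

lemma J_eq: "J = j ` {0..1}"
proof -
  have "j t \<in> j ` {0..1}" for t
  proof -
    have "j t = j (frac t)" using j_int[of "frac t" "\<lfloor>t\<rfloor>"] by (simp add: frac_def)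
    moreover have "frac t \<in> {0..1}" using frac_ge_0 frac_lt_1[of t] by (auto intro: less_imp_le)
    ultimately show ?thesis by blast
  qed
  then show ?thesis unfolding J_def by auto
qed

lemma j_eq_iff: "j s = j t \<longleftrightarrow> (\<exists>n::int. s = t + of_int n)"
proof
  assume "j s = j t"
  then have "j (frac s) = j (frac t)"
    using j_int[of "frac s" "\<lfloor>s\<rfloor>"] j_int[of "frac t" "\<lfloor>t\<rfloor>"] by (simp add: frac_def)
  moreover have "frac s \<in> {0..<1}" "frac t \<in> {0..<1}" by (simp_all add: frac_lt_1)
  ultimately have "frac s = frac t" using inj_j by (meson inj_onD)
  then show "\<exists>n::int. s = t + of_int n"
    by (intro exI[of _ "\<lfloor>s\<rfloor> - \<lfloor>t\<rfloor>"]) (simp add: frac_def algebra_simps)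
qed (use j_int in auto)

lemma J_top: "J \<subseteq> topspace M"
  using cont_j unfolding J_def continuous_map_def by auto

lemma compactin_image: "compact S \<Longrightarrow> compactin M (j ` S)"
  by (rule image_compactin[OF _ cont_j]) simp

lemma closedin_image: "compact S \<Longrightarrow> closedin M (j ` S)"
  using compactin_image Hausdorff compactin_imp_closedin by blast

lemma closedin_J: "closedin M J"
  unfolding J_eq by (rule closedin_image) simp

lemma openin_diff_J: "openin M A \<Longrightarrow> openin M (A - J)"
  using closedin_J by (simp add: openin_diff)

lemma continuous_on_compose_j:
  "(\<And>z. z \<in> J \<Longrightarrow> cont_at M f z) \<Longrightarrow> continuous_on S (\<lambda>t. f (j t))"
  by (rule continuous_on_compose_cont_at[where M=M])
     (auto intro: continuous_map_from_subtopology cont_j)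

lemma nonvanishing_comp:
  assumes "nonvanishing f"
  shows "continuous_on S (\<lambda>t. f (j t))" "f (j t) \<noteq> 0"
  using assms unfolding nonvanishing_def
  by (auto intro!: continuous_on_compose_j)

lemma turning_mult: "nonvanishing f \<Longrightarrow> nonvanishing g \<Longrightarrow> turning (\<lambda>z. f z * g z) = turning f + turning g"
  unfolding turning_def by (rule dlog_mult) (simp_all add: nonvanishing_comp)

lemma turning_divide: "nonvanishing f \<Longrightarrow> nonvanishing g \<Longrightarrow> turning (\<lambda>z. f z / g z) = turning f - turning g"
  unfolding turning_def by (rule dlog_divide) (simp_all add: nonvanishing_comp)

lemma turning_cong: "(\<And>z. z \<in> J \<Longrightarrow> f z = g z) \<Longrightarrow> turning f = turning g"
  unfolding turning_def by (rule dlog_cong) auto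

lemma turning_1: "(\<And>z. z \<in> J \<Longrightarrow> f z = 1) \<Longrightarrow> turning f = 0"
  unfolding turning_def by (rule dlog_eq_0) auto

lemma turning_exp:
  assumes "\<And>z. z \<in> J \<Longrightarrow> cont_at M L z \<and> f z = exp (L z)"
  shows "turning f = 0"
proof -
  have "turning f = L (j 1) - L (j 0)"
    unfolding turning_def using assms
    by (intro dlog_eq[where l="\<lambda>t. L (j t)"] continuous_on_compose_j) auto
  then show ?thesis using periodic[of 0] by simp
qed

lemma turning_disc_supported:
  assumes "(U,\<phi>) \<in> \<A>" "\<And>z. z \<in> topspace M \<Longrightarrow> cont_at M Q z \<and> Q z \<noteq> 0"
    "\<And>z. z \<notin> disc U \<phi> c R \<Longrightarrow> Q z = 1"
  shows "turning Q = 0"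
  using log_of_disc_supported[OF assms] turning_exp J_top by (metis subsetD)

section \<open>The turning of edge functions along the curve\<close>

lemma nonvanishing_edge:
  assumes "(U,\<phi>) \<in> \<A>" "x \<in> disc U \<phi> c r - J" "y \<in> disc U \<phi> c r - J"
  shows "nonvanishing (edge U \<phi> c r x y)"
  using edge_cont[OF assms(1)] assms J_top unfolding nonvanishing_def by blast

lemma turning_edge_refl:
  assumes U: "(U,\<phi>) \<in> \<A>" and x: "x \<in> U - J"
  shows "turning (edge U \<phi> c r x x) = 0"
proof (rule turning_1)
  fix z assume "z \<in> J"
  then have "z \<noteq> x" using x by auto
  then show "edge U \<phi> c r x x z = 1"
    using chart_diff_nonzero[OF U, of x z] x by (auto simp: edge_def cutoff_log_def)
qed

text \<open>The fractions telescope. The cutoffs leave a factor \<open>E\<close>, the exponential of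
  a continuous function, which is 1 off the larger disc and so does not turn. Hence the turning
  behaves like a difference of potentials.\<close>

lemma turning_edge_trans:
  assumes U: "(U,\<phi>) \<in> \<A>"
    and xyz: "x \<in> disc U \<phi> c r - J" "y \<in> disc U \<phi> c r - J" "z \<in> disc U \<phi> c r - J"
  shows "turning (edge U \<phi> c r x y) + turning (edge U \<phi> c r y z) = turning (edge U \<phi> c r x z)"
proof -
  define \<eta> where "\<eta> w = cutoff_log c r (\<phi> x) (\<phi> y) w + cutoff_log c r (\<phi> y) (\<phi> z) w
      - cutoff_log c r (\<phi> x) (\<phi> z) w" for w
  have cl: "continuous_on UNIV \<eta>" unfolding \<eta>_def
    using xyz by (intro continuous_intros cutoff_log_continuous) (auto simp: disc_def)
  define E where "E w = (if w \<in> U then exp (\<eta> (\<phi> w)) else 1)" for w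
  have xyzU: "x \<in> U" "y \<in> U" "z \<in> U" using xyz by (auto simp: disc_def)
  have r: "r > 0" using xyz(1) by (auto simp: disc_def intro: le_less_trans[OF zero_le_dist])
  have eq: "edge U \<phi> c r x y w * edge U \<phi> c r y z w = edge U \<phi> c r x z w * E w"
    if "w \<noteq> x" "w \<noteq> y" "w \<noteq> z" for w
  proof (cases "w \<in> U")
    case True
    have "\<phi> w - \<phi> y \<noteq> 0" using chart_diff_nonzero[OF U xyzU(2) True] that by simp
    then have 1: "(\<phi> w - \<phi> x) / (\<phi> w - \<phi> y) * ((\<phi> w - \<phi> y) / (\<phi> w - \<phi> z)) = (\<phi> w - \<phi> x) / (\<phi> w - \<phi> z)"
      by simp
    have 2: "exp (cutoff_log c r (\<phi> x) (\<phi> y) (\<phi> w)) * exp (cutoff_log c r (\<phi> y) (\<phi> z) (\<phi> w))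
        = exp (cutoff_log c r (\<phi> x) (\<phi> z) (\<phi> w)) * exp (\<eta> (\<phi> w))"
      by (simp add: \<eta>_def flip: exp_add)
    have "edge U \<phi> c r x y w * edge U \<phi> c r y z w =
        ((\<phi> w - \<phi> x) / (\<phi> w - \<phi> y) * ((\<phi> w - \<phi> y) / (\<phi> w - \<phi> z))) *
        (exp (cutoff_log c r (\<phi> x) (\<phi> y) (\<phi> w)) * exp (cutoff_log c r (\<phi> y) (\<phi> z) (\<phi> w)))"
      by (simp only: edge_def True if_True mult_ac)
    also have "\<dots> = edge U \<phi> c r x z w * E w"
      unfolding 1 2 by (simp only: edge_def E_def True if_True mult_ac)
    finally show ?thesis .
  qed (simp add: edge_def E_def)
  \<comment> \<open>Read off from the product formula, in which all three edges are 1; this avoids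
    comparing principal logarithms.\<close>
  have E1: "E w = 1" if w: "w \<notin> disc U \<phi> c (2*r)" for w
  proof -
    have "w \<noteq> x" "w \<noteq> y" "w \<noteq> z" using w xyz disc_mono[of r "2*r" U \<phi> c] r by auto
    from eq[OF this] show ?thesis
      using edge_outside w xyz by (metis DiffD1 mult_1)
  qed
  have Enz: "cont_at M E w \<and> E w \<noteq> 0" if w: "w \<in> topspace M" for w
  proof (cases "w \<in> U")
    case True
    have c1: "cont_at M (\<lambda>w. exp (\<eta> (\<phi> w))) w"
      by (rule cont_at_exp, rule cont_at_compose_on[OF cont_at_chart[OF U True] cl]) auto
    have "cont_at M E w"
      by (rule cont_at_cong_open[OF openin_chart[OF U] True _ c1]) (simp add: E_def)
    then show ?thesis by (simp add: E_def)
  next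
    case False
    have "cont_at M E w"
      by (rule cont_at_off_disc[OF U w False, where c=c and r="2*r" and a=1]) (rule E1)
    then show ?thesis using False by (simp add: E_def)
  qed
  have nE: "nonvanishing E" using Enz J_top by (auto simp: nonvanishing_def)
  have "turning E = 0" by (rule turning_disc_supported[OF U Enz E1])
  have "turning (edge U \<phi> c r x y) + turning (edge U \<phi> c r y z)
      = turning (\<lambda>w. edge U \<phi> c r x y w * edge U \<phi> c r y z w)"
    by (rule turning_mult[symmetric]) (intro nonvanishing_edge U xyz)+
  also have "\<dots> = turning (\<lambda>w. edge U \<phi> c r x z w * E w)"
    by (rule turning_cong, rule eq) (use xyz in auto)
  also have "\<dots> = turning (edge U \<phi> c r x z) + turning E"
    by (rule turning_mult) (intro nonvanishing_edge U xyz nE)+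
  finally show ?thesis using \<open>turning E = 0\<close> by simp
qed

text \<open>Both edges have a simple zero at \<open>x\<close> and a simple pole at \<open>y\<close>.
  As orders agree in all charts, the quotient has order 0 at both points; after a removal off
  \<open>J\<close> it is supported in one disc and does not turn. The double radius is where the
  inner edge becomes 1.\<close>

lemma turning_edge_coherent:
  assumes U: "(U,\<phi>) \<in> \<A>" and V: "(V,\<psi>) \<in> \<A>" and sub: "disc V \<psi> c' (2*r') \<subseteq> disc U \<phi> c r"
    and xy: "x \<in> disc V \<psi> c' r' - J" "y \<in> disc V \<psi> c' r' - J"
  shows "turning (edge U \<phi> c r x y) = turning (edge V \<psi> c' r' x y)"
proof -
  have r': "r' > 0" using xy(1) by (auto simp: disc_def intro: le_less_trans[OF zero_le_dist])
  have xyU: "x \<in> disc U \<phi> c r - J" "y \<in> disc U \<phi> c r - J"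
    using xy sub disc_mono[of r' "2*r'" V \<psi> c'] r' by auto
  have r: "r > 0" using xyU(1) by (auto simp: disc_def intro: le_less_trans[OF zero_le_dist])
  have UV: "x \<in> U - J" "x \<in> V - J" using xy xyU by (auto simp: disc_def)
  show ?thesis
  proof (cases "x = y")
    case True
    then show ?thesis using turning_edge_refl[OF U UV(1)] turning_edge_refl[OF V UV(2)] by simp
  next
    case False
    define Q where "Q z = edge U \<phi> c r x y z / edge V \<psi> c' r' x y z" for z
    have "has_order Q x (1 - 1)" "has_order Q y (-1 - (-1))"
      unfolding Q_def using xy xyU False by (intro has_order_divide edge_order U V; auto)+
    moreover have "cont_at M Q z \<and> Q z \<noteq> 0" if "z \<in> topspace M" "z \<noteq> x" "z \<noteq> y" for z
      unfolding Q_def using edge_cont[OF U _ _ that, of c r] edge_cont[OF V _ _ that, of c' r'] xy xyU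
      by (auto intro!: cont_at_divide)
    ultimately obtain g where g: "\<And>z. z \<notin> disc U \<phi> c r - J \<Longrightarrow> g z = Q z"
        "\<And>z. z \<in> topspace M \<Longrightarrow> cont_at M g z \<and> g z \<noteq> 0"
      using remove_order_0_twice[of x y Q "disc U \<phi> c r - J"] openin_diff_J[OF openin_disc[OF U]] xyU False
      by auto
    have g1: "g z = 1" if z: "z \<notin> disc U \<phi> c (2*r)" for z
    proof -
      have zr: "z \<notin> disc U \<phi> c r" using z disc_mono[of r "2*r" U \<phi> c] r by auto
      then have "z \<notin> disc V \<psi> c' (2*r')" using sub by blast
      then show ?thesis
        using g(1)[of z] zr z edge_outside[of x U \<phi> c r y z] edge_outside[of x V \<psi> c' r' y z] xy xyU
        by (simp add: Q_def)
    qed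
    have "turning g = 0" by (rule turning_disc_supported[OF U g(2) g1])
    moreover have "turning Q = turning g" by (rule turning_cong) (use g(1) in auto)
    moreover have "turning Q = turning (edge U \<phi> c r x y) - turning (edge V \<psi> c' r' x y)"
      unfolding Q_def by (rule turning_divide) (intro nonvanishing_edge U V xy xyU)+
    ultimately show ?thesis by simp
  qed
qed

text \<open>Around \<open>x\<close> there is a disc whose double avoids \<open>J\<close>. Its edges
  are 1 on \<open>J\<close>, and coherence carries this over to the given disc. So the potential
  mentioned at \<open>turning_edge_trans\<close> is locally constant.\<close>

lemma turning_edge_near:
  assumes U: "(U,\<phi>) \<in> \<A>" and x: "x \<in> disc U \<phi> c r - J"
  obtains A where "openin M A" "x \<in> A" "A \<subseteq> disc U \<phi> c r - J"
    "\<And>y. y \<in> A \<Longrightarrow> turning (edge U \<phi> c r y x) = 0"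
proof -
  have xU: "x \<in> U" using x by (auto simp: disc_def)
  obtain s where s: "s > 0" "{y \<in> U. \<phi> y \<in> cball (\<phi> x) s} \<subseteq> disc U \<phi> c r - J"
    using chart_small_ball[OF charts[OF U] openin_diff_J[OF openin_disc[OF U]] x xU] by blast
  have sub: "disc U \<phi> (\<phi> x) (2 * (s/2)) \<subseteq> disc U \<phi> c r - J"
    using s by (auto simp: disc_def)
  have sub1: "disc U \<phi> (\<phi> x) (s/2) \<subseteq> disc U \<phi> c r - J"
    using sub disc_mono[of "s/2" "2*(s/2)" U \<phi> "\<phi> x"] s by auto
  have xd: "x \<in> disc U \<phi> (\<phi> x) (s/2)" using xU s by (auto simp: disc_def)
  show ?thesis
  proof (rule that[OF openin_disc[OF U] xd sub1])
    fix y assume y: "y \<in> disc U \<phi> (\<phi> x) (s/2)"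
    have "turning (edge U \<phi> c r y x) = turning (edge U \<phi> (\<phi> x) (s/2) y x)"
      by (rule turning_edge_coherent[OF U U]) (use sub sub1 y xd x in blast)+
    also have "\<dots> = 0"
      by (rule turning_1, rule edge_outside[OF y xd]) (use sub in blast)
    finally show "turning (edge U \<phi> c r y x) = 0" .
  qed
qed

text \<open>The points that some other point of the disc is separated from, with the sign telling
  the sides apart: the turning is a difference of winding numbers, and the curve winds once more
  around points on the left.\<close>

definition left :: "'a set \<Rightarrow> ('a \<Rightarrow> complex) \<Rightarrow> complex \<Rightarrow> real \<Rightarrow> 'a set" where
  "left U \<phi> c r = {x \<in> disc U \<phi> c r - J. \<exists>y \<in> disc U \<phi> c r - J. turning (edge U \<phi> c r x y) = 2 * of_real pi * \<i>}"

definition right :: "'a set \<Rightarrow> ('a \<Rightarrow> complex) \<Rightarrow> complex \<Rightarrow> real \<Rightarrow> 'a set" where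
  "right U \<phi> c r = {y \<in> disc U \<phi> c r - J. \<exists>x \<in> disc U \<phi> c r - J. turning (edge U \<phi> c r x y) = 2 * of_real pi * \<i>}"

text \<open>Since the turning is additive, these bounds and the one attained value mean that the
  potential takes exactly two values.\<close>

definition two_sided :: "'a set \<Rightarrow> ('a \<Rightarrow> complex) \<Rightarrow> complex \<Rightarrow> real \<Rightarrow> bool" where
  "two_sided U \<phi> c r \<longleftrightarrow> (U,\<phi>) \<in> \<A> \<and>
     (\<forall>x \<in> disc U \<phi> c r - J. \<forall>y \<in> disc U \<phi> c r - J.
        turning (edge U \<phi> c r x y) \<in> {- (2 * of_real pi * \<i>), 0, 2 * of_real pi * \<i>}) \<and>
     (\<exists>x \<in> disc U \<phi> c r - J. \<exists>y \<in> disc U \<phi> c r - J. turning (edge U \<phi> c r x y) = 2 * of_real pi * \<i>)"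

text \<open>Pure arithmetic with the additive \<open>T\<close>: a point on both sides would produce
  the value \<open>w + w\<close>. For the covering, a point \<open>x\<close> is compared with a
  fixed pair \<open>u\<close>, \<open>v\<close> of turning \<open>w\<close>; the value
  \<open>T x u = w\<close> is excluded for the same reason, and 0 or \<open>-w\<close> puts
  \<open>x\<close> on the left or on the right.\<close>

lemma two_sided_left_right:
  assumes "two_sided U \<phi> c r"
  shows "left U \<phi> c r \<inter> right U \<phi> c r = {}" "left U \<phi> c r \<union> right U \<phi> c r = disc U \<phi> c r - J"
    "openin M (left U \<phi> c r)" "openin M (right U \<phi> c r)"
    "left U \<phi> c r \<noteq> {}" "right U \<phi> c r \<noteq> {}"
proof -
  define D where "D = disc U \<phi> c r - J"
  define T where "T x y = turning (edge U \<phi> c r x y)" for x y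
  define w where "w = 2 * of_real pi * \<i>"
  have w0: "w \<noteq> 0" by (simp add: w_def)
  have w3: "w + w \<noteq> - w" "w + w \<noteq> 0" "w + w \<noteq> w" "-w \<noteq> w"
    using w0 by (auto simp: w_def complex_eq_iff)
  have U: "(U,\<phi>) \<in> \<A>" using assms by (simp add: two_sided_def)
  have vals: "T x y \<in> {-w, 0, w}" if "x \<in> D" "y \<in> D" for x y
    using assms that by (simp add: two_sided_def D_def T_def w_def)
  have tr: "T x y + T y z = T x z" if "x \<in> D" "y \<in> D" "z \<in> D" for x y z
    using turning_edge_trans[OF U] that by (simp add: D_def T_def)
  obtain u v where uv: "u \<in> D" "v \<in> D" "T u v = w"
    using assms unfolding two_sided_def D_def T_def w_def by blast
  have L: "left U \<phi> c r = {x \<in> D. \<exists>y \<in> D. T x y = w}" and R: "right U \<phi> c r = {y \<in> D. \<exists>x \<in> D. T x y = w}"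
    by (auto simp: left_def right_def D_def T_def w_def)
  have "False" if "x \<in> D" "y \<in> D" "z \<in> D" "T x y = w" "T z x = w" for x y z
    using tr[OF that(3,1,2)] vals[OF that(3,2)] that w3 by auto
  then show "left U \<phi> c r \<inter> right U \<phi> c r = {}" unfolding L R by blast
  have rf: "T x x = 0" if "x \<in> D" for x using tr[OF that that that] by simp
  have as: "T x y = - T y x" if "x \<in> D" "y \<in> D" for x y
    using tr[OF that that(1)] rf[OF that(1)] by (simp add: eq_neg_iff_add_eq_0)
  have "x \<in> left U \<phi> c r \<union> right U \<phi> c r" if x: "x \<in> D" for x
  proof -
    have "T x u + w = T x v" using tr[OF x uv(1,2)] uv(3) by simp
    then have "T x u \<noteq> w" using vals[OF x uv(2)] w3 by auto
    then consider "T x u = 0" | "T x u = -w" using vals[OF x uv(1)] by auto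
    then show ?thesis
    proof cases
      case 1
      then have "T x v = w" using tr[OF x uv(1,2)] uv(3) by simp
      then show ?thesis using L x uv by blast
    next
      case 2
      then have "T u x = w" using as[OF uv(1) x] by simp
      then show ?thesis using R x uv by blast
    qed
  qed
  then show "left U \<phi> c r \<union> right U \<phi> c r = disc U \<phi> c r - J"
    unfolding L R D_def by blast
  show "openin M (left U \<phi> c r)"
  proof (subst openin_subopen, intro ballI)
    fix x assume "x \<in> left U \<phi> c r"
    then obtain y where xy: "x \<in> D" "y \<in> D" "T x y = w" unfolding L by blast
    then obtain A where A: "openin M A" "x \<in> A" "A \<subseteq> D" "\<And>z. z \<in> A \<Longrightarrow> T z x = 0"
      using turning_edge_near[OF U, of x c r] unfolding D_def T_def by metis
    have "z \<in> left U \<phi> c r" if "z \<in> A" for z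
    proof -
      have "z \<in> D" using that A by blast
      moreover have "T z y = w" using tr[OF \<open>z \<in> D\<close> xy(1,2)] A(4)[OF that] xy by simp
      ultimately show ?thesis unfolding L using xy by blast
    qed
    then show "\<exists>T. openin M T \<and> x \<in> T \<and> T \<subseteq> left U \<phi> c r" using A by blast
  qed
  show "openin M (right U \<phi> c r)"
  proof (subst openin_subopen, intro ballI)
    fix x assume "x \<in> right U \<phi> c r"
    then obtain y where xy: "x \<in> D" "y \<in> D" "T y x = w" unfolding R by blast
    then obtain A where A: "openin M A" "x \<in> A" "A \<subseteq> D" "\<And>z. z \<in> A \<Longrightarrow> T z x = 0"
      using turning_edge_near[OF U, of x c r] unfolding D_def T_def by metis
    have "z \<in> right U \<phi> c r" if "z \<in> A" for z
    proof -
      have "z \<in> D" using that A by blast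
      moreover have "T y z = w"
        using tr[OF xy(2,1) \<open>z \<in> D\<close>] A(4)[OF that] as[OF \<open>z \<in> D\<close> xy(1)] xy by simp
      ultimately show ?thesis unfolding R using xy by blast
    qed
    then show "\<exists>T. openin M T \<and> x \<in> T \<and> T \<subseteq> right U \<phi> c r" using A by blast
  qed
  show "left U \<phi> c r \<noteq> {}" "right U \<phi> c r \<noteq> {}" unfolding L R using uv by blast+
qed

text \<open>A witness for the side in the small disc is also one in the large disc, because the two
  edges have equal turning.\<close>

lemma left_right_mono:
  assumes U: "(U,\<phi>) \<in> \<A>" and V: "(V,\<psi>) \<in> \<A>" and sub: "disc V \<psi> c' (2*r') \<subseteq> disc U \<phi> c r"
  shows "left V \<psi> c' r' \<subseteq> left U \<phi> c r" "right V \<psi> c' r' \<subseteq> right U \<phi> c r"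
proof -
  have *: "x \<in> disc U \<phi> c r - J" if "x \<in> disc V \<psi> c' r' - J" for x
  proof -
    have "r' > 0" using that by (auto simp: disc_def intro: le_less_trans[OF zero_le_dist])
    then show ?thesis using that sub disc_mono[of r' "2*r'" V \<psi> c'] by auto
  qed
  show "left V \<psi> c' r' \<subseteq> left U \<phi> c r" "right V \<psi> c' r' \<subseteq> right U \<phi> c r"
    unfolding left_def right_def using * turning_edge_coherent[OF U V sub] by fastforce+
qed

end

section \<open>Existence of two-sided discs\<close>

context jordan_curve_in_surface
begin

lemma turning_eq_dlog:
  assumes "nonvanishing f"
  shows "turning f = dlog (a - 1/2) (a + 1/2) (\<lambda>t. f (j t))"
  using dlog_periodic[of "\<lambda>t. f (j t)" "a - 1/2"] nonvanishing_comp[OF assms] periodic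
  by (simp add: turning_def add.commute)

text \<open>Near \<open>j t0\<close> the curve is part of a Jordan curve \<open>c\<close> of the
  chart plane. An edge function is 1 off a small double disc, so its turning along \<open>J\<close>
  sees only the common arc and is a difference of winding numbers of \<open>c\<close>.\<close>

lemma exists_two_sided:
  assumes G: "openin M G" "j t0 \<in> G"
  obtains U \<phi> r where "two_sided U \<phi> (\<phi> (j t0)) r" "j t0 \<in> disc U \<phi> (\<phi> (j t0)) r"
    "disc U \<phi> (\<phi> (j t0)) (2*r) \<subseteq> G"
proof -
  define p where "p = j t0"
  have ptop: "p \<in> topspace M" using G openin_subset p_def by blast
  then obtain U \<phi> where U: "(U,\<phi>) \<in> \<A>" "p \<in> U" using cover by blast
  note ch = chart_props[OF charts[OF U(1)]]
  have "openin euclideanreal {t \<in> topspace euclideanreal. j t \<in> U}"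
    by (rule openin_continuous_map_preimage[OF cont_j openin_chart[OF U(1)]])
  then have "open {t. j t \<in> U}" by simp
  then obtain e where e: "e > 0" "cball t0 e \<subseteq> {t. j t \<in> U}"
    using U(2) open_contains_cball p_def by (metis mem_Collect_eq)
  \<comment> \<open>With \<open>1/3\<close> the interval of length \<open>2*d\<close> is shorter
    than a period, so \<open>j\<close> is injective on it.\<close>
  define d where "d = min e (1/3)"
  have d: "d > 0" "d \<le> e" "d \<le> 1/3" using e by (auto simp: d_def)
  have jU: "j t \<in> U" if "t \<in> {t0-d..t0+d}" for t
  proof -
    have "t \<in> cball t0 e" using that d by (auto simp: dist_real_def)
    then show ?thesis using e by blast
  qed
  define \<alpha> where "\<alpha> t = \<phi> (j t)" for t
  have \<alpha>cont: "continuous_on {t0-d..t0+d} \<alpha>" unfolding \<alpha>_def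
    by (rule continuous_on_compose_cont_at[where M=M])
       (auto intro: continuous_map_from_subtopology cont_j intro!: cont_at_chart[OF U(1)] jU)
  have \<alpha>inj: "inj_on \<alpha> {t0-d..t0+d}"
  proof (rule inj_onI)
    fix s t assume st: "s \<in> {t0-d..t0+d}" "t \<in> {t0-d..t0+d}" "\<alpha> s = \<alpha> t"
    then have "j s = j t" using ch(4) jU unfolding \<alpha>_def by (meson inj_onD)
    then obtain n :: int where n: "s = t + of_int n" using j_eq_iff by blast
    then have "\<bar>of_int n :: real\<bar> < 1" using st d by auto
    then have "n = 0" by linarith
    then show "s = t" using n by simp
  qed
  obtain s t q where st: "t0 - d < s" "s < t0" "t0 < t" "t < t0 + d"
    and cs: "simple_path (subpath s t \<alpha> +++ q)"
        "pathfinish (subpath s t \<alpha> +++ q) = pathstart (subpath s t \<alpha> +++ q)"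
    and q: "path q" "pathstart q = \<alpha> t" "\<alpha> t0 \<notin> path_image q"
    using arc_extends_to_simple_closed_path[OF \<alpha>cont \<alpha>inj, of t0] d by auto
  define c where "c = subpath s t \<alpha> +++ q"
  note cs = cs[folded c_def]
  have st_sub: "{s..t} \<subseteq> {t0-d..t0+d}" using st by auto
  have cimg: "path_image c = \<alpha> ` {s..t} \<union> path_image q"
    unfolding c_def using q st by (subst path_image_join) (auto simp: path_image_subpath)
  \<comment> \<open>\<open>K1\<close> is the part added to complete the arc, \<open>K2\<close> the
    rest of \<open>J\<close>. Both are closed and avoid \<open>p\<close>, so inside a small disc
    \<open>J\<close> and \<open>c\<close> coincide.\<close>
  define K1 where "K1 = chart_inv U \<phi> ` path_image q"
  define K2 where "K2 = j ` ({t0-1/2..s} \<union> {t..t0+1/2})"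
  have K1: "closedin M K1"
  proof -
    have "compactin M K1" unfolding K1_def
      by (rule image_compactin[OF _ ch(8)]) (simp add: compact_path_image q)
    then show ?thesis using Hausdorff compactin_imp_closedin by blast
  qed
  have K2: "closedin M K2" unfolding K2_def by (rule closedin_image) (simp add: compact_Un)
  have pK1: "p \<notin> K1"
  proof
    assume "p \<in> K1"
    then have "\<phi> p \<in> path_image q" unfolding K1_def using ch(6) by auto
    then show False using q(3) by (simp add: \<alpha>_def p_def)
  qed
  have pK2: "p \<notin> K2"
  proof
    assume "p \<in> K2"
    then obtain t' where t': "t' \<in> {t0-1/2..s} \<union> {t..t0+1/2}" "j t' = j t0"
      unfolding K2_def p_def by force
    then obtain n :: int where n: "t' = t0 + of_int n" using j_eq_iff by blast
    then have "\<bar>of_int n :: real\<bar> < 1" using t' st by auto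
    then have "n = 0" by linarith
    then show False using n t' st by auto
  qed
  have Jin: "\<exists>t'\<in>{s<..<t}. x = j t'" if x: "x \<in> J" "x \<notin> K2" for x
  proof -
    obtain u where u: "x = j u" using x unfolding J_def by blast
    define u' where "u' = t0 - 1/2 + frac (u - (t0 - 1/2))"
    have "u = u' + of_int \<lfloor>u - (t0 - 1/2)\<rfloor>" by (simp add: u'_def frac_def)
    then have "j u = j u'" using j_int by metis
    then have "x = j u'" using u by simp
    moreover have "u' \<in> {t0-1/2..t0+1/2}"
      using frac_ge_0[of "u - (t0 - 1/2)"] frac_lt_1[of "u - (t0 - 1/2)"] by (auto simp: u'_def)
    ultimately have "u' \<in> {s<..<t}" using x(2) st unfolding K2_def
      by (metis (no_types, lifting) UnI1 UnI2 atLeastAtMost_iff greaterThanLessThan_iff imageI not_le)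
    then show ?thesis using \<open>x = j u'\<close> by blast
  qed
  define A where "A = G - K1 - K2"
  have A: "openin M A" "p \<in> A" using G K1 K2 pK1 pK2 by (auto simp: A_def p_def intro!: openin_diff)
  obtain r1 where r1: "r1 > 0" "{y \<in> U. \<phi> y \<in> cball (\<phi> p) r1} \<subseteq> A"
    using chart_small_ball[OF charts[OF U(1)] A U(2)] by blast
  \<comment> \<open>Halved because an edge function is known to be 1 only off the disc of double
    radius.\<close>
  define r where "r = r1 / 2"
  have r: "r > 0" using r1 by (simp add: r_def)
  define D where "D = disc U \<phi> (\<phi> p) r"
  have D2: "disc U \<phi> (\<phi> p) (2*r) \<subseteq> A" using r1 by (auto simp: disc_def r_def)
  have D12: "D \<subseteq> disc U \<phi> (\<phi> p) (2*r)" unfolding D_def using r by (intro disc_mono) auto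
  have DU: "D \<subseteq> U" by (auto simp: D_def disc_def)
  have nin: "\<phi> x \<notin> path_image c" if x: "x \<in> D - J" for x
  proof
    have xA: "x \<in> A" "x \<in> U" using x D12 D2 DU by auto
    assume "\<phi> x \<in> path_image c"
    then consider t' where "t' \<in> {s..t}" "\<phi> x = \<alpha> t'" | "\<phi> x \<in> path_image q" unfolding cimg by blast
    then show False
    proof cases
      case 1
      then have "x = j t'" using ch(4) xA(2) jU st_sub unfolding \<alpha>_def by (metis inj_onD subsetD)
      then show False using x by simp
    next
      case 2
      then have "x \<in> K1" unfolding K1_def using ch(7)[OF xA(2)] by (metis imageI)
      then show False using xA by (simp add: A_def)
    qed
  qed
  have turn: "turning (edge U \<phi> (\<phi> p) r x y)
      = 2 * of_real pi * \<i> * (winding_number c (\<phi> x) - winding_number c (\<phi> y))"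
    if xy: "x \<in> D - J" "y \<in> D - J" for x y
  proof -
    define a where "a = \<phi> x"
    define b where "b = \<phi> y"
    have ab: "a \<in> ball (\<phi> p) r" "b \<in> ball (\<phi> p) r" using xy by (auto simp: D_def disc_def a_def b_def)
    have abc: "a \<notin> path_image c" "b \<notin> path_image c" using nin xy by (auto simp: a_def b_def)
    define f where "f = edge U \<phi> (\<phi> p) r x y"
    have fnz: "nonvanishing f" unfolding f_def
      by (rule nonvanishing_edge[OF U(1)]) (use xy in \<open>auto simp: D_def\<close>)
    \<comment> \<open>The edge function in the coordinate of the chart; it can be evaluated along
      all of \<open>c\<close>, including \<open>q\<close>.\<close>
    define F where "F w = (w - a) / (w - b) * exp (cutoff_log (\<phi> p) r a b w)" for w
    have Ff: "F (\<phi> z) = f z" if "z \<in> U" for z using that by (simp add: F_def f_def edge_def a_def b_def)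
    have f1: "f z = 1" if "z \<in> K2" for z
      unfolding f_def by (rule edge_outside) (use xy that D2 in \<open>auto simp: D_def A_def\<close>)
    have F1: "F w = 1" if w: "w \<in> path_image q" for w
    proof -
      have "chart_inv U \<phi> w \<in> K1" using w by (auto simp: K1_def)
      then have "chart_inv U \<phi> w \<notin> disc U \<phi> (\<phi> p) (2*r)" using D2 by (auto simp: A_def)
      then have "2 * r \<le> dist (\<phi> p) w" using ch(5,6) by (auto simp: disc_def not_less)
      then show ?thesis unfolding F_def by (rule cutoff_log_outside[OF ab])
    qed
    have fj: "continuous_on S (\<lambda>t. f (j t))" "f (j u) \<noteq> 0" for S u
      using nonvanishing_comp[OF fnz] by auto
    \<comment> \<open>In the period centred at \<open>t0\<close>, both outer pieces run in
      \<open>K2\<close>, where \<open>f\<close> is 1.\<close>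
    have "turning f = dlog (t0 - 1/2) (t0 + 1/2) (\<lambda>t. f (j t))" by (rule turning_eq_dlog[OF fnz])
    also have "\<dots> = dlog (t0 - 1/2) s (\<lambda>t. f (j t)) + dlog s (t0 + 1/2) (\<lambda>t. f (j t))"
      by (rule dlog_combine) (use fj st d in auto)
    also have "dlog s (t0 + 1/2) (\<lambda>t. f (j t)) = dlog s t (\<lambda>t. f (j t)) + dlog t (t0 + 1/2) (\<lambda>t. f (j t))"
      by (rule dlog_combine) (use fj st d in auto)
    also have "dlog (t0 - 1/2) s (\<lambda>t. f (j t)) = 0"
      by (rule dlog_eq_0) (use st d f1 in \<open>auto simp: K2_def\<close>)
    also have "dlog t (t0 + 1/2) (\<lambda>t. f (j t)) = 0"
      by (rule dlog_eq_0) (use st d f1 in \<open>auto simp: K2_def\<close>)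
    finally have 1: "turning f = dlog s t (\<lambda>t. f (j t))" by simp
    have cpath: "path c" using cs(1) by (rule simple_path_imp_path)
    have ccont: "continuous_on {0..1} c" using cpath by (simp add: path_def)
    have cnz: "c u - a \<noteq> 0" "c u - b \<noteq> 0" if "u \<in> {0..1}" for u
      using abc that by (auto simp: path_image_def)
    have clc: "continuous_on UNIV (cutoff_log (\<phi> p) r a b)" by (rule cutoff_log_continuous[OF ab])
    have clcc: "continuous_on {0..1} (\<lambda>u. cutoff_log (\<phi> p) r a b (c u))"
      by (rule continuous_on_compose2[OF clc ccont]) simp
    have Fc: "continuous_on {0..1} (\<lambda>u. F (c u))" unfolding F_def
      using cnz by (intro continuous_intros clcc ccont) auto
    have Fnz: "F (c u) \<noteq> 0" if "u \<in> {0..1}" for u unfolding F_def using cnz[OF that] by simp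
    have "dlog 0 1 (\<lambda>u. F (c u)) = dlog 0 (1/2) (\<lambda>u. F (c u)) + dlog (1/2) 1 (\<lambda>u. F (c u))"
      by (rule dlog_combine) (use Fc Fnz in auto)
    also have "dlog (1/2) 1 (\<lambda>u. F (c u)) = 0"
    proof (rule dlog_eq_0)
      fix u :: real assume u: "u \<in> {1/2..1}"
      have "c u \<in> path_image q"
      proof (cases "u = 1/2")
        case True
        have "c (1/2) = \<alpha> t" by (simp add: c_def joinpaths_def subpath_def)
        then have "c u = \<alpha> t" by (simp only: True)
        then show ?thesis using q(2) pathstart_in_path_image by metis
      next
        case False
        then have "c u = q (2 * u - 1)" "2 * u - 1 \<in> {0..1}" using u by (auto simp: c_def joinpaths_def)
        then show ?thesis by (auto simp: path_image_def)
      qed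
      then show "F (c u) = 1" by (rule F1)
    qed simp
    \<comment> \<open>The first half of \<open>c\<close> runs through \<open>\<alpha>\<close> from
      \<open>s\<close> to \<open>t\<close>, hence the speed \<open>2*(t-s)\<close>.\<close>
    also have "dlog 0 (1/2) (\<lambda>u. F (c u)) = dlog 0 (1/2) (\<lambda>u. f (j ((2*(t-s)) * u + s)))"
    proof (rule dlog_cong)
      fix u :: real assume u: "u \<in> {0..1/2}"
      have 1: "0 \<le> 2*(t-s) * u" using u st by simp
      have "2*(t-s) * u \<le> 2*(t-s) * (1/2)" using u st by (intro mult_left_mono) auto
      then have 2: "2*(t-s) * u \<le> t - s" by simp
      have "2*(t-s) * u + s \<in> {s..t}"
        unfolding atLeastAtMost_iff using add_mono[OF 1 order_refl, of s] add_mono[OF 2 order_refl, of s]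
        by (simp only: add_0_left diff_add_cancel simp_thms)
      then have "j ((2*(t-s)) * u + s) \<in> U" using jU st_sub by blast
      moreover have "c u = \<alpha> ((2*(t-s)) * u + s)" using u by (simp add: c_def joinpaths_def subpath_def mult_ac)
      ultimately show "F (c u) = f (j ((2*(t-s)) * u + s))" using Ff by (simp add: \<alpha>_def)
    qed
    also have "\<dots> = dlog (2*(t-s) * 0 + s) (2*(t-s) * (1/2) + s) (\<lambda>t. f (j t))"
      by (rule dlog_affine) (use st fj in auto)
    also have "2*(t-s) * 0 + s = s" by simp
    also have "2*(t-s) * (1/2) + s = t" by (simp add: field_simps)
    finally have 2: "dlog 0 1 (\<lambda>u. F (c u)) = turning f" using 1 by simp
    \<comment> \<open>The cutoff factor has a logarithm that closes up along \<open>c\<close>, so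
      only the fraction contributes.\<close>
    have "dlog 0 1 (\<lambda>u. F (c u)) = dlog 0 1 (\<lambda>u. (c u - a) / (c u - b)) + dlog 0 1 (\<lambda>u. exp (cutoff_log (\<phi> p) r a b (c u)))"
      unfolding F_def by (rule dlog_mult) (use cnz clcc ccont in \<open>auto intro!: continuous_intros\<close>)
    also have "dlog 0 1 (\<lambda>u. exp (cutoff_log (\<phi> p) r a b (c u))) = 0"
      using dlog_eq[OF _ clcc, of "\<lambda>u. exp (cutoff_log (\<phi> p) r a b (c u))"] cs(2)
      by (simp add: pathstart_def pathfinish_def)
    also have "dlog 0 1 (\<lambda>u. (c u - a) / (c u - b)) = dlog 0 1 (\<lambda>u. c u - a) - dlog 0 1 (\<lambda>u. c u - b)"
      by (rule dlog_divide) (use cnz ccont in \<open>auto intro!: continuous_intros\<close>)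
    also have "\<dots> = 2 * of_real pi * \<i> * winding_number c a - 2 * of_real pi * \<i> * winding_number c b"
      using dlog_winding_number[OF cpath] abc by simp
    finally show ?thesis using 2 by (simp add: f_def a_def b_def algebra_simps)
  qed
  have pc: "\<phi> p \<in> path_image c" unfolding cimg using st by (auto simp: p_def \<alpha>_def)
  obtain a b where ab: "a \<in> ball (\<phi> p) r - path_image c" "b \<in> ball (\<phi> p) r - path_image c"
    "winding_number c a - winding_number c b = 1"
    using simple_closed_path_winding_number_jump[OF cs pc r] by blast
  \<comment> \<open>Off \<open>K2\<close> the curve \<open>J\<close> is contained in the arc of
    \<open>c\<close>, so a point of the ball off \<open>c\<close> comes from a point off
    \<open>J\<close>.\<close>
  have inv: "chart_inv U \<phi> w \<in> D - J" if w: "w \<in> ball (\<phi> p) r - path_image c" for w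
  proof -
    have wD: "chart_inv U \<phi> w \<in> D" using w ch(5,6) by (auto simp: D_def disc_def)
    moreover have "chart_inv U \<phi> w \<notin> J"
    proof
      assume "chart_inv U \<phi> w \<in> J"
      moreover have "chart_inv U \<phi> w \<notin> K2" using wD D12 D2 by (auto simp: A_def)
      ultimately obtain t' where t': "t' \<in> {s<..<t}" "chart_inv U \<phi> w = j t'" using Jin by blast
      then have "w = \<alpha> t'" using ch(6)[of w] by (simp add: \<alpha>_def)
      then have "w \<in> path_image c" unfolding cimg using t' by auto
      then show False using w by simp
    qed
    ultimately show ?thesis by simp
  qed
  have "two_sided U \<phi> (\<phi> p) r"
    unfolding two_sided_def
  proof (intro conjI ballI)
    show "(U,\<phi>) \<in> \<A>" by (rule U)
    fix x y assume xy: "x \<in> disc U \<phi> (\<phi> p) r - J" "y \<in> disc U \<phi> (\<phi> p) r - J"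
    then have "winding_number c (\<phi> x) - winding_number c (\<phi> y) \<in> {-1,0,1}"
      by (intro simple_closed_path_winding_number_diff[OF cs] nin) (auto simp: D_def)
    then show "turning (edge U \<phi> (\<phi> p) r x y) \<in> {- (2 * of_real pi * \<i>), 0, 2 * of_real pi * \<i>}"
      using turn[of x y] xy by (auto simp: D_def)
  next
    have "turning (edge U \<phi> (\<phi> p) r (chart_inv U \<phi> a) (chart_inv U \<phi> b)) = 2 * of_real pi * \<i>"
      using turn[OF inv[OF ab(1)] inv[OF ab(2)]] ab(3) ch(6) by simp
    then show "\<exists>x\<in>disc U \<phi> (\<phi> p) r - J. \<exists>y\<in>disc U \<phi> (\<phi> p) r - J.
        turning (edge U \<phi> (\<phi> p) r x y) = 2 * of_real pi * \<i>"
      using inv[OF ab(1)] inv[OF ab(2)] unfolding D_def by blast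
  qed
  moreover have "p \<in> disc U \<phi> (\<phi> p) r" using U r by (simp add: disc_def)
  moreover have "disc U \<phi> (\<phi> p) (2*r) \<subseteq> G" using D2 by (auto simp: A_def)
  ultimately show ?thesis using that[of U \<phi> r] by (simp add: p_def)
qed

text \<open>Both sides are refined by those of any sufficiently small two-sided disc at \<open>p\<close>.\<close>
lemma sides_agree_near:
  assumes UV: "two_sided U \<phi> c r" "two_sided V \<psi> c' r'"
    and p: "p \<in> J" "p \<in> disc U \<phi> c r" "p \<in> disc V \<psi> c' r'"
  obtains G where "openin M G" "p \<in> G" "G \<inter> left U \<phi> c r \<subseteq> left V \<psi> c' r'"
    "G \<inter> right U \<phi> c r \<subseteq> right V \<psi> c' r'"
proof -
  have 1: "(U,\<phi>) \<in> \<A>" "(V,\<psi>) \<in> \<A>" using UV by (auto simp: two_sided_def)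
  obtain t0 where t0: "p = j t0" using p(1) unfolding J_def by blast
  obtain W \<theta> s where W: "two_sided W \<theta> (\<theta> p) s" "p \<in> disc W \<theta> (\<theta> p) s"
     "disc W \<theta> (\<theta> p) (2 * s) \<subseteq> disc U \<phi> c r \<inter> disc V \<psi> c' r'"
    using exists_two_sided[of "disc U \<phi> c r \<inter> disc V \<psi> c' r'" t0] p t0 openin_disc 1 by blast
  have W1: "(W,\<theta>) \<in> \<A>" using W by (simp add: two_sided_def)
  note m = left_right_mono[OF 1(1) W1, of "\<theta> p" s c r] left_right_mono[OF 1(2) W1, of "\<theta> p" s c' r']
  note lr = two_sided_left_right[OF W(1)] two_sided_left_right[OF UV(1)]
  show ?thesis
  proof (rule that[of "disc W \<theta> (\<theta> p) s"])
    show "openin M (disc W \<theta> (\<theta> p) s)" by (rule openin_disc[OF W1])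
    have sub: "left W \<theta> (\<theta> p) s \<subseteq> left U \<phi> c r" "right W \<theta> (\<theta> p) s \<subseteq> right U \<phi> c r"
       "left W \<theta> (\<theta> p) s \<subseteq> left V \<psi> c' r'" "right W \<theta> (\<theta> p) s \<subseteq> right V \<psi> c' r'"
      using m W(3) by auto
    have L: "left U \<phi> c r \<inter> J = {}" "right U \<phi> c r \<inter> J = {}" using lr(8) by blast+
    show "disc W \<theta> (\<theta> p) s \<inter> left U \<phi> c r \<subseteq> left V \<psi> c' r'"
      using lr(2,7) sub L by blast
    show "disc W \<theta> (\<theta> p) s \<inter> right U \<phi> c r \<subseteq> right V \<psi> c' r'"
      using lr(2,7) sub L by blast
  qed (rule W)
qed

end

section \<open>Local connectedness and separation properties of the surface\<close>

context oriented_surface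
begin

lemma path_connectedin_disc:
  assumes U: "(U,\<phi>) \<in> \<A>"
  shows "path_connectedin M (disc U \<phi> c r)"
proof -
  note ch = chart_props[OF charts[OF U]]
  have "disc U \<phi> c r = chart_inv U \<phi> ` ball c r"
  proof (intro equalityI subsetI)
    fix z assume "z \<in> disc U \<phi> c r"
    then show "z \<in> chart_inv U \<phi> ` ball c r" using ch(7)[of z] unfolding disc_def by (metis (mono_tags, lifting) imageI mem_Collect_eq)
  qed (use ch(5,6) in \<open>auto simp: disc_def\<close>)
  moreover have "path_connectedin euclidean (ball c r)"
    by (simp add: convex_imp_path_connected)
  ultimately show ?thesis using path_connectedin_continuous_map_image[OF ch(8)] by metis
qed

lemma locally_path_connected: "locally_path_connected_space M"
  unfolding locally_path_connected_space
proof (intro allI impI)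
  fix V x assume V: "openin M V \<and> x \<in> V"
  then have "x \<in> topspace M" using openin_subset by blast
  then obtain U \<phi> where U: "(U,\<phi>) \<in> \<A>" "x \<in> U" using cover by blast
  obtain r where r: "r > 0" "{y \<in> U. \<phi> y \<in> cball (\<phi> x) r} \<subseteq> V"
    using chart_small_ball[OF charts[OF U(1)] conjunct1[OF V] conjunct2[OF V] U(2)] by metis
  have "disc U \<phi> (\<phi> x) r \<subseteq> V" using r by (auto simp: disc_def)
  moreover have "x \<in> disc U \<phi> (\<phi> x) r" using U r by (auto simp: disc_def)
  ultimately show "\<exists>U. openin M U \<and> path_connectedin M U \<and> x \<in> U \<and> U \<subseteq> V"
    using openin_disc[OF U(1)] path_connectedin_disc[OF U(1)]
    by (intro exI[of _ "disc U \<phi> (\<phi> x) r"] conjI)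
qed

text \<open>A surface without a countable base need not be normal. Complete regularity follows from
  local compactness and is enough for a bump function that separates the compact curve from a closed
  set.\<close>

lemma completely_regular: "completely_regular_space M"
proof (rule locally_compact_regular_imp_completely_regular_space)
  show "locally_compact_space M"
    unfolding locally_compact_space_def
  proof
    fix x assume "x \<in> topspace M"
    then obtain U \<phi> where U: "(U,\<phi>) \<in> \<A>" "x \<in> U" using cover by blast
    note ch = chart_props[OF charts[OF U(1)]]
    have "compactin M (chart_inv U \<phi> ` cball (\<phi> x) 1)"
      by (rule image_compactin[OF _ ch(8)]) simp
    moreover have "disc U \<phi> (\<phi> x) 1 \<subseteq> chart_inv U \<phi> ` cball (\<phi> x) 1"
    proof
      fix z assume "z \<in> disc U \<phi> (\<phi> x) 1"
      then have "z = chart_inv U \<phi> (\<phi> z)" "\<phi> z \<in> cball (\<phi> x) 1" using ch(7)[of z] by (auto simp: disc_def)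
      then show "z \<in> chart_inv U \<phi> ` cball (\<phi> x) 1" by blast
    qed
    moreover have "x \<in> disc U \<phi> (\<phi> x) 1" using U by (simp add: disc_def)
    ultimately show "\<exists>U K. openin M U \<and> compactin M K \<and> x \<in> U \<and> U \<subseteq> K"
      using openin_disc[OF U(1)] by blast
  qed
qed (simp add: Hausdorff)

lemma path_connected_open_subset:
  assumes "openin M S" "connected_space (subtopology M S)"
  shows "path_connected_space (subtopology M S)"
  using locally_path_connected_space_open_subset[OF locally_path_connected assms(1)] assms(2)
    path_connected_eq_connected_space by blast

end

section \<open>Gluing the local sides along the whole curve\<close>

context jordan_curve_in_surface
begin

text \<open>The partition is of all of \<open>W - J\<close>, while agreement with the prescribed
  local sides is required only near the points of the arc and only as inclusions; this leaves room
  for shrinking \<open>W\<close> when arcs are joined.\<close>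

definition sides_along :: "(real \<Rightarrow> 'a set) \<Rightarrow> (real \<Rightarrow> 'a set) \<Rightarrow> real \<Rightarrow> real \<Rightarrow> 'a set \<Rightarrow> 'a set \<Rightarrow> 'a set \<Rightarrow> bool" where
  "sides_along Ls Rs a b W L R \<longleftrightarrow> openin M W \<and> openin M L \<and> openin M R \<and> j ` {a..b} \<subseteq> W \<and>
     L \<inter> R = {} \<and> L \<union> R = W - J \<and>
     (\<forall>u\<in>{a..b}. \<exists>G. openin M G \<and> j u \<in> G \<and> G \<inter> L \<subseteq> Ls u \<and> G \<inter> R \<subseteq> Rs u)"

text \<open>Where the two arcs meet, both partitions refine the same local sides and hence agree
  nearby. Elsewhere the arcs can be separated by disjoint open sets, and each partition is kept on
  its own side.\<close>

lemma sides_along_glue: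
  assumes S1: "sides_along Ls Rs a b W1 L1 R1" and S2: "sides_along Ls Rs b c W2 L2 R2" and abc: "a \<le> b" "b \<le> c"
    and disj: "\<And>u. Ls u \<inter> Rs u = {}"
    and coh: "\<And>u v. j u = j v \<Longrightarrow> \<exists>G. openin M G \<and> j u \<in> G \<and> G \<inter> Ls u \<subseteq> Ls v \<and> G \<inter> Rs u \<subseteq> Rs v"
  shows "\<exists>W L R. sides_along Ls Rs a c W L R"
proof -
  define K1 where "K1 = j ` {a..b}"
  define K2 where "K2 = j ` {b..c}"
  \<comment> \<open>The union \<open>N\<close> of all good sets is the largest open set on which the
    two partitions agree.\<close>
  define good where "good G \<longleftrightarrow> openin M G \<and> G \<subseteq> W1 \<inter> W2 \<and> G \<inter> L1 \<inter> R2 = {} \<and> G \<inter> R1 \<inter> L2 = {}" for G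
  define N where "N = \<Union>{G. good G}"
  have oN: "openin M N" unfolding N_def good_def by (intro openin_Union) blast
  have N: "N \<subseteq> W1 \<inter> W2" "N \<inter> L1 \<inter> R2 = {}" "N \<inter> R1 \<inter> L2 = {}"
    unfolding N_def good_def by blast+
  note s1 = S1[unfolded sides_along_def] and s2 = S2[unfolded sides_along_def]
  have o: "openin M W1" "openin M L1" "openin M R1" "openin M W2" "openin M L2" "openin M R2"
    and sub: "K1 \<subseteq> W1" "K2 \<subseteq> W2"
    using s1 s2 by (auto simp: K1_def K2_def)
  \<comment> \<open>The arcs may meet not only at \<open>j b\<close> but also where the curve closes
    up. Therefore \<open>coh\<close> compares parameters with \<open>j u = j v\<close>; on a
    one-sided curve it would fail there.\<close>
  have K12: "K1 \<inter> K2 \<subseteq> N"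
  proof
    fix x assume x: "x \<in> K1 \<inter> K2"
    then obtain u v where uv: "u \<in> {a..b}" "x = j u" "v \<in> {b..c}" "x = j v" unfolding K1_def K2_def by blast
    obtain G1 where G1: "openin M G1" "j u \<in> G1" "G1 \<inter> L1 \<subseteq> Ls u" "G1 \<inter> R1 \<subseteq> Rs u" using s1 uv(1) by blast
    obtain G2 where G2: "openin M G2" "j v \<in> G2" "G2 \<inter> L2 \<subseteq> Ls v" "G2 \<inter> R2 \<subseteq> Rs v" using s2 uv(3) by blast
    obtain G3 where G3: "openin M G3" "j u \<in> G3" "G3 \<inter> Ls u \<subseteq> Ls v" "G3 \<inter> Rs u \<subseteq> Rs v"
      using coh[of u v] uv by metis
    have "good (W1 \<inter> W2 \<inter> G1 \<inter> G2 \<inter> G3)"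
      unfolding good_def
    proof (intro conjI openin_Int o G1 G2 G3)
      show "W1 \<inter> W2 \<inter> G1 \<inter> G2 \<inter> G3 \<inter> L1 \<inter> R2 = {}" using G1(3) G2(4) G3(3) disj[of v] by blast
      show "W1 \<inter> W2 \<inter> G1 \<inter> G2 \<inter> G3 \<inter> R1 \<inter> L2 = {}" using G1(4) G2(3) G3(4) disj[of v] by blast
    qed blast
    moreover have "x \<in> W1 \<inter> W2 \<inter> G1 \<inter> G2 \<inter> G3" using G1(2) G2(2) G3(2) uv sub x by auto
    ultimately show "x \<in> N" unfolding N_def by blast
  qed
  have comp: "compactin M (K1 - N)" "compactin M (K2 - N)"
    unfolding K1_def K2_def
    by (rule closed_compactin[OF compactin_image[OF compact_Icc] Diff_subset
          closedin_diff[OF closedin_image[OF compact_Icc] oN]])+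
  \<comment> \<open>What is left of the arcs off \<open>N\<close> is compact and disjoint, so the
    Hausdorff property separates it.\<close>
  have "disjnt (K1 - N) (K2 - N)" using K12 by (auto simp: disjnt_iff)
  then obtain P Q where PQ: "openin M P" "openin M Q" "K1 - N \<subseteq> P" "K2 - N \<subseteq> Q" "disjnt P Q"
    using Hausdorff_space_compact_separation[OF Hausdorff comp] by metis
  define W where "W = (W1 \<inter> P) \<union> (W2 \<inter> Q) \<union> N"
  define L where "L = (L1 \<inter> P) \<union> (L2 \<inter> Q) \<union> (L1 \<inter> N)"
  define R where "R = (R1 \<inter> P) \<union> (R2 \<inter> Q) \<union> (R1 \<inter> N)"
  have LR1: "L1 \<inter> R1 = {}" "L1 \<union> R1 = W1 - J" and LR2: "L2 \<inter> R2 = {}" "L2 \<union> R2 = W2 - J"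
    using s1 s2 by auto
  have pq: "P \<inter> Q = {}" using PQ(5) by (auto simp: disjnt_def)
  have LN: "L \<inter> N = L1 \<inter> N" "R \<inter> N = R1 \<inter> N" "L2 \<inter> N = L1 \<inter> N" "R2 \<inter> N = R1 \<inter> N"
    unfolding L_def R_def using LR1 LR2 N by blast+
  have LP: "L \<inter> P = L1 \<inter> P" "R \<inter> P = R1 \<inter> P" unfolding L_def R_def using pq by blast+
  have LQ: "L \<inter> Q = L2 \<inter> Q" "R \<inter> Q = R2 \<inter> Q"
    using pq LN(3,4) unfolding L_def R_def by blast+
  have "L \<inter> R = {}"
  proof -
    have "L \<subseteq> P \<union> Q \<union> N" by (auto simp: L_def)
    moreover have "L \<inter> R \<inter> P = {}" using LP LR1(1) by blast
    moreover have "L \<inter> R \<inter> Q = {}" using LQ LR2(1) by blast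
    moreover have "L \<inter> R \<inter> N = {}" using LN(1,2) LR1(1) by blast
    ultimately show ?thesis by blast
  qed
  moreover have "L \<union> R = W - J"
    unfolding L_def R_def W_def using LR1(2) LR2(2) N(1) by blast
  moreover have "j ` {a..c} \<subseteq> W"
  proof
    fix x assume "x \<in> j ` {a..c}"
    then have "x \<in> K1 \<or> x \<in> K2" unfolding K1_def K2_def by fastforce
    then show "x \<in> W" unfolding W_def using PQ(3,4) sub by blast
  qed
  moreover have "\<exists>G. openin M G \<and> j u \<in> G \<and> G \<inter> L \<subseteq> Ls u \<and> G \<inter> R \<subseteq> Rs u" if u: "u \<in> {a..c}" for u
  proof (cases "u \<le> b")
    case True
    then have ub: "u \<in> {a..b}" using u by simp
    obtain G1 where G1: "openin M G1" "j u \<in> G1" "G1 \<inter> L1 \<subseteq> Ls u" "G1 \<inter> R1 \<subseteq> Rs u" using s1 ub by blast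
    have "j u \<in> P \<union> N" using ub PQ(3) by (auto simp: K1_def)
    moreover have "G1 \<inter> (P \<union> N) \<inter> L \<subseteq> Ls u" "G1 \<inter> (P \<union> N) \<inter> R \<subseteq> Rs u" using LP LN(1,2) G1(3,4) by blast+
    ultimately show ?thesis using G1(1,2) PQ(1) oN by (intro exI[of _ "G1 \<inter> (P \<union> N)"]) auto
  next
    case False
    then have ub: "u \<in> {b..c}" using u by simp
    obtain G2 where G2: "openin M G2" "j u \<in> G2" "G2 \<inter> L2 \<subseteq> Ls u" "G2 \<inter> R2 \<subseteq> Rs u" using s2 ub by blast
    have "j u \<in> Q \<union> N" using ub PQ(4) by (auto simp: K2_def)
    moreover have "G2 \<inter> (Q \<union> N) \<inter> L \<subseteq> Ls u" "G2 \<inter> (Q \<union> N) \<inter> R \<subseteq> Rs u" using LQ LN G2(3,4) by blast+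
    ultimately show ?thesis using G2(1,2) PQ(2) oN by (intro exI[of _ "G2 \<inter> (Q \<union> N)"]) auto
  qed
  moreover have "openin M W" "openin M L" "openin M R"
    unfolding W_def L_def R_def by (intro openin_Un openin_Int o PQ oN)+
  ultimately have "sides_along Ls Rs a c W L R" unfolding sides_along_def by (intro conjI ballI)
  then show ?thesis by (intro exI)
qed

text \<open>Each parameter has a two-sided disc whose sides serve for all short intervals around it,
  and adjacent intervals can be glued; bisection gives the whole period. The extra disc in the
  conclusion supplies points of \<open>L\<close> and \<open>R\<close> close to each other.\<close>

lemma sides_exist:
  obtains W L R U \<phi> c r where "openin M W" "openin M L" "openin M R" "J \<subseteq> W" "L \<inter> R = {}" "L \<union> R = W - J"
    "two_sided U \<phi> c r" "left U \<phi> c r \<subseteq> L" "right U \<phi> c r \<subseteq> R"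
proof -
  have "\<forall>t. \<exists>d. case d of (U,\<phi>,c,r) \<Rightarrow> two_sided U \<phi> c r \<and> j t \<in> disc U \<phi> c r"
  proof
    fix t
    have "j t \<in> topspace M" using J_top j_in_J by blast
    then obtain U \<phi> r where "two_sided U \<phi> (\<phi> (j t)) r" "j t \<in> disc U \<phi> (\<phi> (j t)) r"
      using exists_two_sided[OF openin_topspace, of t] by metis
    then show "\<exists>d. case d of (U,\<phi>,c,r) \<Rightarrow> two_sided U \<phi> c r \<and> j t \<in> disc U \<phi> c r" by auto
  qed
  then have "\<exists>d. \<forall>t. case d t of (U,\<phi>,c,r) \<Rightarrow> two_sided U \<phi> c r \<and> j t \<in> disc U \<phi> c r"
    by (rule choice)
  then obtain d where d0: "\<forall>t. case d t of (U,\<phi>,c,r) \<Rightarrow> two_sided U \<phi> c r \<and> j t \<in> disc U \<phi> c r" ..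
  note d = spec[OF d0]
  define D where "D t = (case d t of (U,\<phi>,c,r) \<Rightarrow> disc U \<phi> c r)" for t
  define Ls where "Ls t = (case d t of (U,\<phi>,c,r) \<Rightarrow> left U \<phi> c r)" for t
  define Rs where "Rs t = (case d t of (U,\<phi>,c,r) \<Rightarrow> right U \<phi> c r)" for t
  have D: "openin M (D t)" "j t \<in> D t" "openin M (Ls t)" "openin M (Rs t)" "Ls t \<inter> Rs t = {}"
    "Ls t \<union> Rs t = D t - J" for t
    using d[of t] two_sided_left_right openin_disc unfolding D_def Ls_def Rs_def
    by (auto split: prod.splits simp: two_sided_def)
  have coh: "\<exists>G. openin M G \<and> j u \<in> G \<and> G \<inter> Ls s \<subseteq> Ls t \<and> G \<inter> Rs s \<subseteq> Rs t"
    if "j u \<in> D s" "j u \<in> D t" for s t u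
  proof -
    obtain U \<phi> c r where 1: "d s = (U,\<phi>,c,r)" by (cases "d s")
    obtain V \<psi> c' r' where 2: "d t = (V,\<psi>,c',r')" by (cases "d t")
    have ts: "two_sided U \<phi> c r" "two_sided V \<psi> c' r'" using d[of s] d[of t] by (auto simp: 1 2)
    have ju: "j u \<in> disc U \<phi> c r" "j u \<in> disc V \<psi> c' r'" using that by (auto simp: D_def 1 2)
    obtain G where "openin M G" "j u \<in> G" "G \<inter> left U \<phi> c r \<subseteq> left V \<psi> c' r'"
        "G \<inter> right U \<phi> c r \<subseteq> right V \<psi> c' r'"
      by (rule sides_agree_near[OF ts j_in_J ju])
    then show ?thesis by (intro exI[of _ G] conjI) (simp_all add: Ls_def Rs_def 1 2)
  qed
  have "\<exists>W L R. sides_along Ls Rs 0 1 W L R"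
  proof (rule Bolzano[of 0 1 "\<lambda>a b. \<exists>W L R. sides_along Ls Rs a b W L R"])
    show "\<exists>W L R. sides_along Ls Rs a c W L R"
      if "\<exists>W L R. sides_along Ls Rs a b W L R" "\<exists>W L R. sides_along Ls Rs b c W L R" "a \<le> b" "b \<le> c" for a b c
    proof -
      have coh': "\<exists>G. openin M G \<and> j u \<in> G \<and> G \<inter> Ls u \<subseteq> Ls v \<and> G \<inter> Rs u \<subseteq> Rs v" if "j u = j v" for u v
        using coh[of u u v] D(2)[of u] D(2)[of v] that by metis
      show ?thesis using that(1,2) sides_along_glue[OF _ _ that(3,4) D(5) coh'] by blast
    qed
    fix x :: real
    have "openin euclideanreal {t \<in> topspace euclideanreal. j t \<in> D x}"
      by (rule openin_continuous_map_preimage[OF cont_j D(1)])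
    then have "open {t. j t \<in> D x}" by simp
    then obtain e where e: "e > 0" "ball x e \<subseteq> {t. j t \<in> D x}"
      using D(2)[of x] open_contains_ball by (metis mem_Collect_eq)
    show "\<exists>d>0. \<forall>a b. a \<le> x \<and> x \<le> b \<and> b - a < d \<longrightarrow> (\<exists>W L R. sides_along Ls Rs a b W L R)"
    proof (intro exI[of _ e] conjI allI impI e(1))
      fix a b assume ab: "a \<le> x \<and> x \<le> b \<and> b - a < e"
      have jD: "j u \<in> D x" if "u \<in> {a..b}" for u
      proof -
        have "u \<in> ball x e" using that ab by (auto simp: dist_real_def)
        then show ?thesis using e(2) by blast
      qed
      have "sides_along Ls Rs a b (D x) (Ls x) (Rs x)"
        unfolding sides_along_def using D jD coh[of _ x] by (auto simp: image_subset_iff)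
      then show "\<exists>W L R. sides_along Ls Rs a b W L R" by blast
    qed
  qed simp
  then obtain W L R where S: "sides_along Ls Rs 0 1 W L R" by blast
  note s = S[unfolded sides_along_def]
  have JW: "J \<subseteq> W" using s J_eq by simp
  obtain G where G: "openin M G" "j 0 \<in> G" "G \<inter> L \<subseteq> Ls 0" "G \<inter> R \<subseteq> Rs 0"
  proof -
    have "\<forall>u\<in>{0..1}. \<exists>G. openin M G \<and> j u \<in> G \<and> G \<inter> L \<subseteq> Ls u \<and> G \<inter> R \<subseteq> Rs u" using s by blast
    then have "\<exists>G. openin M G \<and> j 0 \<in> G \<and> G \<inter> L \<subseteq> Ls 0 \<and> G \<inter> R \<subseteq> Rs 0" by (rule bspec) simp
    then show ?thesis using that by blast
  qed
  \<comment> \<open>The glued sides agree with \<open>Ls 0\<close> and \<open>Rs 0\<close> only near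
    \<open>j 0\<close>; a two-sided disc chosen inside \<open>G'\<close> has its own sides contained
    in \<open>L\<close> and \<open>R\<close>.\<close>
  define G' where "G' = G \<inter> W \<inter> D 0"
  have oW: "openin M W" and LR: "L \<union> R = W - J" using s by simp_all
  have G': "openin M G'" "j 0 \<in> G'" "G' \<subseteq> G" "G' \<subseteq> W" "G' \<subseteq> D 0"
    unfolding G'_def using G(1,2) oW JW D(1,2)[of 0] by auto
  obtain U \<phi> r where U: "two_sided U \<phi> (\<phi> (j 0)) r" "j 0 \<in> disc U \<phi> (\<phi> (j 0)) r"
    "disc U \<phi> (\<phi> (j 0)) (2 * r) \<subseteq> G'"
    using exists_two_sided[OF G'(1,2)] by metis
  obtain V \<psi> c' r' where V: "d 0 = (V,\<psi>,c',r')" by (cases "d 0")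
  have VA: "(V,\<psi>) \<in> \<A>" "(U,\<phi>) \<in> \<A>" using d[of 0] U V by (auto simp: two_sided_def)
  have "left U \<phi> (\<phi> (j 0)) r \<subseteq> Ls 0" "right U \<phi> (\<phi> (j 0)) r \<subseteq> Rs 0"
    using left_right_mono[OF VA, of "\<phi> (j 0)" r c' r'] U(3) G'(5) unfolding D_def Ls_def Rs_def V by auto
  moreover have "left U \<phi> (\<phi> (j 0)) r \<subseteq> G \<inter> W - J" "right U \<phi> (\<phi> (j 0)) r \<subseteq> G \<inter> W - J"
  proof -
    have "disc U \<phi> (\<phi> (j 0)) r \<subseteq> disc U \<phi> (\<phi> (j 0)) (2 * r)"
      using U(2) by (intro disc_mono) (auto simp: disc_def)
    then show "left U \<phi> (\<phi> (j 0)) r \<subseteq> G \<inter> W - J" "right U \<phi> (\<phi> (j 0)) r \<subseteq> G \<inter> W - J"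
      using U(3) G' unfolding left_def right_def by blast+
  qed
  ultimately have "left U \<phi> (\<phi> (j 0)) r \<subseteq> L" "right U \<phi> (\<phi> (j 0)) r \<subseteq> R"
    using LR G(3,4) D(5)[of 0] by blast+
  then show ?thesis using s by (intro that[OF _ _ _ JW _ _ U(1)]) simp_all
qed

end

subsection \<open>Functions attached to a non-separating Jordan curve\<close>

lemma pathin_loop_join:
  assumes p: "pathin X p" and q: "pathin X q" and pq: "p 1 = q 0"
  shows "pathin X (loop_join p q)"
proof -
  let ?T = "top_of_set {0..1::real}"
  have "continuous_map ?T X (\<lambda>x. if x \<le> 1/2 then (p \<circ> (\<lambda>t. 2 * t)) x else (q \<circ> (\<lambda>t. 2 * t - 1)) x)"
  proof (intro continuous_map_cases_le continuous_map_compose, force, force)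
    show "continuous_map (subtopology ?T {x \<in> topspace ?T. x \<le> 1/2}) ?T ((*) 2)"
      by (auto simp: continuous_map_in_subtopology continuous_map_from_subtopology)
    have "continuous_map (subtopology ?T {x. 0 \<le> x \<and> x \<le> 1 \<and> 1 \<le> x * 2}) euclideanreal (\<lambda>t. 2 * t - 1)"
      by (intro continuous_intros) (force intro: continuous_map_from_subtopology)
    then show "continuous_map (subtopology ?T {x \<in> topspace ?T. 1/2 \<le> x}) ?T (\<lambda>t. 2 * t - 1)"
      by (force simp: continuous_map_in_subtopology)
    show "(p \<circ> (*) 2) x = (q \<circ> (\<lambda>t. 2 * t - 1)) x" if "x \<in> topspace ?T" "x = 1/2" for x
      unfolding that(2) using pq by simp
  qed (use p q in \<open>auto simp: pathin_def\<close>)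
  then show ?thesis by (simp only: pathin_def loop_join_def o_def)
qed

lemma pathin_reverse:
  assumes "pathin X p"
  shows "pathin X (\<lambda>t. p (1 - t))"
proof -
  have "continuous_map (top_of_set {0..1::real}) (top_of_set {0..1}) (\<lambda>t. 1 - t)"
    by (auto simp: continuous_map_in_subtopology intro!: continuous_intros)
  from continuous_map_compose[OF this assms[unfolded pathin_def]] show ?thesis
    by (simp add: pathin_def o_def)
qed

lemma pathin_topspace: "pathin X p \<Longrightarrow> t \<in> {0..1} \<Longrightarrow> p t \<in> topspace X"
  unfolding pathin_def continuous_map_def by auto

definition nonvanishing_on :: "'a topology \<Rightarrow> 'a set \<Rightarrow> ('a \<Rightarrow> complex) \<Rightarrow> bool" where
  "nonvanishing_on M S f \<longleftrightarrow> (\<forall>z\<in>S. cont_at M f z \<and> f z \<noteq> 0)"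

lemma nonvanishing_on_path:
  assumes "nonvanishing_on M (topspace M) f" "pathin M p"
  shows "continuous_on {0..1} (\<lambda>t. f (p t))" "\<And>t. t \<in> {0..1} \<Longrightarrow> f (p t) \<noteq> 0"
proof -
  note pt = pathin_topspace[OF assms(2)]
  show "continuous_on {0..1} (\<lambda>t. f (p t))"
    by (rule continuous_on_compose_cont_at[where M=M])
       (use assms pt in \<open>auto simp: pathin_def nonvanishing_on_def\<close>)
  show "f (p t) \<noteq> 0" if "t \<in> {0..1}" for t
    using assms(1) pt[OF that] by (auto simp: nonvanishing_on_def)
qed

lemma dlog_loop_join:
  assumes f: "nonvanishing_on M (topspace M) f" and p: "pathin M p" and q: "pathin M q" and pq: "p 1 = q 0"
  shows "dlog 0 1 (\<lambda>t. f (loop_join p q t)) = dlog 0 1 (\<lambda>t. f (p t)) + dlog 0 1 (\<lambda>t. f (q t))"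
proof -
  note j = nonvanishing_on_path[OF f pathin_loop_join[OF p q pq]]
  have "dlog 0 1 (\<lambda>t. f (loop_join p q t)) =
      dlog 0 (1/2) (\<lambda>t. f (loop_join p q t)) + dlog (1/2) 1 (\<lambda>t. f (loop_join p q t))"
    by (rule dlog_combine) (use j in auto)
  also have "dlog 0 (1/2) (\<lambda>t. f (loop_join p q t)) = dlog 0 (1/2) (\<lambda>t. f (p (2 * t + 0)))"
    by (rule dlog_cong) (simp add: loop_join_def)
  also have "\<dots> = dlog (2 * 0 + 0) (2 * (1/2) + 0) (\<lambda>t. f (p t))"
    by (rule dlog_affine) (use nonvanishing_on_path[OF f p] in auto)
  also have "dlog (1/2) 1 (\<lambda>t. f (loop_join p q t)) = dlog (1/2) 1 (\<lambda>t. f (q (2 * t + (-1))))"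
  proof (rule dlog_cong)
    fix t :: real assume t: "t \<in> {1/2..1}"
    show "f (loop_join p q t) = f (q (2 * t + (-1)))"
    proof (cases "t = 1/2")
      case True
      show ?thesis unfolding True using pq by (simp add: loop_join_def)
    qed (use t in \<open>simp add: loop_join_def\<close>)
  qed
  also have "\<dots> = dlog (2 * (1/2) + (-1)) (2 * 1 + (-1)) (\<lambda>t. f (q t))"
    by (rule dlog_affine) (use nonvanishing_on_path[OF f q] in auto)
  finally show ?thesis by simp
qed

lemma dlog_path_reverse:
  assumes f: "nonvanishing_on M (topspace M) f" and p: "pathin M p"
  shows "dlog 0 1 (\<lambda>t. f (p (1 - t))) = - dlog 0 1 (\<lambda>t. f (p t))"
  using dlog_reverse[of 0 1 "\<lambda>t. f (p t)"] nonvanishing_on_path[OF f p] by simp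

text \<open>For functions given by several formulas that meet at \<open>x\<close>: a bound by the
  variation of one continuous function covers all of them at once.\<close>

lemma cont_at_squeeze:
  fixes \<rho> :: "'a \<Rightarrow> real" and h :: "'a \<Rightarrow> 'b::real_normed_vector"
  assumes "cont_at M \<rho> x" "openin M G" "x \<in> G" "\<And>w. w \<in> G \<Longrightarrow> norm (h w - h x) \<le> C * \<bar>\<rho> w - \<rho> x\<bar>"
  shows "cont_at M h x"
proof -
  have x: "x \<in> topspace M" "(\<rho> \<longlongrightarrow> \<rho> x) (nhdsin M x)" using assms(1) by (auto simp: cont_at_def)
  have "((\<lambda>w. C * \<bar>\<rho> w - \<rho> x\<bar>) \<longlongrightarrow> C * \<bar>\<rho> x - \<rho> x\<bar>) (nhdsin M x)"
    by (intro tendsto_intros x)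
  then have "((\<lambda>w. C * \<bar>\<rho> w - \<rho> x\<bar>) \<longlongrightarrow> 0) (nhdsin M x)" by simp
  moreover have "\<forall>\<^sub>F w in nhdsin M x. norm (h w - h x) \<le> C * \<bar>\<rho> w - \<rho> x\<bar>"
    using assms(2-4) x(1) by (auto simp: eventually_nhdsin)
  ultimately have "((\<lambda>w. h w - h x) \<longlongrightarrow> 0) (nhdsin M x)" by (rule Lim_null_comparison[rotated])
  then show ?thesis using x(1) by (simp add: cont_at_def LIM_zero_iff)
qed

section \<open>A function that turns along a loop across the curve\<close>

context jordan_curve_in_surface
begin

text \<open>\<open>f\<close> has the logarithm \<open>h\<close> off \<open>J\<close> and the
  logarithm \<open>m\<close> on \<open>W\<close>, which agree on \<open>L\<close> and differ by
  \<open>2 * pi * \<i>\<close> on \<open>R\<close>. A loop that goes from \<open>L\<close> to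
  \<open>R\<close> in a disc, followed by \<open>m\<close>, and returns off \<open>J\<close>,
  followed by \<open>h\<close>, collects this difference.\<close>

lemma function_crossing_curve:
  assumes conn: "connected_space (subtopology M (topspace M - J))"
  obtains f g where "nonvanishing_on M (topspace M) f" "\<And>z. z \<in> J \<Longrightarrow> f z = -1"
    "pathin M g" "g 1 = g 0" "dlog 0 1 (\<lambda>t. f (g t)) \<noteq> 0"
proof -
  obtain W L R U \<phi> c r where o: "openin M W" "openin M L" "openin M R" and JW: "J \<subseteq> W"
    and LR: "L \<inter> R = {}" "L \<union> R = W - J"
    and U: "two_sided U \<phi> c r" "left U \<phi> c r \<subseteq> L" "right U \<phi> c r \<subseteq> R"
    using sides_exist by metis
  have top: "W \<subseteq> topspace M" using o openin_subset by blast
  have "compactin M J" unfolding J_eq by (rule compactin_image) simp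
  moreover have "closedin M (topspace M - W)" using o by blast
  moreover have "disjnt J (topspace M - W)" using JW by (auto simp: disjnt_iff)
  ultimately obtain \<rho> where \<rho>: "continuous_map M (top_of_set {0..1::real}) \<rho>"
    "\<rho> ` (topspace M - W) \<subseteq> {0}" "\<rho> ` J \<subseteq> {1}"
    using Urysohn_completely_regular_compact_closed[OF _ completely_regular, of 0 1] by (metis zero_le_one)
  have \<rho>c: "cont_at M \<rho> z" if "z \<in> topspace M" for z
    by (rule continuous_map_imp_cont_at[of M "topspace M"])
       (use \<rho>(1) that in \<open>auto simp: continuous_map_in_subtopology\<close>)
  have \<rho>01: "0 \<le> \<rho> z" "\<rho> z \<le> 1" if "z \<in> topspace M" for z
    using \<rho>(1) that unfolding continuous_map_in_subtopology by (auto simp: Pi_iff image_subset_iff)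
  have \<rho>J: "\<rho> z = 1" if "z \<in> J" for z using \<rho>(3) that by blast
  have \<rho>W: "\<rho> z = 0" if "z \<in> topspace M" "z \<notin> W" for z using \<rho>(2) that by blast
  \<comment> \<open>\<open>h\<close> jumps by \<open>2 * pi * \<i>\<close> across \<open>J\<close>,
    and \<open>m\<close> does so where \<open>R\<close> borders on the complement of
    \<open>W\<close>. The exponential sees neither jump.\<close>
  define h where "h z = \<i> * of_real pi * of_real (if z \<in> L then \<rho> z else if z \<in> R then - \<rho> z else 0)" for z
  define m where "m z = \<i> * of_real pi * of_real (if z \<in> R then 2 - \<rho> z else \<rho> z)" for z
  define f where "f z = (if z \<in> J then -1 else exp (h z))" for z
  have \<rho>c': "cont_at M (\<lambda>z. \<i> * of_real pi * of_real (k (\<rho> z))) z" if "z \<in> topspace M" "\<And>s. isCont k s" for z k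
    by (rule cont_at_compose[OF \<rho>c[OF that(1)]]) (intro continuous_intros that(2))
  have LJ: "L \<inter> J = {}" "R \<inter> J = {}" "L \<subseteq> W" "R \<subseteq> W" using LR by blast+
  have hL: "cont_at M h z" if "z \<in> L" for z
    by (rule cont_at_cong_open[OF o(2) that _ \<rho>c'[of z "\<lambda>s. s"]])
       (use that top LJ in \<open>auto simp: h_def\<close>)
  have hR: "cont_at M h z" if "z \<in> R" for z
    by (rule cont_at_cong_open[OF o(3) that _ \<rho>c'[of z "\<lambda>s. - s"]])
       (use that top LJ LR(1) in \<open>auto simp: h_def intro!: continuous_intros\<close>)
  have hc: "cont_at M h z" if z: "z \<in> topspace M - J" for z
  proof -
    consider "z \<in> L" | "z \<in> R" | "z \<notin> W" using z LR(2) by blast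
    then show ?thesis
    proof cases
      \<comment> \<open>A point off \<open>W\<close> may be a limit of both sides. As
        \<open>\<rho>\<close> is 0 there and bounds \<open>h\<close> up to the factor
        \<open>pi\<close>, both are handled together.\<close>
      case 3
      then have z0: "\<rho> z = 0" "h z = 0" using \<rho>W z LJ by (auto simp: h_def)
      show ?thesis
      proof (rule cont_at_squeeze[OF \<rho>c openin_topspace])
        show "norm (h w - h z) \<le> pi * \<bar>\<rho> w - \<rho> z\<bar>" if "w \<in> topspace M" for w
          using \<rho>01[OF that] by (auto simp: z0 h_def norm_mult)
      qed (use z in auto)
    qed (use hL hR in auto)
  qed
  have mc: "cont_at M m z" if z: "z \<in> W" for z
  proof -
    consider "z \<in> L" | "z \<in> R" | "z \<in> J" using z LR(2) by blast
    then show ?thesis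
    proof cases
      case 1
      show ?thesis
        by (rule cont_at_cong_open[OF o(2) 1 _ \<rho>c'[of z "\<lambda>s. s"]])
           (use 1 top LJ LR(1) in \<open>auto simp: m_def\<close>)
    next
      case 2
      show ?thesis
        by (rule cont_at_cong_open[OF o(3) 2 _ \<rho>c'[of z "\<lambda>s. 2 - s"]])
           (use 2 top LJ LR(1) in \<open>auto simp: m_def intro!: continuous_intros\<close>)
    next
      case 3
      have zR: "z \<notin> R" using 3 LJ by blast
      have z1: "\<rho> z = 1" by (rule \<rho>J[OF 3])
      show ?thesis
      proof (rule cont_at_squeeze[OF \<rho>c openin_topspace])
        show "norm (m w - m z) \<le> pi * \<bar>\<rho> w - \<rho> z\<bar>" if "w \<in> topspace M" for w
        proof -
          define s where "s = (if w \<in> R then 2 - \<rho> w else \<rho> w)"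
          have "m w - m z = \<i> * of_real pi * of_real (s - 1)" by (simp add: m_def z1 zR s_def algebra_simps)
          then have "norm (m w - m z) = pi * \<bar>s - 1\<bar>"
            by (simp only: norm_mult norm_of_real norm_ii mult_1_left abs_of_pos pi_gt_zero)
          also have "\<bar>s - 1\<bar> = \<bar>\<rho> w - \<rho> z\<bar>" by (auto simp: s_def z1)
          finally show ?thesis by simp
        qed
      qed (use 3 J_top in auto)
    qed
  qed
  have fm: "f z = exp (m z)" if z: "z \<in> W" for z
  proof -
    consider "z \<in> L" | "z \<in> R" | "z \<in> J" using z LR(2) by blast
    then show ?thesis
    proof cases
      case 1
      then show ?thesis using LJ LR(1) by (auto simp: f_def m_def h_def)
    next
      case 2
      then have nn: "z \<notin> L" "z \<notin> J" using LJ LR(1) by auto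
      have "m z = h z + 2 * of_real pi * \<i>" using 2 nn by (simp add: m_def h_def algebra_simps)
      then show ?thesis using nn by (simp add: f_def exp_add)
    next
      case 3
      then have "z \<notin> R" using LJ by blast
      then have "m z = \<i> * of_real pi" by (simp add: m_def \<rho>J[OF 3])
      then show ?thesis using 3 by (simp add: f_def)
    qed
  qed
  have fh: "f z = exp (h z)" if "z \<in> topspace M - J" for z using that by (simp add: f_def)
  have nz: "nonvanishing_on M (topspace M) f"
    unfolding nonvanishing_on_def
  proof
    fix z assume z: "z \<in> topspace M"
    have "cont_at M f z"
    proof (cases "z \<in> J")
      case True
      show ?thesis
        by (rule cont_at_cong_open[OF o(1) _ _ cont_at_exp[OF mc]]) (use True JW fm in auto)
    next
      case False
      show ?thesis
        by (rule cont_at_cong_open[OF openin_diff_J[OF openin_topspace] _ _ cont_at_exp[OF hc]])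
           (use False z fh in auto)
    qed
    then show "cont_at M f z \<and> f z \<noteq> 0" by (simp add: f_def)
  qed
  obtain x y where xy: "x \<in> left U \<phi> c r" "y \<in> right U \<phi> c r"
    using two_sided_left_right(5,6)[OF U(1)] by blast
  have xL: "x \<in> L" "x \<notin> R" and yR: "y \<in> R" "y \<notin> L" using xy U LR(1) by blast+
  have D: "disc U \<phi> c r \<subseteq> W"
  proof -
    have "disc U \<phi> c r - J \<subseteq> L \<union> R" using two_sided_left_right(2)[OF U(1)] U(2,3) by blast
    then show ?thesis using LR(2) JW by blast
  qed
  have "path_connectedin M (disc U \<phi> c r)"
    using U(1) by (intro path_connectedin_disc) (simp add: two_sided_def)
  moreover have xyD: "x \<in> disc U \<phi> c r" "y \<in> disc U \<phi> c r" using xy by (auto simp: left_def right_def)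
  ultimately obtain g1 where g1: "pathin M g1" "g1 ` {0..1} \<subseteq> disc U \<phi> c r" "g1 0 = x" "g1 1 = y"
    unfolding path_connectedin by (metis image_subset_iff_funcset)
  have "path_connected_space (subtopology M (topspace M - J))"
    by (rule path_connected_open_subset[OF openin_diff_J[OF openin_topspace] conn])
  moreover have "x \<in> topspace M - J" "y \<in> topspace M - J" using xL yR LJ top by blast+
  ultimately obtain g2 where g2: "pathin (subtopology M (topspace M - J)) g2" "g2 0 = y" "g2 1 = x"
    unfolding path_connected_space_def by auto
  have g2': "pathin M g2" "\<And>t. t \<in> {0..1} \<Longrightarrow> g2 t \<in> topspace M - J"
    using g2(1) unfolding pathin_subtopology by auto
  have d1: "dlog 0 1 (\<lambda>t. f (g1 t)) = m y - m x"
  proof -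
    have g1W: "g1 t \<in> W" if "t \<in> {0..1}" for t using g1(2) D that by blast
    have "dlog 0 1 (\<lambda>t. f (g1 t)) = m (g1 1) - m (g1 0)"
      by (rule dlog_eq[where l="\<lambda>t. m (g1 t)"])
         (use g1 g1W mc fm in \<open>auto simp: pathin_def intro!: continuous_on_compose_cont_at[where M=M]\<close>)
    then show ?thesis using g1 by simp
  qed
  have d2: "dlog 0 1 (\<lambda>t. f (g2 t)) = h x - h y"
  proof -
    have "dlog 0 1 (\<lambda>t. f (g2 t)) = h (g2 1) - h (g2 0)"
    proof (rule dlog_eq[where l="\<lambda>t. h (g2 t)"])
      show "continuous_on {0..1} (\<lambda>t. h (g2 t))"
        by (rule continuous_on_compose_cont_at[where M=M]) (use g2' hc in \<open>auto simp: pathin_def\<close>)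
    qed (use g2' fh in auto)
    then show ?thesis using g2 by simp
  qed
  \<comment> \<open>The sum equals \<open>(m y - h y) - (m x - h x)\<close>, with \<open>x\<close>
    on the left and \<open>y\<close> on the right.\<close>
  have "dlog 0 1 (\<lambda>t. f (loop_join g1 g2 t)) = (m y - m x) + (h x - h y)"
    using dlog_loop_join[OF nz g1(1) g2'(1)] g1 g2 d1 d2 by simp
  also have "\<dots> = 2 * of_real pi * \<i>" using xL yR by (simp add: m_def h_def algebra_simps)
  finally have dl: "dlog 0 1 (\<lambda>t. f (loop_join g1 g2 t)) \<noteq> 0" by simp
  have pj: "pathin M (loop_join g1 g2)" using g1 g2 g2' by (intro pathin_loop_join) auto
  show ?thesis
    by (rule that[OF nz _ pj _ dl]) (use g1 g2 in \<open>auto simp: f_def loop_join_def\<close>)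
qed

definition off_curve_link :: "'a \<Rightarrow> 'a \<Rightarrow> bool" where
  "off_curve_link x z \<longleftrightarrow> z = x \<or> (\<exists>f. nonvanishing_on M (topspace M - {x, z}) f \<and> turning f = 0 \<and>
     has_order f x 1 \<and> has_order f z (-1))"

lemma nonvanishing_onD:
  assumes "nonvanishing_on M S f" "J \<subseteq> S"
  shows "nonvanishing f"
  using assms unfolding nonvanishing_on_def nonvanishing_def by blast

text \<open>Multiplying by the edge from \<open>u\<close> to \<open>v\<close> moves the pole: the
  old pole at \<open>u\<close> cancels against the zero of the edge. Since the double disc avoids
  \<open>J\<close>, the edge is 1 on \<open>J\<close> and adds no turning.\<close>

lemma off_curve_link_step:
  assumes link: "off_curve_link x u" and U: "(U,\<phi>) \<in> \<A>" and D: "disc U \<phi> c (2 * r) \<inter> J = {}"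
    and uv: "u \<in> disc U \<phi> c r" "v \<in> disc U \<phi> c r" and x: "x \<in> topspace M - J"
  shows "off_curve_link x v"
proof (cases "v = x \<or> v = u")
  case True
  then show ?thesis using link by (auto simp: off_curve_link_def)
next
  case False
  then have vx: "v \<noteq> x" and vu: "u \<noteq> v" by auto
  have r: "r > 0" using uv by (auto simp: disc_def intro: le_less_trans[OF zero_le_dist])
  have sub: "disc U \<phi> c r \<subseteq> disc U \<phi> c (2 * r)" by (rule disc_mono) (use r in simp)
  have uvJ: "u \<notin> J" "v \<notin> J" using uv sub D by blast+
  have uvtop: "u \<in> topspace M" "v \<in> topspace M" using uv openin_disc[OF U] openin_subset by blast+
  define e where "e = edge U \<phi> c r u v"
  have e_nz: "nonvanishing_on M (topspace M - {u, v}) e"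
    unfolding nonvanishing_on_def e_def using edge_cont[OF U uv] by blast
  have e_turn: "turning e = 0"
    by (rule turning_1) (use edge_outside[OF uv] D in \<open>auto simp: e_def\<close>)
  have e_ord: "has_order e u 1" "has_order e v (-1)"
    unfolding e_def by (rule edge_order[OF U uv vu])+
  have ex: "openin M (topspace M - {a, b})" for a b
  proof -
    have "openin M (topspace M - {a} - {b})" by (intro openin_delete openin_topspace)
    moreover have "topspace M - {a} - {b} = topspace M - {a, b}" by auto
    ultimately show "openin M (topspace M - {a, b})" by simp
  qed
  have ord0: "has_order h w 0" if "nonvanishing_on M (topspace M - {a, b}) h" "w \<in> topspace M" "w \<noteq> a" "w \<noteq> b" for h w a b
    by (rule has_order_0[OF _ _ ex[of a b]]) (use that in \<open>auto simp: nonvanishing_on_def\<close>)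
  show ?thesis
  proof (cases "u = x")
    case True
    then show ?thesis using e_nz e_turn e_ord unfolding off_curve_link_def by blast
  next
    case ux: False
    then obtain f where f: "nonvanishing_on M (topspace M - {x, u}) f" "turning f = 0"
      "has_order f x 1" "has_order f u (-1)"
      using link unfolding off_curve_link_def by blast
    define F where "F z = f z * e z" for z
    have xt: "x \<in> topspace M" using x by blast
    have F_nz: "cont_at M F z \<and> F z \<noteq> 0" if "z \<in> topspace M" "z \<noteq> x" "z \<noteq> u" "z \<noteq> v" for z
      using f(1) e_nz that unfolding F_def nonvanishing_on_def by (auto intro!: cont_at_mult)
    have F_x: "has_order F x 1"
      using has_order_mult[OF f(3) ord0[OF e_nz xt]] ux vx unfolding F_def by auto
    have F_v: "has_order F v (-1)"
      using has_order_mult[OF ord0[OF f(1) uvtop(2)] e_ord(2)] vx vu unfolding F_def by auto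
    have F_u: "has_order F u 0"
      using has_order_mult[OF f(4) e_ord(1)] unfolding F_def by simp
    have f_J: "nonvanishing f" "nonvanishing e"
      using x uvJ J_top by (auto intro!: nonvanishing_onD[OF f(1)] nonvanishing_onD[OF e_nz])
    have F_turn: "turning F = 0" unfolding F_def using turning_mult[OF f_J] f(2) e_turn by simp
    obtain P1 Q1 where P1: "openin M P1" "openin M Q1" "u \<in> P1" "x \<in> Q1" "disjnt P1 Q1"
      using Hausdorff uvtop(1) xt ux unfolding Hausdorff_space_def by meson
    obtain P2 Q2 where P2: "openin M P2" "openin M Q2" "u \<in> P2" "v \<in> Q2" "disjnt P2 Q2"
      using Hausdorff uvtop vu unfolding Hausdorff_space_def by meson
    \<comment> \<open>Away from \<open>x\<close> and \<open>v\<close>, whose orders must survive the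
      removal at \<open>u\<close>, and inside the disc, hence off \<open>J\<close>.\<close>
    define W where "W = disc U \<phi> c r \<inter> P1 \<inter> P2"
    have W: "openin M W" "u \<in> W" unfolding W_def using openin_disc[OF U] P1 P2 uv by auto
    obtain g where g: "\<And>z. z \<notin> W \<Longrightarrow> g z = F z" "cont_at M g u" "g u \<noteq> 0"
      "\<And>z. z \<noteq> u \<Longrightarrow> cont_at M F z \<Longrightarrow> F z \<noteq> 0 \<Longrightarrow> cont_at M g z \<and> g z \<noteq> 0"
      using remove_order_0[OF F_u W] by metis
    have WQ: "Q1 \<inter> W = {}" "Q2 \<inter> W = {}" using P1(5) P2(5) by (auto simp: W_def disjnt_iff)
    have Fg1: "F z = g z" if "z \<in> Q1 - {x}" for z
      using that WQ(1) by (intro g(1)[symmetric]) blast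
    have Fg2: "F z = g z" if "z \<in> Q2 - {v}" for z
      using that WQ(2) by (intro g(1)[symmetric]) blast
    have "has_order g x 1" by (rule has_order_cong[OF F_x P1(2,4) Fg1])
    moreover have "has_order g v (-1)" by (rule has_order_cong[OF F_v P2(2,4) Fg2])
    moreover have "turning g = 0"
    proof -
      have "turning g = turning F"
      proof (rule turning_cong)
        fix z assume "z \<in> J"
        then have "z \<notin> W" using D sub unfolding W_def by blast
        then show "g z = F z" by (rule g(1))
      qed
      then show ?thesis using F_turn by simp
    qed
    moreover have "nonvanishing_on M (topspace M - {x, v}) g"
      unfolding nonvanishing_on_def
    proof
      fix z assume z: "z \<in> topspace M - {x, v}"
      show "cont_at M g z \<and> g z \<noteq> 0"
        using g(2,3) g(4)[of z] F_nz[of z] z by (cases "z = u") auto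
    qed
    ultimately show ?thesis unfolding off_curve_link_def by blast
  qed
qed

text \<open>A step can be made between any two points of a small disc off \<open>J\<close>, so both
  the set of linked points and its complement are open in the connected complement of
  \<open>J\<close>.\<close>

lemma off_curve_link:
  assumes conn: "connected_space (subtopology M (topspace M - J))"
    and x: "x \<in> topspace M - J" and y: "y \<in> topspace M - J"
  shows "off_curve_link x y"
proof -
  define X where "X = subtopology M (topspace M - J)"
  have oJ: "openin M (topspace M - J)" by (rule openin_diff_J[OF openin_topspace])
  have topX: "topspace X = topspace M - J" by (auto simp: X_def)
  define S where "S = {z \<in> topspace M - J. off_curve_link x z}"
  have nbhd: "\<exists>T. openin M T \<and> z \<in> T \<and> T \<subseteq> topspace M - J \<and> (\<forall>a\<in>T. \<forall>b\<in>T. off_curve_link x a \<longrightarrow> off_curve_link x b)"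
    if z: "z \<in> topspace M - J" for z
  proof -
    obtain U \<phi> where U: "(U,\<phi>) \<in> \<A>" "z \<in> U" using cover z by blast
    obtain r where r: "r > 0" "{y \<in> U. \<phi> y \<in> cball (\<phi> z) r} \<subseteq> topspace M - J"
      using chart_small_ball[OF charts[OF U(1)] oJ z U(2)] by metis
    have sub: "disc U \<phi> (\<phi> z) (2 * (r/2)) \<subseteq> topspace M - J" using r by (auto simp: disc_def)
    have D: "disc U \<phi> (\<phi> z) (2 * (r/2)) \<inter> J = {}" using sub by blast
    have sub2: "disc U \<phi> (\<phi> z) (r/2) \<subseteq> disc U \<phi> (\<phi> z) (2 * (r/2))" using r by (intro disc_mono) auto
    show ?thesis
    proof (intro exI[of _ "disc U \<phi> (\<phi> z) (r/2)"] conjI ballI impI)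
      show "openin M (disc U \<phi> (\<phi> z) (r/2))" by (rule openin_disc[OF U(1)])
      show "z \<in> disc U \<phi> (\<phi> z) (r/2)" using U r by (simp add: disc_def)
      show "disc U \<phi> (\<phi> z) (r/2) \<subseteq> topspace M - J" using sub sub2 by blast
      show "off_curve_link x b" if "a \<in> disc U \<phi> (\<phi> z) (r/2)" "b \<in> disc U \<phi> (\<phi> z) (r/2)" "off_curve_link x a" for a b
        by (rule off_curve_link_step[OF that(3) U(1) D that(1,2) x])
    qed
  qed
  have "openin M S"
  proof (subst openin_subopen, intro ballI)
    fix z assume z: "z \<in> S"
    obtain T where T: "openin M T" "z \<in> T" "T \<subseteq> topspace M - J"
      "\<forall>a\<in>T. \<forall>b\<in>T. off_curve_link x a \<longrightarrow> off_curve_link x b"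
      using nbhd[of z] z unfolding S_def by blast
    then have "T \<subseteq> S" using z unfolding S_def by blast
    then show "\<exists>T. openin M T \<and> z \<in> T \<and> T \<subseteq> S" using T by blast
  qed
  moreover have "openin M (topspace M - J - S)"
  proof (subst openin_subopen, intro ballI)
    fix z assume z: "z \<in> topspace M - J - S"
    obtain T where T: "openin M T" "z \<in> T" "T \<subseteq> topspace M - J"
      "\<forall>a\<in>T. \<forall>b\<in>T. off_curve_link x a \<longrightarrow> off_curve_link x b"
      using nbhd[of z] z by blast
    then have "T \<subseteq> topspace M - J - S" using z unfolding S_def by blast
    then show "\<exists>T. openin M T \<and> z \<in> T \<and> T \<subseteq> topspace M - J - S" using T by blast
  qed
  ultimately have "openin X S" "openin X (topspace X - S)"
    unfolding X_def topX[unfolded X_def] using oJ by (auto simp: openin_open_subtopology S_def)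
  then have "openin X S" "closedin X S" unfolding closedin_def topX by (auto simp: S_def)
  then have "S = {} \<or> S = topspace X" using conn connected_space_clopen_in X_def by blast
  moreover have "x \<in> S" using x by (simp add: S_def off_curve_link_def)
  ultimately show ?thesis using y topX unfolding S_def by blast
qed

text \<open>In a two-sided disc some edge turns along \<open>J\<close>. Dividing it by a link with
  the same zero and pole but no turning leaves only removable singularities, and these lie off
  \<open>J\<close>.\<close>

lemma function_turning_along_curve:
  assumes conn: "connected_space (subtopology M (topspace M - J))"
  obtains f where "nonvanishing_on M (topspace M) f" "turning f \<noteq> 0"
proof -
  obtain U \<phi> r where U: "two_sided U \<phi> (\<phi> (j 0)) r"
  proof -
    have "j 0 \<in> topspace M" using J_top j_in_J by blast
    then show ?thesis using that by (rule exists_two_sided[OF openin_topspace])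
  qed
  define c where "c = \<phi> (j 0)"
  have UA: "(U,\<phi>) \<in> \<A>" using U by (simp add: two_sided_def)
  obtain x y where xy: "x \<in> disc U \<phi> c r - J" "y \<in> disc U \<phi> c r - J"
    and t: "turning (edge U \<phi> c r x y) = 2 * of_real pi * \<i>"
    using U unfolding two_sided_def c_def by blast
  have top: "disc U \<phi> c r \<subseteq> topspace M" using openin_disc[OF UA] openin_subset by blast
  have ne: "x \<noteq> y"
    using turning_edge_refl[OF UA, of x c r] t xy by (auto simp: disc_def)
  obtain f where f: "nonvanishing_on M (topspace M - {x, y}) f" "turning f = 0" "has_order f x 1" "has_order f y (-1)"
    using off_curve_link[OF conn, of x y] xy top ne unfolding off_curve_link_def by blast
  define Q where "Q z = edge U \<phi> c r x y z / f z" for z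
  have xyd: "x \<in> disc U \<phi> c r" "y \<in> disc U \<phi> c r" using xy by auto
  have "has_order Q x (1 - 1)" "has_order Q y (-1 - (-1))"
    unfolding Q_def by (intro has_order_divide edge_order[OF UA xyd ne] f)+
  moreover have "cont_at M Q z \<and> Q z \<noteq> 0" if "z \<in> topspace M" "z \<noteq> x" "z \<noteq> y" for z
    unfolding Q_def using edge_cont[OF UA xyd that] f(1) that
    by (auto simp: nonvanishing_on_def intro!: cont_at_divide)
  ultimately obtain g where g: "\<And>z. z \<notin> topspace M - J \<Longrightarrow> g z = Q z"
      "\<And>z. z \<in> topspace M \<Longrightarrow> cont_at M g z \<and> g z \<noteq> 0"
    using remove_order_0_twice[of x y Q "topspace M - J"] openin_diff_J[OF openin_topspace] xy top ne by auto
  have fJ: "nonvanishing f" by (rule nonvanishing_onD[OF f(1)]) (use xy J_top in auto)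
  have "turning g = turning Q" by (rule turning_cong) (use g(1) in auto)
  also have "\<dots> = turning (edge U \<phi> c r x y) - turning f"
    unfolding Q_def by (rule turning_divide[OF nonvanishing_edge[OF UA xy] fJ])
  finally have "turning g \<noteq> 0" using t f(2) by simp
  then show ?thesis using that g(2) by (auto simp: nonvanishing_on_def)
qed

end

subsection \<open>Oriented charts from the homological orientation\<close>

lemma cont_at_imp_continuous_map:
  fixes f :: "'a \<Rightarrow> 'b::topological_space"
  assumes "\<And>x. x \<in> topspace X \<Longrightarrow> cont_at X f x"
  shows "continuous_map X euclidean f"
  unfolding continuous_map
proof (intro conjI allI impI)
  show "f ` topspace X \<subseteq> topspace euclidean" by simp
  fix V :: "'b set" assume V: "openin euclidean V"
  show "openin X {x \<in> topspace X. f x \<in> V}"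
  proof (subst openin_subopen, intro ballI)
    fix x assume x: "x \<in> {x \<in> topspace X. f x \<in> V}"
    then obtain A where "openin X A" "x \<in> A" "f ` A \<subseteq> V"
      using assms[of x] V unfolding cont_at_topological by auto
    then show "\<exists>T. openin X T \<and> x \<in> T \<and> T \<subseteq> {x \<in> topspace X. f x \<in> V}"
      using openin_subset by (intro exI[of _ A]) blast
  qed
qed

lemma continuous_map_imp_cont_at_topspace:
  "continuous_map X euclidean f \<Longrightarrow> x \<in> topspace X \<Longrightarrow> cont_at X f x"
  by (rule continuous_map_imp_cont_at[OF openin_topspace]) simp_all

text \<open>This is \<open>z / norm z\<close>, padded with zeros because the points of
  \<open>nsphere 1\<close> are sequences.\<close>

definition circle_dir :: "complex \<Rightarrow> nat \<Rightarrow> real" where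
  "circle_dir z = (\<lambda>i. if i = 0 then Re z / norm z else if i = 1 then Im z / norm z else 0)"

lemma continuous_map_circle_dir: "continuous_map (top_of_set (- {0})) (nsphere 1) circle_dir"
  unfolding nsphere continuous_map_in_subtopology
proof
  have "continuous_on (- {0}) (\<lambda>z. circle_dir z i)" for i
    unfolding circle_dir_def
    by (cases "i = 0"; cases "i = 1") (auto intro!: continuous_intros)
  then show "continuous_map (top_of_set (- {0})) (powertop_real UNIV) circle_dir"
    by (simp add: continuous_map_componentwise_UNIV)
  have "(Re z / norm z)\<^sup>2 + (Im z / norm z)\<^sup>2 = 1" if "z \<noteq> 0" for z :: complex
    using that by (auto simp: power_divide cmod_power2 complex_eq_iff simp flip: add_divide_distrib)
  then show "circle_dir \<in> topspace (top_of_set (- {0})) \<rightarrow> {x. (\<Sum>i\<le>1. (x i)\<^sup>2) = 1 \<and> (\<forall>i>1. x i = 0)}"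
    by (auto simp: circle_dir_def)
qed

abbreviation nzmap :: "'a topology \<Rightarrow> ('a \<Rightarrow> complex) \<Rightarrow> bool" where
  "nzmap X g \<equiv> continuous_map X (top_of_set (- {0})) g"

text \<open>The homological winding number: applied to the class of a loop, it gives the class of
  the direction of \<open>g\<close> along that loop.\<close>

definition dirmap :: "'a topology \<Rightarrow> ('a \<Rightarrow> complex) \<Rightarrow> 'a chain set \<Rightarrow> (nat \<Rightarrow> real) chain set" where
  "dirmap X g = hom_induced 1 X {} (nsphere 1) {} (circle_dir \<circ> g)"

lemma dirmap_natural:
  assumes "continuous_map X Y f" "nzmap Y g"
  shows "dirmap Y g (hom_induced 1 X {} Y {} f c) = dirmap X (g \<circ> f) c"
  unfolding dirmap_def
  using hom_induced_compose'[OF assms(1) _ continuous_map_compose[OF assms(2) continuous_map_circle_dir], of "{}" "{}" "{}" 1 c]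
  by (simp add: o_assoc)

text \<open>The maps \<open>b * exp (s * L)\<close> for \<open>s\<close> from 0 to 1 are a homotopy
  through nonvanishing functions.\<close>

lemma dirmap_eq_of_log:
  assumes b: "nzmap X b" and L: "continuous_map X euclidean L"
    and ab: "\<And>x. x \<in> topspace X \<Longrightarrow> a x = b x * exp (L x)"
  shows "dirmap X a = dirmap X b"
proof -
  define Z where "Z = prod_topology (top_of_set {0..1::real}) X"
  define k where "k p = b (snd p) * exp (of_real (fst p) * L (snd p))" for p :: "real \<times> 'a"
  have fst: "continuous_map Z euclideanreal fst"
    unfolding Z_def using continuous_map_fst continuous_map_into_fulltopology by blast
  have snd: "continuous_map Z X snd" unfolding Z_def by (rule continuous_map_snd)
  have b': "continuous_map X euclidean b" using b continuous_map_into_fulltopology by blast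
  have "cont_at Z k p" if p: "p \<in> topspace Z" for p
    unfolding k_def
  proof (intro cont_at_mult cont_at_exp)
    show "cont_at Z (\<lambda>p. b (snd p)) p" "cont_at Z (\<lambda>p. L (snd p)) p"
      using continuous_map_imp_cont_at_topspace[OF continuous_map_compose[OF snd b'] p]
        continuous_map_imp_cont_at_topspace[OF continuous_map_compose[OF snd L] p] by (simp_all add: o_def)
    show "cont_at Z (\<lambda>p. complex_of_real (fst p)) p"
      by (rule cont_at_compose[OF continuous_map_imp_cont_at_topspace[OF fst p]]) (intro continuous_intros)
  qed
  then have "continuous_map Z euclidean k" by (rule cont_at_imp_continuous_map)
  moreover have "k p \<noteq> 0" if "p \<in> topspace Z" for p
    using b that unfolding k_def Z_def continuous_map_in_subtopology by auto
  ultimately have "nzmap Z k" by (auto simp: continuous_map_in_subtopology)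
  then have kc: "continuous_map Z (nsphere 1) (circle_dir \<circ> k)"
    by (rule continuous_map_compose[OF _ continuous_map_circle_dir])
  have "homotopic_with (\<lambda>h. True) X (nsphere 1) (circle_dir \<circ> b) (circle_dir \<circ> a)"
    by (subst homotopic_with, simp)
       (use kc in \<open>auto intro!: exI[of _ "circle_dir \<circ> k"] simp: Z_def k_def ab\<close>)
  then show ?thesis unfolding dirmap_def by (metis homology_homotopy_empty)
qed

section \<open>Generators of infinite cyclic groups and the homology of the circle\<close>

definition generates :: "('g, 'm) monoid_scheme \<Rightarrow> 'g \<Rightarrow> bool" where
  "generates G a \<longleftrightarrow> a \<in> carrier G \<and> (\<forall>x\<in>carrier G. \<exists>n::int. x = a [^]\<^bsub>G\<^esub> n)"

lemma generates_hom:
  assumes "group G" "group H" "h \<in> hom G H" "h ` carrier G = carrier H" "generates G a"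
  shows "generates H (h a)"
proof -
  interpret group_hom G H h using assms by (simp add: group_hom_def group_hom_axioms_def)
  show ?thesis
    unfolding generates_def
  proof (intro conjI ballI)
    show "h a \<in> carrier H" using assms by (auto simp: generates_def)
    fix x assume "x \<in> carrier H"
    then obtain y where "y \<in> carrier G" "x = h y" using assms(4) by blast
    moreover from this obtain n :: int where "y = a [^]\<^bsub>G\<^esub> n" using assms(5) unfolding generates_def by blast
    ultimately have "x = h (a [^]\<^bsub>G\<^esub> n)" by simp
    then show "\<exists>n::int. x = h a [^]\<^bsub>H\<^esub> n" using assms(5) hom_int_pow unfolding generates_def by auto
  qed
qed

text \<open>The only units of the integers are 1 and -1, and they are distinct. Applied to
  \<open>H\<^sub>1\<close> of the circle this leaves each chart two possible orientations, which can
  be told apart.\<close>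

lemma infinite_cyclic_generators:
  assumes G: "group G" "G \<cong> integer_group" and a: "generates G a"
  shows "generates G b \<Longrightarrow> b = a \<or> b = inv\<^bsub>G\<^esub> a" and "a \<noteq> inv\<^bsub>G\<^esub> a"
proof -
  obtain f where f: "f \<in> iso G integer_group" using G(2) by (auto simp: is_iso_def)
  interpret group_hom G integer_group f
    using f G by (simp add: group_hom_def group_hom_axioms_def iso_def)
  have inj: "inj_on f (carrier G)" and surj: "f ` carrier G = UNIV"
    using f by (auto simp: iso_def bij_betw_def)
  have unit: "f c = 1 \<or> f c = -1" if c: "generates G c" for c
  proof -
    obtain x where x: "x \<in> carrier G" "f x = 1" using surj by (metis UNIV_I imageE)
    then obtain n :: int where "x = c [^]\<^bsub>G\<^esub> n" using c unfolding generates_def by blast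
    then have "n * f c = 1" using x c hom_int_pow[of c n] by (simp add: generates_def)
    then show ?thesis by (metis zmult_eq_1_iff)
  qed
  have ac: "a \<in> carrier G" using a by (simp add: generates_def)
  have fi: "f (inv\<^bsub>G\<^esub> a) = - f a" using ac by simp
  show "a \<noteq> inv\<^bsub>G\<^esub> a"
  proof
    assume "a = inv\<^bsub>G\<^esub> a"
    then have "f a = - f a" using fi by metis
    then show False using unit[OF a] by simp
  qed
  show "b = a \<or> b = inv\<^bsub>G\<^esub> a" if b: "generates G b"
  proof -
    have bc: "b \<in> carrier G" using b by (simp add: generates_def)
    have "f b = f a \<or> f b = f (inv\<^bsub>G\<^esub> a)" using unit[OF a] unit[OF b] fi by auto
    then show ?thesis using inj ac bc group.inv_closed[OF G(1) ac] by (meson inj_onD)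
  qed
qed

lemma homology_circle_integer: "homology_group 1 (nsphere 1) \<cong> integer_group"
  using reduced_homology_group_nsphere(1)[of 1] un_reduced_homology_group[of 1 "nsphere 1"] by simp

text \<open>The map \<open>- cnj\<close> changes the sign of the real part, that is, of coordinate 0
  on the circle; this reflection has Brouwer degree -1.\<close>

lemma dirmap_reflect:
  assumes g: "nzmap X g"
  shows "dirmap X (\<lambda>x. - cnj (g x)) c = inv\<^bsub>homology_group 1 (nsphere 1)\<^esub> (dirmap X g c)"
proof -
  let ?r = "\<lambda>x i. if i = 0 then - x i else x i :: real"
  have "circle_dir (- cnj z) = ?r (circle_dir z)" for z
    by (auto simp: circle_dir_def fun_eq_iff)
  then have eq: "circle_dir \<circ> (\<lambda>x. - cnj (g x)) = ?r \<circ> (circle_dir \<circ> g)" by (simp add: o_def)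
  have r: "continuous_map (nsphere 1) (nsphere 1) ?r" by (rule continuous_map_nsphere_reflection)
  have gc: "continuous_map X (nsphere 1) (circle_dir \<circ> g)"
    by (rule continuous_map_compose[OF g continuous_map_circle_dir])
  have car: "dirmap X g c \<in> carrier (homology_group 1 (nsphere 1))"
    unfolding dirmap_def by (rule hom_induced_carrier)
  have "dirmap X (\<lambda>x. - cnj (g x)) c = hom_induced 1 (nsphere 1) {} (nsphere 1) {} ?r (dirmap X g c)"
    unfolding dirmap_def eq by (rule hom_induced_compose'[OF gc _ r, symmetric]) auto
  also have "\<dots> = dirmap X g c [^]\<^bsub>homology_group 1 (nsphere 1)\<^esub> (-1::int)"
    using Brouwer_degree2[of "dirmap X g c" 1 ?r] car un_reduced_homology_group[of 1 "nsphere 1"]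
    by (simp add: Brouwer_degree2_reflection)
  also have "\<dots> = inv\<^bsub>homology_group 1 (nsphere 1)\<^esub> (dirmap X g c)"
    using car by (simp add: group.int_pow_neg group.int_pow_1)
  finally show ?thesis .
qed

text \<open>The complement of \<open>B\<close> is excised. The closed set \<open>K\<close> between
  \<open>N\<close> and \<open>B\<close> ensures that this closed complement lies in the interior of
  the complement of \<open>N\<close>; \<open>N\<close> will be a point or an open disc.\<close>

lemma excision_iso:
  assumes B: "openin M B" and K: "closedin M K" "N \<subseteq> K" "K \<subseteq> B"
  shows "hom_induced 2 (subtopology M B) (B - N) M (topspace M - N) id
     \<in> iso (relative_homology_group 2 (subtopology M B) (B - N)) (relative_homology_group 2 M (topspace M - N))"
proof -
  have Bt: "B \<subseteq> topspace M" using B openin_subset by blast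
  have "M closure_of (topspace M - B) = topspace M - B"
    using B by (intro closure_of_closedin) blast
  also have "\<dots> \<subseteq> topspace M - K" using K by blast
  also have "\<dots> \<subseteq> M interior_of (topspace M - N)"
    using K by (intro interior_of_maximal) auto
  finally have "M closure_of (topspace M - B) \<subseteq> M interior_of (topspace M - N)" .
  from homology_excision_axiom[OF this, of "topspace M" 2]
  moreover have "topspace M - (topspace M - B) = B" "topspace M - N - (topspace M - B) = B - N"
    using Bt by auto
  ultimately show ?thesis by auto
qed

text \<open>The inverse of excision, so a local class at \<open>x\<close> can be represented inside
  any open \<open>B\<close> around \<open>x\<close>.\<close>

definition lift_class :: "'a topology \<Rightarrow> 'a set \<Rightarrow> 'a \<Rightarrow> 'a chain set \<Rightarrow> 'a chain set" where
  "lift_class M B x m = inv_into (carrier (relative_homology_group 2 (subtopology M B) (B - {x})))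
     (hom_induced 2 (subtopology M B) (B - {x}) M (topspace M - {x}) id) m"

text \<open>The class in \<open>H\<^sub>1\<close> of the circle of the map \<open>g\<close> restricted to a small loop around \<open>x\<close> that is
  oriented by the local homology class \<open>m\<close>.\<close>
definition local_dir :: "'a topology \<Rightarrow> 'a set \<Rightarrow> 'a \<Rightarrow> ('a \<Rightarrow> complex) \<Rightarrow> 'a chain set \<Rightarrow> (nat \<Rightarrow> real) chain set" where
  "local_dir M B x g m = dirmap (subtopology M (B - {x})) g
     (hom_boundary 2 (subtopology M B) (B - {x}) (lift_class M B x m))"

lemma lift_class:
  assumes H: "Hausdorff_space M" and B: "openin M B" "x \<in> B" and m: "m \<in> carrier (local_homology M {x})"
  shows "lift_class M B x m \<in> carrier (relative_homology_group 2 (subtopology M B) (B - {x}))"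
    and "hom_induced 2 (subtopology M B) (B - {x}) M (topspace M - {x}) id (lift_class M B x m) = m"
    and "\<And>b. b \<in> carrier (relative_homology_group 2 (subtopology M B) (B - {x})) \<Longrightarrow>
      hom_induced 2 (subtopology M B) (B - {x}) M (topspace M - {x}) id b = m \<Longrightarrow> lift_class M B x m = b"
proof -
  have "x \<in> topspace M" using B openin_subset by blast
  then have "closedin M {x}" using H by (simp add: Hausdorff_imp_t1_space closedin_t1_singleton)
  then have iso: "hom_induced 2 (subtopology M B) (B - {x}) M (topspace M - {x}) id
     \<in> iso (relative_homology_group 2 (subtopology M B) (B - {x})) (relative_homology_group 2 M (topspace M - {x}))"
    using B by (intro excision_iso[where K="{x}"]) auto
  then have bij: "bij_betw (hom_induced 2 (subtopology M B) (B - {x}) M (topspace M - {x}) id)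
      (carrier (relative_homology_group 2 (subtopology M B) (B - {x})))
      (carrier (relative_homology_group 2 M (topspace M - {x})))"
    by (simp add: iso_def)
  have m': "m \<in> hom_induced 2 (subtopology M B) (B - {x}) M (topspace M - {x}) id `
      carrier (relative_homology_group 2 (subtopology M B) (B - {x}))"
    using bij m unfolding local_homology_def bij_betw_def by simp
  show "lift_class M B x m \<in> carrier (relative_homology_group 2 (subtopology M B) (B - {x}))"
    unfolding lift_class_def by (rule inv_into_into[OF m'])
  show "hom_induced 2 (subtopology M B) (B - {x}) M (topspace M - {x}) id (lift_class M B x m) = m"
    unfolding lift_class_def by (rule f_inv_into_f[OF m'])
  show "lift_class M B x m = b"
    if "b \<in> carrier (relative_homology_group 2 (subtopology M B) (B - {x}))"
      "hom_induced 2 (subtopology M B) (B - {x}) M (topspace M - {x}) id b = m" for b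
    unfolding lift_class_def using that bij by (metis bij_betw_def inv_into_f_f)
qed

text \<open>By naturality of the boundary, any representative of \<open>m\<close> in a smaller pair
  gives the same direction class. With \<open>P\<close> a neighbourhood one class serves all its
  points at once; with \<open>P = {x}\<close> and \<open>B\<close> in two charts the charts can be
  compared.\<close>

lemma local_dir_eq:
  assumes H: "Hausdorff_space M" and U: "openin M U" "x \<in> U" and m: "m \<in> carrier (local_homology M {x})"
    and B: "B \<subseteq> U" "x \<in> P" "P \<subseteq> B"
    and c: "c \<in> carrier (relative_homology_group 2 (subtopology M B) (B - P))"
      "hom_induced 2 (subtopology M B) (B - P) M (topspace M - {x}) id c = m"
    and g: "nzmap (subtopology M (U - {x})) g"
  shows "local_dir M U x g m = dirmap (subtopology M (B - P)) g (hom_boundary 2 (subtopology M B) (B - P) c)"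
proof -
  have Ut: "U \<subseteq> topspace M" using U openin_subset by blast
  have i1: "continuous_map (subtopology M B) (subtopology M U) id"
    using B(1) by (auto simp: continuous_map_in_subtopology continuous_map_from_subtopology)
  have i2: "continuous_map (subtopology M U) M id" by (simp add: continuous_map_from_subtopology)
  have s1: "id \<in> B - P \<rightarrow> U - {x}" and s2: "id \<in> U - {x} \<rightarrow> topspace M - {x}" using B Ut by auto
  have "lift_class M U x m = hom_induced 2 (subtopology M B) (B - P) (subtopology M U) (U - {x}) id c"
  proof (rule lift_class(3)[OF H U m])
    show "hom_induced 2 (subtopology M B) (B - P) (subtopology M U) (U - {x}) id c
        \<in> carrier (relative_homology_group 2 (subtopology M U) (U - {x}))" by (rule hom_induced_carrier)
    show "hom_induced 2 (subtopology M U) (U - {x}) M (topspace M - {x}) id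
       (hom_induced 2 (subtopology M B) (B - P) (subtopology M U) (U - {x}) id c) = m"
      using hom_induced_compose'[OF i1 s1 i2 s2, of 2 c] c(2) by simp
  qed
  moreover have "hom_boundary 2 (subtopology M U) (U - {x})
        (hom_induced 2 (subtopology M B) (B - P) (subtopology M U) (U - {x}) id c)
      = hom_induced 1 (subtopology M (B - P)) {} (subtopology M (U - {x})) {} id
          (hom_boundary 2 (subtopology M B) (B - P) c)"
  proof -
    have "B \<inter> (B - P) = B - P" "U \<inter> (U - {x}) = U - {x}" by auto
    then show ?thesis
      using fun_cong[OF naturality_hom_induced[OF i1 s1, of 2], of c] by (simp add: subtopology_subtopology)
  qed
  moreover have "continuous_map (subtopology M (B - P)) (subtopology M (U - {x})) id"
    using B by (auto simp: continuous_map_in_subtopology continuous_map_from_subtopology)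
  from dirmap_natural[OF this g]
  have "dirmap (subtopology M (U - {x})) g (hom_induced 1 (subtopology M (B - P)) {} (subtopology M (U - {x})) {} id
          (hom_boundary 2 (subtopology M B) (B - P) c))
      = dirmap (subtopology M (B - P)) g (hom_boundary 2 (subtopology M B) (B - P) c)" by simp
  ultimately show ?thesis unfolding local_dir_def by simp
qed

lemma nzmap_subset:
  assumes "nzmap (subtopology M S) g" "T \<subseteq> S"
  shows "nzmap (subtopology M T) g"
  using assms continuous_map_from_subtopology_mono by blast

lemma nzmap_chart_diff:
  assumes "chart M U \<phi>" "x \<in> U"
  shows "nzmap (subtopology M (U - {x})) (\<lambda>z. \<phi> z - \<phi> x)"
proof -
  note ch = chart_props[OF assms(1)]
  have c: "continuous_map (subtopology M U) euclidean \<phi>"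
    using assms(1) by (simp add: chart_def homeomorphic_imp_continuous_map)
  then have "continuous_map (subtopology M (U - {x})) euclidean \<phi>"
    by (rule continuous_map_from_subtopology_mono) auto
  then have "continuous_map (subtopology M (U - {x})) euclidean (\<lambda>z. \<phi> z - \<phi> x)"
    using continuous_map_compose[of _ euclidean \<phi> euclidean "\<lambda>w. w - \<phi> x"]
    by (auto simp: o_def intro!: continuous_intros)
  moreover have "\<phi> z \<noteq> \<phi> x" if "z \<in> U" "z \<noteq> x" for z using ch(4) assms(2) that by (auto dest: inj_onD)
  ultimately show ?thesis by (auto simp: continuous_map_in_subtopology)
qed

text \<open>Excision carries the generator to the pair of \<open>U\<close> and
  \<open>U - {x}\<close>; the boundary is onto because \<open>U\<close> is contractible, and the
  direction map is onto in homology because it is a retraction. Surjective homomorphisms preserve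
  generators.\<close>

lemma local_dir_generates:
  assumes H: "Hausdorff_space M" and U: "chart M U \<phi>" and x: "x \<in> U"
    and m: "m \<in> carrier (local_homology M {x})" "subgroup_generated (local_homology M {x}) {m} = local_homology M {x}"
  shows "generates (homology_group 1 (nsphere 1)) (local_dir M U x (\<lambda>z. \<phi> z - \<phi> x) m)"
proof -
  note ch = chart_props[OF U]
  let ?G = "relative_homology_group 2 (subtopology M U) (U - {x})"
  have grp: "group (local_homology M {x})" by (simp add: local_homology_def)
  have gm: "generates (local_homology M {x}) m"
  proof -
    have "carrier (local_homology M {x}) = range (\<lambda>n::int. m [^]\<^bsub>local_homology M {x}\<^esub> n)"
      using group.carrier_subgroup_generated_by_singleton[OF grp m(1)] m(2) by simp
    then show ?thesis unfolding generates_def using m(1) by blast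
  qed
  have "x \<in> topspace M" using ch(2) x by blast
  then have "closedin M {x}" using H by (simp add: Hausdorff_imp_t1_space closedin_t1_singleton)
  then have iso: "hom_induced 2 (subtopology M U) (U - {x}) M (topspace M - {x}) id \<in> iso ?G (local_homology M {x})"
    unfolding local_homology_def using x by (intro excision_iso[where K="{x}"] ch(1)) auto
  define E where "E = hom_induced 2 (subtopology M U) (U - {x}) M (topspace M - {x}) id"
  have Ehom: "group_hom ?G (local_homology M {x}) E"
    using iso grp by (simp add: group_hom_def group_hom_axioms_def E_def iso_def)
  have inj: "inj_on E (carrier ?G)" using iso by (simp add: iso_def bij_betw_def E_def)
  define \<beta> where "\<beta> = lift_class M U x m"
  have \<beta>: "\<beta> \<in> carrier ?G" "E \<beta> = m" unfolding \<beta>_def E_def using lift_class(1,2)[OF H ch(1) x m(1)] by auto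
  have g\<beta>: "generates ?G \<beta>"
    unfolding generates_def
  proof (intro conjI ballI \<beta>(1))
    fix y assume y: "y \<in> carrier ?G"
    then have "E y \<in> carrier (local_homology M {x})" using Ehom by (simp add: group_hom.hom_closed)
    then obtain n :: int where "E y = m [^]\<^bsub>local_homology M {x}\<^esub> n" using gm unfolding generates_def by blast
    also have "\<dots> = E (\<beta> [^]\<^bsub>?G\<^esub> n)" using group_hom.hom_int_pow[OF Ehom \<beta>(1)] \<beta>(2) by simp
    finally have "E y = E (\<beta> [^]\<^bsub>?G\<^esub> n)" .
    moreover have "\<beta> [^]\<^bsub>?G\<^esub> n \<in> carrier ?G" using \<beta>(1) by (simp add: group.int_pow_closed)
    ultimately have "y = \<beta> [^]\<^bsub>?G\<^esub> n" using inj y by (meson inj_onD)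
    then show "\<exists>n::int. y = \<beta> [^]\<^bsub>?G\<^esub> n" by blast
  qed
  have subsub: "subtopology (subtopology M U) (U - {x}) = subtopology M (U - {x})"
    by (simp add: subtopology_subtopology Int_absorb1 Diff_subset)
  let ?K = "homology_group 1 (subtopology M (U - {x}))"
  define d where "d = hom_boundary 2 (subtopology M U) (U - {x})"
  have d: "d \<in> hom ?G ?K"
    using hom_boundary_hom[of 2 "subtopology M U" "U - {x}"] by (simp add: d_def subsub)
  have d_surj: "d ` carrier ?G = carrier ?K"
  proof -
    have "(subtopology M U) homeomorphic_space (euclidean :: complex topology)"
      using U unfolding chart_def homeomorphic_space by blast
    moreover have "contractible_space (euclidean :: complex topology)"
      using contractible_space_top_of_set[of "UNIV :: complex set"] by (simp add: convex_imp_contractible)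
    ultimately have "contractible_space (subtopology M U)"
      using homeomorphic_space_contractibility by blast
    then have "trivial_group (homology_group 1 (subtopology M U))"
      using trivial_reduced_homology_group_contractible_space[of "subtopology M U" 1]
        un_reduced_homology_group[of 1 "subtopology M U"] by simp
    then have t: "carrier (homology_group 1 (subtopology M U)) = {\<one>\<^bsub>homology_group 1 (subtopology M U)\<^esub>}"
      by (simp add: trivial_group_def)
    have "d ` carrier ?G = kernel ?K (homology_group 1 (subtopology M U))
        (hom_induced 1 (subtopology M (U - {x})) {} (subtopology M U) {} id)"
      using homology_exactness_axiom_2[of 2 "subtopology M U" "U - {x}"] by (simp add: d_def subsub)
    also have "\<dots> = carrier ?K"
      unfolding kernel_def using t hom_induced_carrier[of 1 "subtopology M (U - {x})" "{}" "subtopology M U" "{}" id] by auto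
    finally show ?thesis .
  qed
  have gd: "generates ?K (d \<beta>)" by (rule generates_hom[OF _ _ d d_surj g\<beta>]) auto
  define g where "g z = \<phi> z - \<phi> x" for z
  have g: "nzmap (subtopology M (U - {x})) g" unfolding g_def by (rule nzmap_chart_diff[OF U x])
  \<comment> \<open>The section of the direction map: the unit circle around \<open>\<phi> x\<close>
    in the chart plane.\<close>
  define s where "s v = chart_inv U \<phi> (\<phi> x + Complex (v 0) (v 1))" for v :: "nat \<Rightarrow> real"
  have retr: "retraction_map (subtopology M (U - {x})) (nsphere 1) (circle_dir \<circ> g)"
    unfolding retraction_map_def retraction_maps_def
  proof (intro exI[of _ s] conjI ballI)
    show "continuous_map (subtopology M (U - {x})) (nsphere 1) (circle_dir \<circ> g)"
      by (rule continuous_map_compose[OF g continuous_map_circle_dir])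
    have v: "(v 0)\<^sup>2 + (v 1)\<^sup>2 = 1" "\<And>i. i > 1 \<Longrightarrow> v i = 0" if "v \<in> topspace (nsphere 1)" for v
      using that by (auto simp: nsphere)
    have nz: "Complex (v 0) (v 1) \<noteq> 0" "norm (Complex (v 0) (v 1)) = 1" if "v \<in> topspace (nsphere 1)" for v
      using v(1)[OF that] by (auto simp: complex_eq_iff cmod_def)
    have "continuous_map (nsphere 1) euclidean (\<lambda>v. \<phi> x + Complex (v 0) (v 1))"
    proof (rule cont_at_imp_continuous_map)
      fix v assume v: "v \<in> topspace (nsphere 1)"
      have p: "cont_at (nsphere 1) (\<lambda>v. v k) v" for k
        by (rule continuous_map_imp_cont_at_topspace[OF continuous_map_nsphere_projection v])
      have "cont_at (nsphere 1) (\<lambda>v. \<phi> x + (of_real (v 0) + \<i> * of_real (v 1))) v"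
        by (intro cont_at_add cont_at_mult cont_at_const v cont_at_compose[OF p]) (auto intro!: continuous_intros)
      then show "cont_at (nsphere 1) (\<lambda>v. \<phi> x + Complex (v 0) (v 1)) v" by (simp add: Complex_eq)
    qed
    then have "continuous_map (nsphere 1) M (\<lambda>v. chart_inv U \<phi> (\<phi> x + Complex (v 0) (v 1)))"
      using continuous_map_compose[OF _ ch(8)] by (fastforce simp: o_def)
    moreover have "s v \<in> U - {x}" if "v \<in> topspace (nsphere 1)" for v
      using ch(5,6) nz(1)[OF that] unfolding s_def by (metis DiffI add_cancel_right_right singletonD)
    ultimately show "continuous_map (nsphere 1) (subtopology M (U - {x})) s"
      unfolding s_def by (auto simp: continuous_map_in_subtopology)
    show "(circle_dir \<circ> g) (s v) = v" if vt: "v \<in> topspace (nsphere 1)" for v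
    proof
      fix i
      have "g (s v) = Complex (v 0) (v 1)" by (simp add: g_def s_def ch(6))
      then show "(circle_dir \<circ> g) (s v) i = v i"
        using nz(2)[OF vt] v(2)[OF vt, of i] by (auto simp: circle_dir_def)
    qed
  qed
  have "generates (homology_group 1 (nsphere 1)) (dirmap (subtopology M (U - {x})) g (d \<beta>))"
    by (rule generates_hom[OF _ _ _ _ gd])
       (use surj_hom_induced_retraction_map[OF retr, of 1] hom_induced_hom in \<open>auto simp: dirmap_def\<close>)
  then show ?thesis by (simp add: local_dir_def d_def \<beta>_def g_def[abs_def])
qed

lemma cont_at_imp_continuous_map_subtopology:
  fixes f :: "'a \<Rightarrow> 'b::topological_space"
  assumes "\<And>x. x \<in> S \<Longrightarrow> cont_at M f x"
  shows "continuous_map (subtopology M S) euclidean f"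
proof (rule cont_at_imp_continuous_map)
  fix x assume x: "x \<in> topspace (subtopology M S)"
  then have c: "cont_at M f x" using assms by simp
  show "cont_at (subtopology M S) f x"
    unfolding cont_at_topological
  proof (intro conjI allI impI x)
    fix V assume "open V \<and> f x \<in> V"
    then obtain A where "openin M A" "x \<in> A" "f ` A \<subseteq> V" using c unfolding cont_at_topological by blast
    then show "\<exists>A. openin (subtopology M S) A \<and> x \<in> A \<and> f ` A \<subseteq> V"
      using x by (intro exI[of _ "A \<inter> S"]) (auto simp: openin_subtopology)
  qed
qed

lemma chart_continuous:
  assumes "chart M U \<phi>"
  shows "continuous_map (subtopology M U) euclidean \<phi>"
  using assms homeomorphic_imp_continuous_map unfolding chart_def by blast

text \<open>One class on a disc \<open>N\<close> restricts to all \<open>\<mu> y\<close> with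
  \<open>y\<close> in \<open>N\<close>, and its boundary lies in \<open>U - N\<close>. There the
  coordinate differences from \<open>x\<close> and from \<open>y\<close> have a quotient with a
  continuous logarithm.\<close>

lemma local_dir_locally_constant:
  assumes H: "Hausdorff_space M" and \<mu>: "surface_orientation M \<mu>" and U: "chart M U \<phi>" and x: "x \<in> U"
  obtains N where "openin M N" "x \<in> N" "N \<subseteq> U"
    "\<And>y. y \<in> N \<Longrightarrow> local_dir M U y (\<lambda>z. \<phi> z - \<phi> y) (\<mu> y) = local_dir M U x (\<lambda>z. \<phi> z - \<phi> x) (\<mu> x)"
proof -
  note ch = chart_props[OF U]
  have xt: "x \<in> topspace M" using ch(2) x by blast
  obtain U0 \<alpha> where U0: "openin M U0" "x \<in> U0" and \<alpha>: "\<alpha> \<in> carrier (local_homology M U0)"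
    "\<And>y. y \<in> U0 \<Longrightarrow> hom_induced 2 M (topspace M - U0) M (topspace M - {y}) id \<alpha> = \<mu> y"
  proof -
    have "\<exists>U. openin M U \<and> x \<in> U \<and> (\<exists>\<alpha> \<in> carrier (local_homology M U). \<forall>y \<in> U.
           hom_induced 2 M (topspace M - U) M (topspace M - {y}) id \<alpha> = \<mu> y)"
      using \<mu> xt unfolding surface_orientation_def by simp
    then show ?thesis
      by (elim exE conjE bexE) (rule that, assumption, assumption, assumption, erule (1) bspec)
  qed
  obtain r where r: "r > 0" "{y \<in> U. \<phi> y \<in> cball (\<phi> x) r} \<subseteq> U0"
    using chart_small_ball[OF U U0 x] by blast
  \<comment> \<open>The open disc carries the common class, and the closed disc \<open>K\<close> is
    what excision requires between \<open>N\<close> and \<open>U\<close>.\<close>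
  define N where "N = {y \<in> U. \<phi> y \<in> ball (\<phi> x) r}"
  define K where "K = {y \<in> U. \<phi> y \<in> cball (\<phi> x) r}"
  have N: "openin M N" unfolding N_def by (rule chart_open_vimage[OF U]) simp
  have K: "closedin M K" unfolding K_def by (rule chart_closed_vimage[OF U H]) simp
  have NK: "N \<subseteq> K" "K \<subseteq> U" "K \<subseteq> U0" using r by (auto simp: N_def K_def)
  have xN: "x \<in> N" using x r by (simp add: N_def)
  define \<alpha>' where "\<alpha>' = hom_induced 2 M (topspace M - U0) M (topspace M - N) id \<alpha>"
  have iso: "hom_induced 2 (subtopology M U) (U - N) M (topspace M - N) id
     \<in> iso (relative_homology_group 2 (subtopology M U) (U - N)) (relative_homology_group 2 M (topspace M - N))"
    by (rule excision_iso[OF ch(1) K NK(1,2)])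
  have "\<alpha>' \<in> carrier (relative_homology_group 2 M (topspace M - N))"
    unfolding \<alpha>'_def by (rule hom_induced_carrier)
  then have "\<alpha>' \<in> hom_induced 2 (subtopology M U) (U - N) M (topspace M - N) id `
      carrier (relative_homology_group 2 (subtopology M U) (U - N))"
    using iso by (simp add: iso_def bij_betw_def)
  then obtain \<gamma> where \<gamma>: "\<gamma> \<in> carrier (relative_homology_group 2 (subtopology M U) (U - N))"
    "hom_induced 2 (subtopology M U) (U - N) M (topspace M - N) id \<gamma> = \<alpha>'" by (elim imageE) simp
  have \<gamma>y: "hom_induced 2 (subtopology M U) (U - N) M (topspace M - {y}) id \<gamma> = \<mu> y" if y: "y \<in> N" for y
  proof -
    have c1: "continuous_map (subtopology M U) M id" by (simp add: continuous_map_from_subtopology)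
    have s: "id \<in> U - N \<rightarrow> topspace M - N" "id \<in> topspace M - N \<rightarrow> topspace M - {y}"
      "id \<in> topspace M - U0 \<rightarrow> topspace M - N"
      using ch(2) y NK by auto
    have "hom_induced 2 (subtopology M U) (U - N) M (topspace M - {y}) id \<gamma>
       = hom_induced 2 M (topspace M - N) M (topspace M - {y}) id \<alpha>'"
      using hom_induced_compose'[OF c1 s(1) continuous_map_id s(2), of 2 \<gamma>] \<gamma>(2) by simp
    also have "\<dots> = hom_induced 2 M (topspace M - U0) M (topspace M - {y}) id \<alpha>"
      unfolding \<alpha>'_def using hom_induced_compose'[OF continuous_map_id[of M] s(3) continuous_map_id s(2), of 2 \<alpha>] by simp
    also have "\<dots> = \<mu> y" using \<alpha>(2) y NK by blast
    finally show ?thesis .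
  qed
  define D where "D y = dirmap (subtopology M (U - N)) (\<lambda>z. \<phi> z - \<phi> y) (hom_boundary 2 (subtopology M U) (U - N) \<gamma>)" for y
  have 1: "local_dir M U y (\<lambda>z. \<phi> z - \<phi> y) (\<mu> y) = D y" if y: "y \<in> N" for y
  proof -
    have yU: "y \<in> U" using y NK by blast
    have "\<mu> y \<in> carrier (local_homology M {y})"
      using \<mu> ch(2) yU unfolding surface_orientation_def by blast
    then show ?thesis unfolding D_def
      by (rule local_dir_eq[OF H ch(1) yU _ order_refl y _ \<gamma>(1) \<gamma>y[OF y] nzmap_chart_diff[OF U yU]])
         (use NK in blast)
  qed
  have 2: "D y = D x" if y: "y \<in> N" for y
  proof -
    \<comment> \<open>Both centres lie in the ball, so for \<open>w\<close> outside it the quotient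
      avoids the cut of \<open>Ln\<close>.\<close>
    define h where "h w = Ln ((w - \<phi> y) / (w - \<phi> x))" for w
    have b: "\<phi> y \<in> ball (\<phi> x) r" "\<phi> x \<in> ball (\<phi> x) r" using y r by (auto simp: N_def)
    have nx: "w - \<phi> x \<noteq> 0" "w - \<phi> y \<noteq> 0" if "w \<notin> ball (\<phi> x) r" for w using that b by auto
    have "continuous_on (- ball (\<phi> x) r) h"
      unfolding h_def using nx quotient_notin_nonpos_Reals[OF b] by (intro continuous_intros) auto
    then have hc: "continuous_map (top_of_set (- ball (\<phi> x) r)) euclidean h" by simp
    have "continuous_map (subtopology M (U - N)) euclidean \<phi>"
      by (rule continuous_map_from_subtopology_mono[OF chart_continuous[OF U]]) auto
    then have pc: "continuous_map (subtopology M (U - N)) (top_of_set (- ball (\<phi> x) r)) \<phi>"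
      by (auto simp: continuous_map_in_subtopology N_def)
    have L: "continuous_map (subtopology M (U - N)) euclidean (\<lambda>z. h (\<phi> z))"
      using continuous_map_compose[OF pc hc] by (simp add: o_def)
    have "nzmap (subtopology M (U - N)) (\<lambda>z. \<phi> z - \<phi> x)"
      by (rule nzmap_subset[OF nzmap_chart_diff[OF U x]]) (use xN in auto)
    from dirmap_eq_of_log[OF this L, of "\<lambda>z. \<phi> z - \<phi> y"] show ?thesis
    proof -
      assume *: "(\<And>z. z \<in> topspace (subtopology M (U - N)) \<Longrightarrow> \<phi> z - \<phi> y = (\<phi> z - \<phi> x) * exp (h (\<phi> z)))
         \<Longrightarrow> dirmap (subtopology M (U - N)) (\<lambda>z. \<phi> z - \<phi> y) = dirmap (subtopology M (U - N)) (\<lambda>z. \<phi> z - \<phi> x)"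
      have "\<phi> z - \<phi> y = (\<phi> z - \<phi> x) * exp (h (\<phi> z))" if "z \<in> topspace (subtopology M (U - N))" for z
      proof -
        have "\<phi> z \<notin> ball (\<phi> x) r" using that by (auto simp: N_def)
        then show ?thesis using nx[of "\<phi> z"] by (simp add: h_def exp_Ln)
      qed
      from *[OF this] show ?thesis by (simp add: D_def)
    qed
  qed
  show ?thesis
  proof (rule that[OF N xN])
    show "N \<subseteq> U" using NK by blast
    show "local_dir M U y (\<lambda>z. \<phi> z - \<phi> y) (\<mu> y) = local_dir M U x (\<lambda>z. \<phi> z - \<phi> x) (\<mu> x)"
      if "y \<in> N" for y using 1[OF that] 1[OF xN] 2[OF that] by (simp only:)
  qed
qed

text \<open>Locally constant on \<open>U\<close>, and the chart makes \<open>U\<close> a copy of the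
  connected plane.\<close>

lemma local_dir_constant:
  assumes H: "Hausdorff_space M" and \<mu>: "surface_orientation M \<mu>" and U: "chart M U \<phi>" and xy: "x \<in> U" "y \<in> U"
  shows "local_dir M U x (\<lambda>z. \<phi> z - \<phi> x) (\<mu> x) = local_dir M U y (\<lambda>z. \<phi> z - \<phi> y) (\<mu> y)"
proof -
  note ch = chart_props[OF U]
  define e where "e x = local_dir M U x (\<lambda>z. \<phi> z - \<phi> x) (\<mu> x)" for x
  have "e (chart_inv U \<phi> (\<phi> x)) = e (chart_inv U \<phi> (\<phi> y))"
  proof (rule connected_local_const[where A=UNIV and f="\<lambda>w. e (chart_inv U \<phi> w)"])
    show "\<forall>w\<in>UNIV. \<forall>\<^sub>F v in at w within UNIV. e (chart_inv U \<phi> w) = e (chart_inv U \<phi> v)"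
    proof
      fix w :: complex
      obtain N where N: "openin M N" "chart_inv U \<phi> w \<in> N" "N \<subseteq> U" "\<And>y. y \<in> N \<Longrightarrow> e y = e (chart_inv U \<phi> w)"
        using local_dir_locally_constant[OF H \<mu> U ch(5)[of w]] unfolding e_def by blast
      have "open (\<phi> ` (N \<inter> U))" by (rule ch(9)[OF N(1)])
      moreover have "w \<in> \<phi> ` (N \<inter> U)" using N(2) ch(5,6) by (metis IntI imageI)
      moreover have "e (chart_inv U \<phi> w) = e (chart_inv U \<phi> v)" if "v \<in> \<phi> ` (N \<inter> U)" for v
        using that ch(7) N(4) by auto
      ultimately show "\<forall>\<^sub>F v in at w within UNIV. e (chart_inv U \<phi> w) = e (chart_inv U \<phi> v)"
        unfolding eventually_at_topological by blast
    qed
  qed auto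
  then show ?thesis using ch(7) xy by (simp add: e_def)
qed

text \<open>The transition map is injective, so its local degree is 1 or -1. In the second case the
  direction of one chart is homotopic to the reflected direction of the other, and a generator of an
  infinite cyclic group would equal its inverse.\<close>

lemma orientation_compatible:
  assumes H: "Hausdorff_space M" and U: "chart M U \<phi>" and V: "chart M V \<psi>" and x: "x \<in> U" "x \<in> V"
    and m: "m \<in> carrier (local_homology M {x})" "subgroup_generated (local_homology M {x}) {m} = local_homology M {x}"
    and eq: "local_dir M U x (\<lambda>z. \<phi> z - \<phi> x) m = local_dir M V x (\<lambda>z. \<psi> z - \<psi> x) m"
  shows "\<exists>W \<kappa>. openin M W \<and> x \<in> W \<and>
     (\<forall>z\<in>W-{x}. cont_at M \<kappa> z \<and> \<phi> z - \<phi> x = (\<psi> z - \<psi> x) * exp (\<kappa> z :: complex))"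
proof -
  note cu = chart_props[OF U] and cv = chart_props[OF V]
  define \<Omega> where "\<Omega> = \<psi> ` (U \<inter> V)"
  define \<tau> where "\<tau> w = \<phi> (chart_inv V \<psi> w)" for w
  have \<Omega>: "open \<Omega>" "\<psi> x \<in> \<Omega>" unfolding \<Omega>_def using cv(9)[OF cu(1)] x by auto
  have inU: "chart_inv V \<psi> w \<in> U \<inter> V" if "w \<in> \<Omega>" for w using that cv(7) unfolding \<Omega>_def by auto
  have "continuous_on \<Omega> \<tau>" unfolding \<tau>_def
    by (rule continuous_on_compose_cont_at[where M=M])
       (use inU cu(3) cv(8) in \<open>auto intro: continuous_map_from_subtopology\<close>)
  moreover have "inj_on \<tau> \<Omega>"
  proof (rule inj_onI)
    fix v w assume vw: "v \<in> \<Omega>" "w \<in> \<Omega>" "\<tau> v = \<tau> w"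
    then have "chart_inv V \<psi> v = chart_inv V \<psi> w" using inU cu(4) unfolding \<tau>_def by (meson IntD1 inj_onD)
    then show "v = w" using cv(6) by metis
  qed
  ultimately obtain k :: int and r \<kappa> where k: "k = 1 \<or> k = -1" and r: "r > 0" "ball (\<psi> x) r \<subseteq> \<Omega>"
    and \<kappa>: "continuous_on (ball (\<psi> x) r - {\<psi> x}) \<kappa>"
    "\<And>w. w \<in> ball (\<psi> x) r - {\<psi> x} \<Longrightarrow> \<tau> w - \<tau> (\<psi> x) = (w - \<psi> x) powi k * exp (\<kappa> w)"
    using injective_local_degree[OF \<Omega>] by metis
  define W where "W = {z \<in> V. \<psi> z \<in> ball (\<psi> x) r}"
  have W: "openin M W" unfolding W_def by (rule chart_open_vimage[OF V]) simp
  have xW: "x \<in> W" using x r by (simp add: W_def)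
  have WV: "W \<subseteq> V" by (auto simp: W_def)
  have WU: "W \<subseteq> U"
  proof
    fix z assume z: "z \<in> W"
    then have "\<psi> z \<in> \<Omega>" using r by (auto simp: W_def)
    then show "z \<in> U" using inU[of "\<psi> z"] cv(7)[of z] z WV by auto
  qed
  have pz: "\<psi> z \<in> ball (\<psi> x) r - {\<psi> x}" if "z \<in> W - {x}" for z
    using that cv(4) x(2) by (auto simp: W_def dest: inj_onD)
  have eqz: "\<phi> z - \<phi> x = (\<psi> z - \<psi> x) powi k * exp (\<kappa> (\<psi> z))" if z: "z \<in> W - {x}" for z
  proof -
    have "z \<in> V" using z WV by blast
    then show ?thesis using \<kappa>(2)[OF pz[OF z]] cv(7) x(2) by (simp add: \<tau>_def)
  qed
  have kc: "cont_at M (\<lambda>z. \<kappa> (\<psi> z)) z" if z: "z \<in> W - {x}" for z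
  proof (rule cont_at_compose_on[OF _ \<kappa>(1)])
    show "cont_at M \<psi> z" using z WV cv(3) by blast
    show "open (ball (\<psi> x) r - {\<psi> x})" by (simp add: open_delete)
  qed (rule pz[OF z])
  show ?thesis
  proof (cases "k = 1")
    case True
    then show ?thesis using W xW kc eqz by (intro exI[of _ W] exI[of _ "\<lambda>z. \<kappa> (\<psi> z)"]) simp
  next
    case False
    then have k1: "k = -1" using k by simp
    let ?H = "homology_group 1 (nsphere 1)"
    define d where "d = hom_boundary 2 (subtopology M W) (W - {x}) (lift_class M W x m)"
    \<comment> \<open>Both charts are evaluated on the same boundary class \<open>d\<close>, which
      lives in the common part \<open>W - {x}\<close>.\<close>
    note lc = lift_class(1,2)[OF H W xW m(1)]
    have dU: "local_dir M U x (\<lambda>z. \<phi> z - \<phi> x) m = dirmap (subtopology M (W - {x})) (\<lambda>z. \<phi> z - \<phi> x) d"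
      unfolding d_def
      by (rule local_dir_eq[OF H cu(1) x(1) m(1) WU _ _ lc nzmap_chart_diff[OF U x(1)]]) (use xW in auto)
    have dV: "local_dir M V x (\<lambda>z. \<psi> z - \<psi> x) m = dirmap (subtopology M (W - {x})) (\<lambda>z. \<psi> z - \<psi> x) d"
      unfolding d_def
      by (rule local_dir_eq[OF H cv(1) x(2) m(1) WV _ _ lc nzmap_chart_diff[OF V x(2)]]) (use xW in auto)
    define v where "v z = \<psi> z - \<psi> x" for z
    have nzv: "nzmap (subtopology M (W - {x})) v"
      unfolding v_def[abs_def] by (rule nzmap_subset[OF nzmap_chart_diff[OF V x(2)]]) (use WV in auto)
    have vz: "v z \<noteq> 0" if "z \<in> W - {x}" for z using pz[OF that] by (simp add: v_def)
    \<comment> \<open>From \<open>1 / v = cnj v / (norm v)\<^sup>2\<close>: the logarithm of the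
      squared norm is divided out, and \<open>- \<i> * pi\<close> supplies the sign of
      \<open>- cnj v\<close>.\<close>
    define L where "L z = \<kappa> (\<psi> z) - of_real (2 * ln (norm (v z))) - \<i> * of_real pi" for z
    have "cont_at M L z" if z: "z \<in> W - {x}" for z
    proof -
      have zt: "z \<in> topspace M" using z W openin_subset by blast
      have "cont_at M v z" unfolding v_def[abs_def] using z WV cv(3) zt by (intro cont_at_diff cont_at_const) auto
      then have "cont_at M (\<lambda>z. complex_of_real (2 * ln (norm (v z)))) z"
        by (rule cont_at_compose) (use vz[OF z] in \<open>auto intro!: continuous_intros\<close>)
      then show ?thesis unfolding L_def using kc[OF z] zt by (intro cont_at_diff cont_at_const)
    qed
    then have Lc: "continuous_map (subtopology M (W - {x})) euclidean L"
      by (rule cont_at_imp_continuous_map_subtopology)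
    have nzR: "nzmap (subtopology M (W - {x})) (\<lambda>z. - cnj (v z))"
    proof -
      have "continuous_map (top_of_set (- {0})) (top_of_set (- {0})) (\<lambda>z::complex. - cnj z)"
        by (auto simp: continuous_map_in_subtopology intro!: continuous_intros)
      from continuous_map_compose[OF nzv this] show ?thesis by (simp add: o_def)
    qed
    have "dirmap (subtopology M (W - {x})) (\<lambda>z. \<phi> z - \<phi> x) = dirmap (subtopology M (W - {x})) (\<lambda>z. - cnj (v z))"
    proof (rule dirmap_eq_of_log[OF nzR Lc])
      fix z assume "z \<in> topspace (subtopology M (W - {x}))"
      then have z: "z \<in> W - {x}" by simp
      have "exp (complex_of_real (2 * ln (norm (v z)))) = of_real ((norm (v z))\<^sup>2)"
        using vz[OF z] by (simp add: exp_of_real exp_double flip: of_real_power)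
      also have "\<dots> = v z * cnj (v z)" using complex_norm_square by blast
      finally have "exp (L z) = - exp (\<kappa> (\<psi> z)) / (v z * cnj (v z))"
        by (simp add: L_def exp_diff)
      then have "- cnj (v z) * exp (L z) = exp (\<kappa> (\<psi> z)) / v z" using vz[OF z] by (simp add: field_simps)
      also have "\<dots> = \<phi> z - \<phi> x" using eqz[OF z] k1 by (simp add: v_def power_int_minus field_simps)
      finally show "\<phi> z - \<phi> x = - cnj (v z) * exp (L z)" by simp
    qed
    then have "local_dir M U x (\<lambda>z. \<phi> z - \<phi> x) m = inv\<^bsub>?H\<^esub> (local_dir M V x (\<lambda>z. \<psi> z - \<psi> x) m)"
      using dirmap_reflect[OF nzv, of d] unfolding dU dV v_def by simp
    then have "local_dir M V x (\<lambda>z. \<psi> z - \<psi> x) m = inv\<^bsub>?H\<^esub> (local_dir M V x (\<lambda>z. \<psi> z - \<psi> x) m)"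
      using eq by simp
    then have False
      using infinite_cyclic_generators(2)[OF _ homology_circle_integer local_dir_generates[OF H V x(2) m]] by simp
    then show ?thesis ..
  qed
qed

lemma homeomorphic_Euclidean_space_2_complex: "Euclidean_space 2 homeomorphic_space (euclidean :: complex topology)"
proof -
  define f where "f v = Complex (v 0) (v 1)" for v :: "nat \<Rightarrow> real"
  define g where "g z = (\<lambda>i::nat. if i = 0 then Re z else if i = 1 then Im z else 0)" for z
  have "continuous_map (Euclidean_space 2) euclidean f"
  proof (rule cont_at_imp_continuous_map)
    fix v assume v: "v \<in> topspace (Euclidean_space 2)"
    have "continuous_map (Euclidean_space 2) euclideanreal (\<lambda>v. v k)" for k
      unfolding Euclidean_space_def by (intro continuous_map_from_subtopology continuous_map_product_projection) simp
    then have p: "cont_at (Euclidean_space 2) (\<lambda>v. v k) v" for k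
      using continuous_map_imp_cont_at_topspace[OF _ v] by blast
    have "cont_at (Euclidean_space 2) (\<lambda>v. complex_of_real (v 0) + \<i> * of_real (v 1)) v"
      by (intro cont_at_add cont_at_mult cont_at_const v cont_at_compose[OF p]) (auto intro!: continuous_intros)
    then show "cont_at (Euclidean_space 2) f v" by (simp add: f_def[abs_def] Complex_eq)
  qed
  moreover have "continuous_map euclidean (Euclidean_space 2) g"
    unfolding Euclidean_space_def continuous_map_in_subtopology
  proof
    have "continuous_on UNIV (\<lambda>z. g z i)" for i
      unfolding g_def by (cases "i = 0"; cases "i = 1") (auto intro!: continuous_intros)
    then show "continuous_map euclidean (powertop_real UNIV) g"
      by (simp add: continuous_map_componentwise_UNIV)
  qed (auto simp: g_def)
  moreover have "g (f v) = v" if "v \<in> topspace (Euclidean_space 2)" for v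
    using that by (auto simp: f_def g_def topspace_Euclidean_space fun_eq_iff)
  moreover have "f (g z) = z" for z by (simp add: f_def g_def complex_eq_iff)
  ultimately show ?thesis unfolding homeomorphic_space_def homeomorphic_maps_def by auto
qed

lemma chart_reflect:
  assumes "chart M U \<phi>"
  shows "chart M U (\<lambda>z. - cnj (\<phi> z))"
proof -
  have "homeomorphic_maps euclidean euclidean (\<lambda>z::complex. - cnj z) (\<lambda>z. - cnj z)"
    by (auto simp: homeomorphic_maps_def intro!: continuous_intros)
  then have "homeomorphic_map euclidean euclidean (\<lambda>z::complex. - cnj z)"
    using homeomorphic_map_maps by blast
  from homeomorphic_map_compose[OF _ this] show ?thesis
    using assms by (auto simp: chart_def o_def)
qed

text \<open>The atlas consists of the charts whose direction class is one fixed generator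
  \<open>e0\<close>. Any other chart has the inverse class, so its reflection belongs to the atlas;
  constancy on \<open>U\<close> reduces this to one point.\<close>

lemma oriented_surface_exists:
  assumes M: "surface M" and or: "orientable M"
  shows "\<exists>\<A>. oriented_surface M \<A>"
proof -
  have H: "Hausdorff_space M" using M by (simp add: surface_def)
  obtain \<mu> where \<mu>: "surface_orientation M \<mu>" using or by (auto simp: orientable_def)
  have \<mu>m: "\<mu> x \<in> carrier (local_homology M {x})" "subgroup_generated (local_homology M {x}) {\<mu> x} = local_homology M {x}"
    if "x \<in> topspace M" for x using \<mu> that unfolding surface_orientation_def by auto
  let ?H = "homology_group 1 (nsphere 1)"
  have gH: "group ?H" by simp
  define e where "e U \<phi> x = local_dir M U x (\<lambda>z. \<phi> z - \<phi> x) (\<mu> x)" for U \<phi> x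
  have gen: "generates ?H (e U \<phi> x)" if "chart M U \<phi>" "x \<in> U" for U \<phi> x
    unfolding e_def using that chart_props(2)[OF that(1)] by (intro local_dir_generates[OF H that] \<mu>m) auto
  have reflect: "e U (\<lambda>z. - cnj (\<phi> z)) x = inv\<^bsub>?H\<^esub> (e U \<phi> x)" if "chart M U \<phi>" "x \<in> U" for U \<phi> x
  proof -
    have "(\<lambda>z. - cnj (\<phi> z) - - cnj (\<phi> x)) = (\<lambda>z. - cnj (\<phi> z - \<phi> x))" by auto
    then show ?thesis unfolding e_def local_dir_def using dirmap_reflect[OF nzmap_chart_diff[OF that]] by simp
  qed
  obtain e0 where e0: "generates ?H e0"
  proof -
    obtain a where "a \<in> carrier ?H" "subgroup_generated ?H {a} = ?H"
      using cyclic_reduced_homology_group_nsphere[of 1 1] un_reduced_homology_group[of 1 "nsphere 1"]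
      by (auto simp: cyclic_group_def)
    then have "generates ?H a"
      unfolding generates_def using group.carrier_subgroup_generated_by_singleton[OF gH, of a] by auto
    then show ?thesis by (rule that)
  qed
  define \<A> where "\<A> = {(U, \<phi>). chart M U \<phi> \<and> (\<forall>x\<in>U. e U \<phi> x = e0)}"
  have "oriented_surface M \<A>"
  proof
    show "Hausdorff_space M" by (rule H)
    show "chart M U \<phi>" if "(U, \<phi>) \<in> \<A>" for U \<phi> using that by (simp add: \<A>_def)
    show "\<exists>(U, \<phi>)\<in>\<A>. x \<in> U" if x: "x \<in> topspace M" for x
    proof -
      obtain U where U: "openin M U" "x \<in> U" "subtopology M U homeomorphic_space Euclidean_space 2"
        using M x unfolding surface_def by blast
      have "subtopology M U homeomorphic_space (euclidean :: complex topology)"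
        by (rule homeomorphic_space_trans[OF U(3) homeomorphic_Euclidean_space_2_complex])
      then obtain \<phi> where \<phi>: "chart M U \<phi>" using U(1) unfolding homeomorphic_space chart_def by blast
      note \<phi>' = chart_reflect[OF \<phi>]
      have "e U \<phi> x = e0 \<or> e U \<phi> x = inv\<^bsub>?H\<^esub> e0"
        by (rule infinite_cyclic_generators(1)[OF gH homology_circle_integer e0 gen[OF \<phi> U(2)]])
      then have "e U \<phi> x = e0 \<or> e U (\<lambda>z. - cnj (\<phi> z)) x = e0"
        using reflect[OF \<phi> U(2)] e0 group.inv_inv[OF gH] by (auto simp: generates_def)
      then have "(U, \<phi>) \<in> \<A> \<or> (U, \<lambda>z. - cnj (\<phi> z)) \<in> \<A>"
        unfolding \<A>_def using local_dir_constant[OF H \<mu> \<phi> _ U(2)] local_dir_constant[OF H \<mu> \<phi>' _ U(2)] \<phi> \<phi>'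
        by (auto simp: e_def)
      then show ?thesis using U(2) by auto
    qed
    fix U \<phi> V \<psi> x assume A: "(U, \<phi>) \<in> \<A>" "(V, \<psi>) \<in> \<A>" "x \<in> U" "x \<in> V"
    have x: "x \<in> topspace M" using A chart_props(2)[of M U \<phi>] by (auto simp: \<A>_def)
    have "e U \<phi> x = e V \<psi> x" using A by (simp add: \<A>_def)
    then show "\<exists>W \<kappa>. openin M W \<and> x \<in> W \<and>
         (\<forall>z\<in>W-{x}. cont_at M \<kappa> z \<and> \<phi> z - \<phi> x = (\<psi> z - \<psi> x) * exp (\<kappa> z :: complex))"
      using A by (intro orientation_compatible[OF H _ _ A(3,4) \<mu>m[OF x]]) (auto simp: \<A>_def e_def)
  qed
  then show ?thesis by blast
qed

subsection \<open>The fundamental group\<close>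

lemma homotopic_loops_atE:
  assumes "homotopic_loops_at X x0 p q"
  obtains h where "continuous_map (top_of_set ({0..1} \<times> {0..1})) X h"
    "\<And>t. h (0::real, t::real) = p t" "\<And>t. h (1, t) = q t"
    "\<And>s. s \<in> {0..1} \<Longrightarrow> h (s, 0) = x0" "\<And>s. s \<in> {0..1} \<Longrightarrow> h (s, 1) = x0"
proof -
  obtain h where h: "continuous_map (prod_topology (top_of_set {0..1::real}) (top_of_set {0..1::real})) X h"
    "\<forall>t. h (0, t) = p t" "\<forall>t. h (1, t) = q t" "\<forall>s\<in>{0..1}. h (s, 0) = x0 \<and> h (s, 1) = x0"
    using assms unfolding homotopic_loops_at_def homotopic_with_def by auto
  have "prod_topology (top_of_set {0..1::real}) (top_of_set {0..1::real}) = top_of_set ({0..1} \<times> {0..1})"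
    by (simp add: prod_topology_subtopology euclidean_product_topology subtopology_subtopology Times_Int_Times)
  from h(1)[unfolded this] show ?thesis by (rule that) (use h(2-4) in auto)
qed

lemma homotopic_loops_at_dlog:
  assumes hom: "homotopic_loops_at M x0 p q" and f: "nonvanishing_on M (topspace M) f"
  shows "dlog 0 1 (\<lambda>t. f (p t)) = dlog 0 1 (\<lambda>t. f (q t))"
proof (rule homotopic_loops_atE[OF hom])
  fix h :: "real \<times> real \<Rightarrow> 'a"
  assume h: "continuous_map (top_of_set ({0..1} \<times> {0..1})) M h"
    "\<And>t. h (0, t) = p t" "\<And>t. h (1, t) = q t"
    "\<And>s. s \<in> {0..1} \<Longrightarrow> h (s, 0) = x0" "\<And>s. s \<in> {0..1} \<Longrightarrow> h (s, 1) = x0"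
  have ht: "h z \<in> topspace M" if "z \<in> {0..1} \<times> {0..1}" for z
    using h(1) that unfolding continuous_map_def by auto
  have "dlog 0 1 (\<lambda>t. f (h (0, t))) = dlog 0 1 (\<lambda>t. f (h (1, t)))"
  proof (rule dlog_homotopy[where H="\<lambda>z. f (h z)"])
    show "continuous_on ({0..1} \<times> {0..1}) (\<lambda>z. f (h z))"
      by (rule continuous_on_compose_cont_at[OF h(1)]) (use f ht in \<open>auto simp: nonvanishing_on_def\<close>)
    show "f (h z) \<noteq> 0" if "z \<in> {0..1} \<times> {0..1}" for z
      using f ht[OF that] by (auto simp: nonvanishing_on_def)
    show "f (h (s, 0)) = f x0" "f (h (s, 1)) = f x0" if "s \<in> {0..1}" for s using h(4,5) that by auto
  qed
  then show ?thesis by (simp add: h(2,3))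
qed

lemma homotopic_loops_at_refl: "p \<in> loops X x0 \<Longrightarrow> homotopic_loops_at X x0 p p"
  unfolding homotopic_loops_at_def loops_def pathin_def by auto

lemma homotopic_loops_at_sym: "homotopic_loops_at X x0 p q \<Longrightarrow> homotopic_loops_at X x0 q p"
  unfolding homotopic_loops_at_def by (simp add: homotopic_with_sym)

lemma homotopic_loops_at_trans:
  "homotopic_loops_at X x0 p q \<Longrightarrow> homotopic_loops_at X x0 q r \<Longrightarrow> homotopic_loops_at X x0 p r"
  unfolding homotopic_loops_at_def by (rule homotopic_with_trans)

lemma homotopic_loops_at_loop_join:
  assumes p: "homotopic_loops_at X x0 p p'" and q: "homotopic_loops_at X x0 q q'"
  shows "homotopic_loops_at X x0 (loop_join p q) (loop_join p' q')"
proof -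
  let ?I = "top_of_set {0..1::real}"
  let ?T = "prod_topology ?I ?I"
  obtain h where h: "continuous_map ?T X h" "\<forall>t. h (0, t) = p t" "\<forall>t. h (1, t) = p' t"
     "\<forall>s\<in>{0..1}. h (s, 0) = x0 \<and> h (s, 1) = x0"
    using p unfolding homotopic_loops_at_def homotopic_with_def by auto
  obtain k where k: "continuous_map ?T X k" "\<forall>t. k (0, t) = q t" "\<forall>t. k (1, t) = q' t"
     "\<forall>s\<in>{0..1}. k (s, 0) = x0 \<and> k (s, 1) = x0"
    using q unfolding homotopic_loops_at_def homotopic_with_def by auto
  define H where "H z = (if snd z \<le> 1/2 then h (fst z, 2 * snd z) else k (fst z, 2 * snd z - 1))" for z :: "real \<times> real"
  have T: "?T = top_of_set ({0..1} \<times> {0..1})"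
    by (simp add: prod_topology_subtopology euclidean_product_topology subtopology_subtopology Times_Int_Times)
  have "continuous_map ?T X H"
    unfolding H_def
  proof (rule continuous_map_cases_le)
    show "continuous_map ?T euclideanreal snd" "continuous_map ?T euclideanreal (\<lambda>z. 1/2)"
      unfolding T by (auto intro!: continuous_intros)
    have 1: "subtopology ?T {z \<in> topspace ?T. snd z \<le> 1/2} = top_of_set ({0..1} \<times> {0..1/2})"
      unfolding T subtopology_subtopology by (rule arg_cong[where f="top_of_set"]) auto
    have 2: "subtopology ?T {z \<in> topspace ?T. 1/2 \<le> snd z} = top_of_set ({0..1} \<times> {1/2..1})"
      unfolding T subtopology_subtopology by (rule arg_cong[where f="top_of_set"]) auto
    have "continuous_map (top_of_set ({0..1} \<times> {0..1/2})) ?T (\<lambda>z. (fst z, 2 * snd z))"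
      unfolding T by (auto simp: continuous_map_in_subtopology intro!: continuous_intros)
    from continuous_map_compose[OF this h(1)]
    show "continuous_map (subtopology ?T {z \<in> topspace ?T. snd z \<le> 1/2}) X (\<lambda>z. h (fst z, 2 * snd z))"
      unfolding 1 by (simp add: o_def)
    have "continuous_map (top_of_set ({0..1} \<times> {1/2..1})) ?T (\<lambda>z. (fst z, 2 * snd z - 1))"
      unfolding T by (auto simp: continuous_map_in_subtopology intro!: continuous_intros)
    from continuous_map_compose[OF this k(1)]
    show "continuous_map (subtopology ?T {z \<in> topspace ?T. 1/2 \<le> snd z}) X (\<lambda>z. k (fst z, 2 * snd z - 1))"
      unfolding 2 by (simp add: o_def)
    show "h (fst z, 2 * snd z) = k (fst z, 2 * snd z - 1)" if "z \<in> topspace ?T" "snd z = 1/2" for z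
    proof -
      have "fst z \<in> {0..1}" using that(1) unfolding T by auto
      then show ?thesis unfolding that(2) using h(4) k(4) by simp
    qed
  qed
  then show ?thesis
    unfolding homotopic_loops_at_def homotopic_with_def
    using h k by (intro exI[of _ H]) (auto simp: H_def loop_join_def fun_eq_iff)
qed

lemma loop_class_eq:
  assumes "homotopic_loops_at X x0 p q"
  shows "loop_class X x0 p = loop_class X x0 q"
  unfolding loop_class_def
proof (intro Collect_cong iffI)
  show "homotopic_loops_at X x0 q r" if "homotopic_loops_at X x0 p r" for r
    by (rule homotopic_loops_at_trans[OF homotopic_loops_at_sym[OF assms] that])
  show "homotopic_loops_at X x0 p r" if "homotopic_loops_at X x0 q r" for r
    by (rule homotopic_loops_at_trans[OF assms that])
qed

lemma loop_class_eq_iff: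
  assumes "p \<in> loops X x0" "q \<in> loops X x0"
  shows "loop_class X x0 p = loop_class X x0 q \<longleftrightarrow> homotopic_loops_at X x0 p q"
proof
  assume "loop_class X x0 p = loop_class X x0 q"
  moreover have "q \<in> loop_class X x0 q" using homotopic_loops_at_refl[OF assms(2)] by (simp add: loop_class_def)
  ultimately show "homotopic_loops_at X x0 p q" by (simp add: loop_class_def set_eq_iff)
next
  assume "homotopic_loops_at X x0 p q"
  then show "loop_class X x0 p = loop_class X x0 q" by (rule loop_class_eq)
qed

lemma loop_join_loops: "p \<in> loops X x0 \<Longrightarrow> q \<in> loops X x0 \<Longrightarrow> loop_join p q \<in> loops X x0"
  unfolding loops_def using pathin_loop_join[of X p q] by (auto simp: loop_join_def)

text \<open>Joining respects homotopy, so all sets in the union are equal; the union is not empty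
  because a loop represents its own class.\<close>

lemma mult_loop_class:
  assumes p: "p \<in> loops X x0" and q: "q \<in> loops X x0"
  shows "loop_class X x0 p \<otimes>\<^bsub>fundamental_group X x0\<^esub> loop_class X x0 q = loop_class X x0 (loop_join p q)"
proof -
  have sub: "loop_class X x0 (loop_join p' q') = loop_class X x0 (loop_join p q)"
    if "p' \<in> loop_class X x0 p" "q' \<in> loop_class X x0 q" for p' q'
  proof -
    have "homotopic_loops_at X x0 (loop_join p q) (loop_join p' q')"
      using that by (intro homotopic_loops_at_loop_join) (auto simp: loop_class_def)
    then show ?thesis by (rule loop_class_eq[symmetric])
  qed
  have "p \<in> loop_class X x0 p" "q \<in> loop_class X x0 q"
    using p q homotopic_loops_at_refl by (auto simp: loop_class_def)
  then have "(\<Union>p'\<in>loop_class X x0 p. \<Union>q'\<in>loop_class X x0 q. loop_class X x0 (loop_join p' q'))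
      = loop_class X x0 (loop_join p q)"
    using sub by blast
  then show ?thesis by (simp add: fundamental_group_def)
qed

text \<open>The reason is that any two homomorphisms from an infinite cyclic group to the integers are proportional.\<close>
lemma dlog_infinite_cyclic:
  assumes iso: "fundamental_group M x0 \<cong> integer_group"
    and f1: "nonvanishing_on M (topspace M) f1" and f2: "nonvanishing_on M (topspace M) f2"
    and a: "a \<in> loops M x0" "dlog 0 1 (\<lambda>t. f1 (a t)) = 0" and b: "b \<in> loops M x0" "dlog 0 1 (\<lambda>t. f1 (b t)) \<noteq> 0"
  shows "dlog 0 1 (\<lambda>t. f2 (a t)) = 0"
proof -
  let ?\<pi> = "fundamental_group M x0"
  obtain \<theta> where \<theta>: "\<theta> \<in> iso ?\<pi> integer_group" using iso by (auto simp: is_iso_def)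
  have carr: "carrier ?\<pi> = loop_class M x0 ` loops M x0" by (simp add: fundamental_group_def)
  have \<theta>_mult: "\<theta> (x \<otimes>\<^bsub>?\<pi>\<^esub> y) = \<theta> x + \<theta> y" if "x \<in> carrier ?\<pi>" "y \<in> carrier ?\<pi>" for x y
    using \<theta> that by (auto simp: iso_def hom_def)
  have inj: "inj_on \<theta> (carrier ?\<pi>)" and surj: "\<theta> ` carrier ?\<pi> = UNIV"
    using \<theta> by (auto simp: iso_def bij_betw_def)
  define c where "c p = \<theta> (loop_class M x0 p)" for p
  have cj: "c (loop_join p q) = c p + c q" if "p \<in> loops M x0" "q \<in> loops M x0" for p q
    using \<theta>_mult[of "loop_class M x0 p" "loop_class M x0 q"] mult_loop_class[OF that] that
    by (simp add: c_def carr)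
  have dlog_c: "dlog 0 1 (\<lambda>t. f (p t)) = dlog 0 1 (\<lambda>t. f (q t))"
    if "p \<in> loops M x0" "q \<in> loops M x0" "c p = c q" "nonvanishing_on M (topspace M) f" for p q f
  proof -
    have "loop_class M x0 p = loop_class M x0 q"
      using that inj unfolding c_def carr by (auto dest: inj_onD)
    then have "homotopic_loops_at M x0 p q" using loop_class_eq_iff[OF that(1,2)] by simp
    then show ?thesis using that(4) by (rule homotopic_loops_at_dlog)
  qed
  have "\<exists>p\<in>loops M x0. c p = k" for k
  proof -
    have "k \<in> \<theta> ` carrier ?\<pi>" using surj by simp
    then show ?thesis unfolding carr c_def by blast
  qed
  then obtain P where P: "\<And>k. P k \<in> loops M x0" "\<And>k. c (P k) = k" by metis
  \<comment> \<open>With \<open>P k\<close> in the class of the integer \<open>k\<close>, each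
    \<open>D f\<close> is an additive function on the integers, hence determined by its value at
    1.\<close>
  define D where "D f k = dlog 0 1 (\<lambda>t. f (P k t))" for f :: "'a \<Rightarrow> complex" and k
  have D_add: "D f (k + l) = D f k + D f l" if f: "nonvanishing_on M (topspace M) f" for f k l
  proof -
    have "D f (k + l) = dlog 0 1 (\<lambda>t. f (loop_join (P k) (P l) t))"
      unfolding D_def by (rule dlog_c[OF P(1) loop_join_loops[OF P(1) P(1)] _ f]) (simp add: P cj)
    also have "\<dots> = D f k + D f l"
      unfolding D_def by (rule dlog_loop_join[OF f]) (use P[of k] P[of l] in \<open>auto simp: loops_def\<close>)
    finally show ?thesis .
  qed
  have D_int: "D f k = of_int k * D f 1" if f: "nonvanishing_on M (topspace M) f" for f k
  proof -
    have D0: "D f 0 = 0" using D_add[OF f, of 0 0] by simp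
    have nat: "D f (int n) = of_nat n * D f 1" for n
      by (induction n) (use D0 D_add[OF f] in \<open>simp_all add: algebra_simps\<close>)
    show ?thesis
    proof (cases "k \<ge> 0")
      case True
      then show ?thesis using nat[of "nat k"] by simp
    next
      case False
      then obtain n where k: "k = - int n" by (metis int_cases2 of_nat_0_le_iff)
      have "D f k + D f (int n) = 0" using D_add[OF f, of k "int n"] D0 k by simp
      then have "D f k = - D f (int n)" by (simp only: eq_neg_iff_add_eq_0)
      also have "\<dots> = of_int k * D f 1" by (simp add: nat k)
      finally show ?thesis .
    qed
  qed
  have dl: "dlog 0 1 (\<lambda>t. f (p t)) = of_int (c p) * D f 1"
    if "p \<in> loops M x0" "nonvanishing_on M (topspace M) f" for p f
    using dlog_c[OF that(1) P(1)[of "c p"] _ that(2)] P(2) D_int[OF that(2), of "c p"] unfolding D_def by simp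
  \<comment> \<open>\<open>b\<close> shows that \<open>f1\<close> turns along the generator, so the
    vanishing along \<open>a\<close> forces the class of \<open>a\<close> to be 0, and then no
    function turns along \<open>a\<close>.\<close>
  have "D f1 1 \<noteq> 0" using dl[OF b(1) f1] b(2) by auto
  then have "c a = 0" using dl[OF a(1) f1] a(2) by simp
  then show ?thesis using dl[OF a(1) f2] by simp
qed

text \<open>Conjugation by a path from \<open>x0\<close>: the changes of logarithm along the path
  and its reverse cancel.\<close>

lemma loop_based_at:
  assumes conn: "path_connected_space M" and x0: "x0 \<in> topspace M" and g: "pathin M g" "g 1 = g 0"
  obtains p where "p \<in> loops M x0"
    "\<And>f. nonvanishing_on M (topspace M) f \<Longrightarrow> dlog 0 1 (\<lambda>t. f (p t)) = dlog 0 1 (\<lambda>t. f (g t))"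
proof -
  have "g 0 \<in> topspace M" using pathin_topspace[OF g(1), of 0] by simp
  then obtain d where d: "pathin M d" "d 0 = x0" "d 1 = g 0"
    using conn x0 unfolding path_connected_space_def by blast
  define e where "e t = d (1 - t)" for t
  have e: "pathin M e" unfolding e_def[abs_def] by (rule pathin_reverse[OF d(1)])
  have dg: "pathin M (loop_join d g)" using d g by (intro pathin_loop_join) auto
  have ends: "loop_join d g 0 = x0" "loop_join d g 1 = g 0" "e 0 = g 0" "e 1 = x0"
    using d g by (auto simp: loop_join_def e_def)
  show ?thesis
  proof (rule that[of "loop_join (loop_join d g) e"])
    show "loop_join (loop_join d g) e \<in> loops M x0"
      unfolding loops_def using pathin_loop_join[OF dg e] ends by (simp add: loop_join_def)
    fix f assume f: "nonvanishing_on M (topspace M) f"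
    have "dlog 0 1 (\<lambda>t. f (loop_join (loop_join d g) e t)) =
        (dlog 0 1 (\<lambda>t. f (d t)) + dlog 0 1 (\<lambda>t. f (g t))) + dlog 0 1 (\<lambda>t. f (e t))"
      using dlog_loop_join[OF f dg e] dlog_loop_join[OF f d(1) g(1)] d ends by simp
    also have "dlog 0 1 (\<lambda>t. f (e t)) = - dlog 0 1 (\<lambda>t. f (d t))"
      unfolding e_def by (rule dlog_path_reverse[OF f d(1)])
    finally show "dlog 0 1 (\<lambda>t. f (loop_join (loop_join d g) e t)) = dlog 0 1 (\<lambda>t. f (g t))" by simp
  qed
qed

lemma jordan_curve_parametrization:
  assumes "jordan_curve M K"
  obtains j where "continuous_map euclideanreal M j" "\<And>t. j (t + 1) = j t" "inj_on j {0..<1}" "range j = K"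
proof -
  obtain f where f: "embedding_map (nsphere 1) M f" "K = f ` topspace (nsphere 1)"
    using assms by (auto simp: jordan_curve_def)
  define c where "c t = (\<lambda>i::nat. if i = 0 then cos (2 * pi * t) else if i = 1 then sin (2 * pi * t) else 0)" for t :: real
  have cc: "continuous_map euclideanreal (nsphere 1) c"
    unfolding nsphere continuous_map_in_subtopology
  proof
    have "continuous_on UNIV (\<lambda>t. c t i)" for i
      unfolding c_def by (cases "i = 0"; cases "i = 1") (auto intro!: continuous_intros)
    then show "continuous_map euclideanreal (powertop_real UNIV) c"
      by (simp add: continuous_map_componentwise_UNIV)
  qed (auto simp: c_def)
  have cm: "continuous_map (nsphere 1) M f"
    using homeomorphic_imp_continuous_map[OF f(1)[unfolded embedding_map_def]] continuous_map_into_fulltopology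
    by blast
  have inj: "inj_on f (topspace (nsphere 1))"
    using f(1) by (simp add: embedding_map_def homeomorphic_eq_everything_map)
  have ct: "c t \<in> topspace (nsphere 1)" for t using cc unfolding continuous_map_def by auto
  show ?thesis
  proof (rule that[of "f \<circ> c"])
    show "continuous_map euclideanreal M (f \<circ> c)" by (rule continuous_map_compose[OF cc cm])
    have "2 * pi * (t + 1) = 2 * pi * t + 2 * pi" for t by (simp add: algebra_simps)
    then have "c (t + 1) = c t" for t unfolding c_def by (auto simp: fun_eq_iff)
    then show "(f \<circ> c) (t + 1) = (f \<circ> c) t" for t by simp
    show "inj_on (f \<circ> c) {0..<1}"
    proof (rule inj_onI)
      fix s t assume st: "s \<in> {0..<1}" "t \<in> {0..<1}" "(f \<circ> c) s = (f \<circ> c) t"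
      then have "c s = c t" using inj ct by (auto dest: inj_onD)
      then have "c s 0 = c t 0" "c s 1 = c t 1" by auto
      then have "sin (2 * pi * s) = sin (2 * pi * t) \<and> cos (2 * pi * s) = cos (2 * pi * t)" by (simp add: c_def)
      then obtain n :: int where "2 * pi * s = 2 * pi * t + 2 * pi * of_int n" using sin_cos_eq_iff by blast
      then have "2 * pi * s = 2 * pi * (t + of_int n)" by (simp add: algebra_simps)
      then have n: "s = t + of_int n" by simp
      then have "\<bar>of_int n :: real\<bar> < 1" using st by auto
      then have "n = 0" by linarith
      then show "s = t" using n by simp
    qed
    have "topspace (nsphere 1) \<subseteq> range c"
    proof
      fix v assume "v \<in> topspace (nsphere 1)"
      then have v: "(v 0)\<^sup>2 + (v 1)\<^sup>2 = 1" "\<And>i. i > 1 \<Longrightarrow> v i = 0" by (auto simp: nsphere)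
      obtain \<theta> where \<theta>: "v 0 = cos \<theta>" "v 1 = sin \<theta>" using sincos_total_2pi[OF v(1)] by metis
      have "v = c (\<theta> / (2 * pi))" using v(2) \<theta> by (auto simp: c_def fun_eq_iff)
      then show "v \<in> range c" by blast
    qed
    then have "topspace (nsphere 1) = range c" using ct by blast
    then have "K = f ` range c" using f(2) by simp
    then show "range (f \<circ> c) = K" by (simp only: image_comp)
  qed
qed

theorem lemma2p15:
  fixes M :: "'a topology" and x0 :: 'a
  assumes "surface M"
    and "orientable M"
    and "x0 \<in> topspace M"
    and "fundamental_group M x0 \<cong> integer_group"
  shows "dichotomic M"
  unfolding dichotomic_def
proof (intro allI impI notI)
  fix K assume K: "jordan_curve M K" and conn: "connected_space (subtopology M (topspace M - K))"
  obtain \<A> where A: "oriented_surface M \<A>" using oriented_surface_exists[OF assms(1,2)] by blast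
  obtain j where j: "continuous_map euclideanreal M j" "\<And>t. j (t + 1) = j t" "inj_on j {0..<1}" "range j = K"
    using jordan_curve_parametrization[OF K] by blast
  interpret oriented_surface M \<A> by (rule A)
  interpret jordan_curve_in_surface M \<A> j by unfold_locales (use j in auto)
  have conn': "connected_space (subtopology M (topspace M - J))" using conn j(4) by (simp add: J_def)
  obtain f1 g where f1: "nonvanishing_on M (topspace M) f1" "\<And>z. z \<in> J \<Longrightarrow> f1 z = -1"
    and g: "pathin M g" "g 1 = g 0" "dlog 0 1 (\<lambda>t. f1 (g t)) \<noteq> 0"
    using function_crossing_curve[OF conn'] by blast
  obtain f2 where f2: "nonvanishing_on M (topspace M) f2" "turning f2 \<noteq> 0"
    using function_turning_along_curve[OF conn'] by blast
  have "connected_space M" using assms(1) by (simp add: surface_def)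
  then have pc: "path_connected_space M"
    using path_connected_open_subset[OF openin_topspace] by simp
  have jp: "pathin M j" "j 1 = j 0"
    using j(1) periodic[of 0] by (auto simp: pathin_def continuous_map_from_subtopology)
  obtain a where a: "a \<in> loops M x0"
    "\<And>f. nonvanishing_on M (topspace M) f \<Longrightarrow> dlog 0 1 (\<lambda>t. f (a t)) = dlog 0 1 (\<lambda>t. f (j t))"
    using loop_based_at[OF pc assms(3) jp] by blast
  obtain b where b: "b \<in> loops M x0"
    "\<And>f. nonvanishing_on M (topspace M) f \<Longrightarrow> dlog 0 1 (\<lambda>t. f (b t)) = dlog 0 1 (\<lambda>t. f (g t))"
    using loop_based_at[OF pc assms(3) g(1,2)] by blast
  \<comment> \<open>\<open>f1\<close> is constant on the curve, so it has no turning there.\<close>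
  have "dlog 0 1 (\<lambda>t. f1 (j t)) = dlog 0 1 (\<lambda>t. - 1)" by (rule dlog_cong) (simp add: f1(2))
  also have "\<dots> = 0" by (rule dlog_const) auto
  finally have "dlog 0 1 (\<lambda>t. f1 (a t)) = 0" using a(2)[OF f1(1)] by simp
  \<comment> \<open>\<open>a\<close> is the curve and \<open>b\<close> the crossing loop, both moved
    to \<open>x0\<close>. Since \<open>f1\<close> turns along \<open>b\<close> only, proportionality
    forbids \<open>f2\<close> to turn along \<open>a\<close>.\<close>
  then have "dlog 0 1 (\<lambda>t. f2 (a t)) = 0"
    using dlog_infinite_cyclic[OF assms(4) f1(1) f2(1) a(1) _ b(1)] b(2)[OF f1(1)] g(3) by simp
  then show False using f2(2) a(2)[OF f2(1)] by (simp add: turning_def)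
qed

end
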